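(* Let $K$ be a field and let $G$ be a Cameron-Walker graph (finite, simple, without isolated vertices). The following conditions are equivalent. (a) $I(G)^{[k]}$ is Cohen-Macaulay for all $1\le k\le\nu(G)$. (b) $G$ is either $K_2$ or $K_3$ (the complete graph on $2$ or $3$ vertices, up to isomorphism).
   Context: $S$ is the polynomial ring over $K$ whose variables are the vertices of $G$, and $I(G)\subset S$ is the edge ideal of $G$, generated by the products $xy$ with $\{x,y\}\in E(G)$. A matching of $G$ is a set of pairwise disjoint edges; $\nu(G)$ is the maximum size of a matching. An induced matching of $G$ is a matching $M$ such that for any two distinct edges $e=\{a,b\}$, $e'=\{c,d\}$ in $M$ the induced subgraph of $G$ on $\{a,b,c,d\}$ consists of just the two disjoint edges $e$ and $e'$; $\mathrm{im}(G)$ is the maximum size of an induced matching. A graph $G$ is called a Cameron-Walker graph if $G$ is connected and $\nu(G)=\mathrm{im}(G)$. The $k$th matching power $I(G)^{[k]}$ is the ideal of $S$ generated by all products $u_1\cdots u_k$ where $u_1,\dots,u_k$ are minimal monomial generators of $I(G)$ with pairwise disjoint supports, i.e. by the products of the variables in the vertex sets of the $k$-matchings of $G$. An ideal $I\subset S$ is called Cohen-Macaulay if $S/I$ is a Cohen-Macaulay ring. *)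

theory Defs
  imports "HOL-Algebra.Ring_Divisibility" "HOL-Library.Poly_Mapping" "HOL-Library.Extended_Nat"
begin

section \<open>Cohen-Macaulay rings\<close>

subsection \<open>Localization\<close>

definition loc_rel :: "('a, 'b) ring_scheme \<Rightarrow> 'a set \<Rightarrow> (('a \<times> 'a) \<times> ('a \<times> 'a)) set" where
  "loc_rel R T = {((a, s), (b, t)). a \<in> carrier R \<and> b \<in> carrier R \<and> s \<in> T \<and> t \<in> T \<and>
     (\<exists>u\<in>T. u \<otimes>\<^bsub>R\<^esub> (t \<otimes>\<^bsub>R\<^esub> a) = u \<otimes>\<^bsub>R\<^esub> (s \<otimes>\<^bsub>R\<^esub> b))}"

definition loc_frac :: "('a, 'b) ring_scheme \<Rightarrow> 'a set \<Rightarrow> 'a \<Rightarrow> 'a \<Rightarrow> ('a \<times> 'a) set" where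
  "loc_frac R T a s = loc_rel R T `` {(a, s)}"

text \<open>
  The ring of fractions of \<open>R\<close> with denominators in a multiplicative set \<open>T\<close>. Elements are
  equivalence classes of pairs (numerator, denominator); an operation on two classes is the union
  over all pairs of representatives, which for a commutative ring \<open>R\<close> is a single class
  (lemmas \<open>localization_add\<close> and \<open>localization_mult\<close> below).
\<close>

definition localization :: "('a, 'b) ring_scheme \<Rightarrow> 'a set \<Rightarrow> ('a \<times> 'a) set ring" where
  "localization R T =
    \<lparr>carrier = (carrier R \<times> T) // loc_rel R T,
     mult = (\<lambda>X Y. \<Union>(a, s)\<in>X. \<Union>(b, t)\<in>Y. loc_frac R T (a \<otimes>\<^bsub>R\<^esub> b) (s \<otimes>\<^bsub>R\<^esub> t)),
     one = loc_frac R T \<one>\<^bsub>R\<^esub> \<one>\<^bsub>R\<^esub>,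
     zero = loc_frac R T \<zero>\<^bsub>R\<^esub> \<one>\<^bsub>R\<^esub>,
     add = (\<lambda>X Y. \<Union>(a, s)\<in>X. \<Union>(b, t)\<in>Y.
       loc_frac R T (t \<otimes>\<^bsub>R\<^esub> a \<oplus>\<^bsub>R\<^esub> s \<otimes>\<^bsub>R\<^esub> b) (s \<otimes>\<^bsub>R\<^esub> t))\<rparr>"

definition localization_at :: "('a, 'b) ring_scheme \<Rightarrow> 'a set \<Rightarrow> ('a \<times> 'a) set ring" where
  "localization_at R P = localization R (carrier R - P)"

lemma UN_pairs_constant:
  assumes "(a, s) \<in> X" "(b, t) \<in> Y"
    and "\<And>a s b t. (a, s) \<in> X \<Longrightarrow> (b, t) \<in> Y \<Longrightarrow> f a s b t = Z"
  shows "(\<Union>(a, s)\<in>X. \<Union>(b, t)\<in>Y. f a s b t) = Z"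
proof -
  have "(\<Union>(a, s)\<in>X. \<Union>(b, t)\<in>Y. f a s b t) = (\<Union>p\<in>X. \<Union>q\<in>Y. Z)"
    using assms(3) by (intro SUP_cong refl) (auto intro!: SUP_cong)
  then show ?thesis using assms(1,2) by auto
qed

locale mult_subset = cring R for R (structure) +
  fixes T
  assumes T_carrier: "T \<subseteq> carrier R"
    and T_one: "\<one> \<in> T"
    and T_mult: "s \<in> T \<Longrightarrow> t \<in> T \<Longrightarrow> s \<otimes> t \<in> T"
begin

lemma T_closed [simp]: "s \<in> T \<Longrightarrow> s \<in> carrier R"
  using T_carrier by blast

lemma equiv_loc_rel: "equiv (carrier R \<times> T) (loc_rel R T)"
proof (rule equivI)
  show "loc_rel R T \<subseteq> (carrier R \<times> T) \<times> (carrier R \<times> T)"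
    by (auto simp: loc_rel_def)
  show "refl_on (carrier R \<times> T) (loc_rel R T)"
    using T_one by (auto simp: loc_rel_def refl_on_def)
  show "sym (loc_rel R T)"
    by (force simp: loc_rel_def sym_def)
  show "trans (loc_rel R T)"
  proof (rule transI, clarsimp simp: loc_rel_def)
    fix a s b t c w u v
    assume c: "a \<in> carrier R" "b \<in> carrier R" "c \<in> carrier R" "s \<in> T" "t \<in> T" "w \<in> T" "u \<in> T" "v \<in> T"
      and 1: "u \<otimes> (t \<otimes> a) = u \<otimes> (s \<otimes> b)" and 2: "v \<otimes> (w \<otimes> b) = v \<otimes> (t \<otimes> c)"
    have "(u \<otimes> v \<otimes> t) \<otimes> (w \<otimes> a) = (v \<otimes> w) \<otimes> (u \<otimes> (t \<otimes> a))"
      using c by (simp add: m_ac)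
    also have "\<dots> = (u \<otimes> s) \<otimes> (v \<otimes> (w \<otimes> b))" unfolding 1 using c by (simp add: m_ac)
    also have "\<dots> = (u \<otimes> v \<otimes> t) \<otimes> (s \<otimes> c)" unfolding 2 using c by (simp add: m_ac)
    finally show "\<exists>x\<in>T. x \<otimes> (w \<otimes> a) = x \<otimes> (s \<otimes> c)" using c T_mult by blast
  qed
qed

lemma loc_frac_eq_iff:
  assumes "a \<in> carrier R" "b \<in> carrier R" "s \<in> T" "t \<in> T"
  shows "loc_frac R T a s = loc_frac R T b t \<longleftrightarrow> (\<exists>u\<in>T. u \<otimes> (t \<otimes> a) = u \<otimes> (s \<otimes> b))"
  using eq_equiv_class_iff[OF equiv_loc_rel, of "(a, s)" "(b, t)"] assms
  by (auto simp: loc_frac_def loc_rel_def)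

lemma loc_frac_scale:
  assumes "a \<in> carrier R" "s \<in> T" "t \<in> T"
  shows "loc_frac R T (t \<otimes> a) (t \<otimes> s) = loc_frac R T a s"
  using assms T_one T_mult by (subst loc_frac_eq_iff) (auto simp: m_ac intro!: bexI[of _ \<one>])

lemma localization_carrier_iff:
  "X \<in> carrier (localization R T) \<longleftrightarrow> (\<exists>a\<in>carrier R. \<exists>s\<in>T. X = loc_frac R T a s)"
  by (auto simp: localization_def quotient_def loc_frac_def)

lemma localization_mult:
  assumes "a \<in> carrier R" "b \<in> carrier R" "s \<in> T" "t \<in> T"
  shows "loc_frac R T a s \<otimes>\<^bsub>localization R T\<^esub> loc_frac R T b t = loc_frac R T (a \<otimes> b) (s \<otimes> t)"
proof -
  have *: "loc_frac R T (a' \<otimes> b') (s' \<otimes> t') = loc_frac R T (a \<otimes> b) (s \<otimes> t)"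
    if "(a', s') \<in> loc_frac R T a s" "(b', t') \<in> loc_frac R T b t" for a' s' b' t'
  proof -
    from that obtain u v where c: "u \<in> T" "v \<in> T" "a' \<in> carrier R" "b' \<in> carrier R" "s' \<in> T" "t' \<in> T"
      and 1: "u \<otimes> (s' \<otimes> a) = u \<otimes> (s \<otimes> a')" and 2: "v \<otimes> (t' \<otimes> b) = v \<otimes> (t \<otimes> b')"
      by (auto simp: loc_frac_def loc_rel_def)
    have "(u \<otimes> v) \<otimes> ((s \<otimes> t) \<otimes> (a' \<otimes> b')) = (u \<otimes> (s \<otimes> a')) \<otimes> (v \<otimes> (t \<otimes> b'))"
      using c assms by (simp add: m_ac)
    also have "\<dots> = (u \<otimes> v) \<otimes> ((s' \<otimes> t') \<otimes> (a \<otimes> b))"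
      unfolding 1[symmetric] 2[symmetric] using c assms by (simp add: m_ac)
    finally show ?thesis
      using c assms T_mult by (subst loc_frac_eq_iff) auto
  qed
  have ne: "(a, s) \<in> loc_frac R T a s" "(b, t) \<in> loc_frac R T b t"
    using assms equiv_class_self[OF equiv_loc_rel] by (auto simp: loc_frac_def)
  show ?thesis
    unfolding localization_def by simp (rule UN_pairs_constant[OF ne *])
qed

lemma localization_add:
  assumes "a \<in> carrier R" "b \<in> carrier R" "s \<in> T" "t \<in> T"
  shows "loc_frac R T a s \<oplus>\<^bsub>localization R T\<^esub> loc_frac R T b t =
    loc_frac R T (t \<otimes> a \<oplus> s \<otimes> b) (s \<otimes> t)"
proof -
  have *: "loc_frac R T (t' \<otimes> a' \<oplus> s' \<otimes> b') (s' \<otimes> t') = loc_frac R T (t \<otimes> a \<oplus> s \<otimes> b) (s \<otimes> t)"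
    if "(a', s') \<in> loc_frac R T a s" "(b', t') \<in> loc_frac R T b t" for a' s' b' t'
  proof -
    from that obtain u v where c: "u \<in> T" "v \<in> T" "a' \<in> carrier R" "b' \<in> carrier R" "s' \<in> T" "t' \<in> T"
      and 1: "u \<otimes> (s' \<otimes> a) = u \<otimes> (s \<otimes> a')" and 2: "v \<otimes> (t' \<otimes> b) = v \<otimes> (t \<otimes> b')"
      by (auto simp: loc_frac_def loc_rel_def)
    have "(u \<otimes> v) \<otimes> ((s \<otimes> t) \<otimes> (t' \<otimes> a' \<oplus> s' \<otimes> b')) =
        (v \<otimes> t \<otimes> t') \<otimes> (u \<otimes> (s \<otimes> a')) \<oplus> (u \<otimes> s \<otimes> s') \<otimes> (v \<otimes> (t \<otimes> b'))"
      using c assms by (simp add: m_ac r_distr)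
    also have "\<dots> = (u \<otimes> v) \<otimes> ((s' \<otimes> t') \<otimes> (t \<otimes> a \<oplus> s \<otimes> b))"
      unfolding 1[symmetric] 2[symmetric] using c assms by (simp add: m_ac r_distr)
    finally show ?thesis
      using c assms T_mult by (subst loc_frac_eq_iff) auto
  qed
  have ne: "(a, s) \<in> loc_frac R T a s" "(b, t) \<in> loc_frac R T b t"
    using assms equiv_class_self[OF equiv_loc_rel] by (auto simp: loc_frac_def)
  show ?thesis
    unfolding localization_def by simp (rule UN_pairs_constant[OF ne *])
qed

lemma localization_zero: "\<zero>\<^bsub>localization R T\<^esub> = loc_frac R T \<zero> \<one>"
  and localization_one: "\<one>\<^bsub>localization R T\<^esub> = loc_frac R T \<one> \<one>"
  by (simp_all add: localization_def)

lemma localization_cring: "cring (localization R T)"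
proof (rule cringI)
  let ?L = "localization R T"
  note [simp] = localization_carrier_iff localization_add localization_mult
    localization_zero localization_one T_one T_mult
  have frac_closed: "loc_frac R T a s \<in> carrier ?L" if "a \<in> carrier R" "s \<in> T" for a s
    using that by auto
  show "abelian_group ?L"
  proof (rule abelian_groupI)
    fix X Y assume "X \<in> carrier ?L" "Y \<in> carrier ?L"
    then obtain a s b t where c: "a \<in> carrier R" "s \<in> T" "b \<in> carrier R" "t \<in> T"
      and X: "X = loc_frac R T a s" and Y: "Y = loc_frac R T b t" by auto
    show "X \<oplus>\<^bsub>?L\<^esub> Y \<in> carrier ?L"
      unfolding X Y using c by (simp add: frac_closed del: localization_carrier_iff)
    show "X \<oplus>\<^bsub>?L\<^esub> Y = Y \<oplus>\<^bsub>?L\<^esub> X" unfolding X Y using c by (simp add: a_comm m_comm)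
    fix Z assume "Z \<in> carrier ?L"
    then obtain e w where d: "e \<in> carrier R" "w \<in> T" and Z: "Z = loc_frac R T e w" by auto
    show "X \<oplus>\<^bsub>?L\<^esub> Y \<oplus>\<^bsub>?L\<^esub> Z = X \<oplus>\<^bsub>?L\<^esub> (Y \<oplus>\<^bsub>?L\<^esub> Z)"
      unfolding X Y Z using c d by (simp add: m_ac r_distr a_assoc)
  next
    show "\<zero>\<^bsub>?L\<^esub> \<in> carrier ?L" by (simp add: frac_closed del: localization_carrier_iff)
  next
    fix X assume "X \<in> carrier ?L"
    then obtain a s where c: "a \<in> carrier R" "s \<in> T" and X: "X = loc_frac R T a s" by auto
    show "\<zero>\<^bsub>?L\<^esub> \<oplus>\<^bsub>?L\<^esub> X = X" unfolding X using c by simp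
    have "loc_frac R T (\<ominus> a) s \<oplus>\<^bsub>?L\<^esub> X = loc_frac R T (s \<otimes> \<ominus> a \<oplus> s \<otimes> a) (s \<otimes> s)"
      unfolding X using c by simp
    also have "s \<otimes> \<ominus> a \<oplus> s \<otimes> a = \<zero>" using c by (simp add: r_minus l_neg)
    also have "loc_frac R T \<zero> (s \<otimes> s) = loc_frac R T \<zero> \<one>"
      using c by (subst loc_frac_eq_iff) auto
    finally show "\<exists>Y\<in>carrier ?L. Y \<oplus>\<^bsub>?L\<^esub> X = \<zero>\<^bsub>?L\<^esub>"
      using c frac_closed[of "\<ominus> a" s] by (metis a_inv_closed localization_zero)
  qed
  show "Group.comm_monoid ?L"
  proof (rule comm_monoidI)
    fix X Y assume "X \<in> carrier ?L" "Y \<in> carrier ?L"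
    then obtain a s b t where c: "a \<in> carrier R" "s \<in> T" "b \<in> carrier R" "t \<in> T"
      and X: "X = loc_frac R T a s" and Y: "Y = loc_frac R T b t" by auto
    show "X \<otimes>\<^bsub>?L\<^esub> Y \<in> carrier ?L"
      unfolding X Y using c by (simp add: frac_closed del: localization_carrier_iff)
    show "X \<otimes>\<^bsub>?L\<^esub> Y = Y \<otimes>\<^bsub>?L\<^esub> X" unfolding X Y using c by (simp add: m_comm)
    fix Z assume "Z \<in> carrier ?L"
    then obtain e w where d: "e \<in> carrier R" "w \<in> T" and Z: "Z = loc_frac R T e w" by auto
    show "X \<otimes>\<^bsub>?L\<^esub> Y \<otimes>\<^bsub>?L\<^esub> Z = X \<otimes>\<^bsub>?L\<^esub> (Y \<otimes>\<^bsub>?L\<^esub> Z)"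
      unfolding X Y Z using c d by (simp add: m_ac)
  next
    show "\<one>\<^bsub>?L\<^esub> \<in> carrier ?L" by (simp add: frac_closed del: localization_carrier_iff)
  next
    fix X assume "X \<in> carrier ?L"
    then show "\<one>\<^bsub>?L\<^esub> \<otimes>\<^bsub>?L\<^esub> X = X" by auto
  qed
  fix X Y Z assume "X \<in> carrier ?L" "Y \<in> carrier ?L" "Z \<in> carrier ?L"
  then obtain a s b t e w where c: "a \<in> carrier R" "s \<in> T" "b \<in> carrier R" "t \<in> T"
      "e \<in> carrier R" "w \<in> T"
    and X: "X = loc_frac R T a s" and Y: "Y = loc_frac R T b t" and Z: "Z = loc_frac R T e w"
    by auto
  have "X \<otimes>\<^bsub>?L\<^esub> Z \<oplus>\<^bsub>?L\<^esub> Y \<otimes>\<^bsub>?L\<^esub> Z =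
      loc_frac R T (w \<otimes> ((t \<otimes> a \<oplus> s \<otimes> b) \<otimes> e)) (w \<otimes> ((s \<otimes> t) \<otimes> w))"
    unfolding X Y Z using c by (simp add: m_ac r_distr)
  also have "\<dots> = loc_frac R T ((t \<otimes> a \<oplus> s \<otimes> b) \<otimes> e) ((s \<otimes> t) \<otimes> w)"
    using c by (intro loc_frac_scale) auto
  also have "\<dots> = (X \<oplus>\<^bsub>?L\<^esub> Y) \<otimes>\<^bsub>?L\<^esub> Z" unfolding X Y Z using c by simp
  finally show "(X \<oplus>\<^bsub>?L\<^esub> Y) \<otimes>\<^bsub>?L\<^esub> Z = X \<otimes>\<^bsub>?L\<^esub> Z \<oplus>\<^bsub>?L\<^esub> Y \<otimes>\<^bsub>?L\<^esub> Z" by simp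
qed

end

lemma localization_at_cring:
  fixes R (structure)
  assumes "primeideal P R"
  shows "cring (localization_at R P)"
proof -
  interpret primeideal P R by fact
  have "\<one> \<notin> P" using I_notcarr one_imp_carrier by blast
  then interpret mult_subset R "carrier R - P"
    by unfold_locales (auto dest: I_prime)
  show ?thesis unfolding localization_at_def by (rule localization_cring)
qed


subsection \<open>Dimension and depth\<close>

text \<open>Suprema of lengths are taken in \<^typ>\<open>enat\<close>; the zero ring gets dimension \<open>0\<close> here.\<close>

definition krull_dim :: "('a, 'b) ring_scheme \<Rightarrow> enat" where
  "krull_dim R = (SUP n\<in>{n. \<exists>P :: nat \<Rightarrow> 'a set.
     (\<forall>i\<le>n. primeideal (P i) R) \<and> (\<forall>i<n. P i \<subset> P (Suc i))}. enat n)"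

text \<open>
  The element \<open>xs ! i\<close> is a nonzerodivisor on the quotient of \<open>R\<close> by the ideal generated by its
  predecessors, and all of \<open>xs\<close> together generates a proper ideal.
\<close>

definition regular_sequence :: "('a, 'b) ring_scheme \<Rightarrow> 'a list \<Rightarrow> bool" where
  "regular_sequence R xs \<longleftrightarrow>
     set xs \<subseteq> carrier R \<and> Idl\<^bsub>R\<^esub> (set xs) \<noteq> carrier R \<and>
     (\<forall>i<length xs. \<forall>a\<in>carrier R.
        xs ! i \<otimes>\<^bsub>R\<^esub> a \<in> Idl\<^bsub>R\<^esub> (set (take i xs)) \<longrightarrow> a \<in> Idl\<^bsub>R\<^esub> (set (take i xs)))"

definition ideal_depth :: "'a set \<Rightarrow> ('a, 'b) ring_scheme \<Rightarrow> enat" where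
  "ideal_depth I R = (SUP xs\<in>{xs. regular_sequence R xs \<and> set xs \<subseteq> I}. enat (length xs))"

definition noetherian_local_ring :: "'a set \<Rightarrow> ('a, 'b) ring_scheme \<Rightarrow> bool" where
  "noetherian_local_ring M R \<longleftrightarrow> cring R \<and> noetherian_ring R \<and> {N. maximalideal N R} = {M}"

definition cohen_macaulay_local_ring :: "('a, 'b) ring_scheme \<Rightarrow> bool" where
  "cohen_macaulay_local_ring R \<longleftrightarrow>
     (\<exists>M. noetherian_local_ring M R \<and> ideal_depth M R = krull_dim R)"

definition cohen_macaulay_ring :: "('a, 'b) ring_scheme \<Rightarrow> bool" where
  "cohen_macaulay_ring R \<longleftrightarrow> cring R \<and> noetherian_ring R \<and>
     (\<forall>M. maximalideal M R \<longrightarrow> cohen_macaulay_local_ring (localization_at R M))"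


section \<open>Polynomial rings and matching powers of monomial ideals\<close>

text \<open>
  A polynomial over \<open>'k\<close> is a finitely supported map from exponent vectors to coefficients, and an
  exponent vector is a finitely supported map from variables to \<^typ>\<open>nat\<close>. The ring
  \<open>polynomial_ring V\<close> consists of those polynomials in which only variables from \<open>V\<close> occur.
\<close>

type_synonym ('v, 'k) mpoly = "('v \<Rightarrow>\<^sub>0 nat) \<Rightarrow>\<^sub>0 'k"

definition polynomial_ring :: "'v set \<Rightarrow> ('v, 'k::field) mpoly ring" where
  "polynomial_ring V =
    \<lparr>carrier = {p. \<forall>m\<in>Poly_Mapping.keys p. Poly_Mapping.keys m \<subseteq> V},
     mult = (*), one = 1, zero = 0, add = (+)\<rparr>"

lemma polynomial_ring_cring: "cring (polynomial_ring V :: ('v, 'k::field) mpoly ring)"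
proof (rule cringI)
  let ?S = "polynomial_ring V :: ('v, 'k::field) mpoly ring"
  have keys_plus: "Poly_Mapping.keys (m + n) = Poly_Mapping.keys m \<union> Poly_Mapping.keys n"
    for m n :: "'v \<Rightarrow>\<^sub>0 nat"
    by (auto simp: in_keys_iff lookup_add)
  show "abelian_group ?S"
  proof (rule abelian_groupI)
    fix p assume "p \<in> carrier ?S"
    then show "\<exists>q\<in>carrier ?S. q \<oplus>\<^bsub>?S\<^esub> p = \<zero>\<^bsub>?S\<^esub>"
      by (intro bexI[of _ "- p"]) (auto simp: polynomial_ring_def in_keys_iff)
  next
    fix p q assume "p \<in> carrier ?S" "q \<in> carrier ?S"
    then show "p \<oplus>\<^bsub>?S\<^esub> q \<in> carrier ?S"
      using Poly_Mapping.keys_add[of p q] by (auto simp: polynomial_ring_def)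
  qed (auto simp: polynomial_ring_def add_ac)
  show "Group.comm_monoid ?S"
  proof (rule comm_monoidI)
    fix p q assume pq: "p \<in> carrier ?S" "q \<in> carrier ?S"
    show "p \<otimes>\<^bsub>?S\<^esub> q \<in> carrier ?S"
      using keys_mult[of p q] pq
      by (fastforce simp: polynomial_ring_def keys_plus)
  qed (auto simp: polynomial_ring_def mult_ac)
qed (auto simp: polynomial_ring_def algebra_simps)

definition cohen_macaulay_ideal :: "'v set \<Rightarrow> ('v, 'k::field) mpoly set \<Rightarrow> bool" where
  "cohen_macaulay_ideal V I \<longleftrightarrow> cohen_macaulay_ring (polynomial_ring V Quot I)"

definition monomial :: "('v \<Rightarrow>\<^sub>0 nat) \<Rightarrow> ('v, 'k::field) mpoly" where
  "monomial m = Poly_Mapping.single m 1"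

definition variable :: "'v \<Rightarrow> ('v, 'k::field) mpoly" where
  "variable x = monomial (Poly_Mapping.single x 1)"

text \<open>The monomials of \<open>I\<close>, given by their exponent vectors, that are minimal under divisibility.\<close>

definition minimal_generators :: "('v, 'k::field) mpoly set \<Rightarrow> ('v \<Rightarrow>\<^sub>0 nat) set" where
  "minimal_generators I = {m. monomial m \<in> I \<and>
     (\<forall>n. monomial n \<in> I \<longrightarrow>
       (\<forall>x. Poly_Mapping.lookup n x \<le> Poly_Mapping.lookup m x) \<longrightarrow> n = m)}"

definition matching_power ::
    "'v set \<Rightarrow> ('v, 'k::field) mpoly set \<Rightarrow> nat \<Rightarrow> ('v, 'k) mpoly set" where
  "matching_power V I k = Idl\<^bsub>polynomial_ring V\<^esub> {\<Prod>i<k. monomial (u i) | u.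
     (\<forall>i<k. u i \<in> minimal_generators I) \<and>
     (\<forall>i<k. \<forall>j<k. i \<noteq> j \<longrightarrow> Poly_Mapping.keys (u i) \<inter> Poly_Mapping.keys (u j) = {})}"


section \<open>Graphs and edge ideals\<close>

definition simple_graph :: "'v set \<Rightarrow> 'v set set \<Rightarrow> bool" where
  "simple_graph V E \<longleftrightarrow> (\<forall>e\<in>E. e \<subseteq> V \<and> card e = 2)"

definition no_isolated_vertices :: "'v set \<Rightarrow> 'v set set \<Rightarrow> bool" where
  "no_isolated_vertices V E \<longleftrightarrow> (\<forall>x\<in>V. \<exists>e\<in>E. x \<in> e)"

text \<open>The graph without vertices does not count as connected.\<close>

definition graph_connected :: "'v set \<Rightarrow> 'v set set \<Rightarrow> bool" where
  "graph_connected V E \<longleftrightarrow> V \<noteq> {} \<and> (\<forall>x\<in>V. \<forall>y\<in>V. (x, y) \<in> {(a, b). {a, b} \<in> E}\<^sup>*)"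

definition complete_edges :: "'v set \<Rightarrow> 'v set set" where
  "complete_edges V = {e. e \<subseteq> V \<and> card e = 2}"

definition graph_isomorphic ::
    "'v set \<Rightarrow> 'v set set \<Rightarrow> 'w set \<Rightarrow> 'w set set \<Rightarrow> bool" where
  "graph_isomorphic V E W F \<longleftrightarrow>
     (\<exists>f. bij_betw f V W \<and> (\<forall>x\<in>V. \<forall>y\<in>V. {x, y} \<in> E \<longleftrightarrow> {f x, f y} \<in> F))"

definition isomorphic_to_complete :: "'v set \<Rightarrow> 'v set set \<Rightarrow> nat \<Rightarrow> bool" where
  "isomorphic_to_complete V E n \<longleftrightarrow> graph_isomorphic V E {..<n} (complete_edges {..<n})"

definition is_matching :: "'v set set \<Rightarrow> 'v set set \<Rightarrow> bool" where
  "is_matching E M \<longleftrightarrow> M \<subseteq> E \<and> pairwise disjnt M"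

definition is_induced_matching :: "'v set set \<Rightarrow> 'v set set \<Rightarrow> bool" where
  "is_induced_matching E M \<longleftrightarrow> is_matching E M \<and>
     (\<forall>e\<in>M. \<forall>e'\<in>M. e \<noteq> e' \<longrightarrow> {f \<in> E. f \<subseteq> e \<union> e'} = {e, e'})"

definition matching_number :: "'v set set \<Rightarrow> nat" where
  "matching_number E = Max (card ` {M. is_matching E M})"

definition induced_matching_number :: "'v set set \<Rightarrow> nat" where
  "induced_matching_number E = Max (card ` {M. is_induced_matching E M})"

definition cameron_walker :: "'v set \<Rightarrow> 'v set set \<Rightarrow> bool" where
  "cameron_walker V E \<longleftrightarrow>
     graph_connected V E \<and> matching_number E = induced_matching_number E"

definition edge_ideal :: "'v set \<Rightarrow> 'v set set \<Rightarrow> ('v, 'k::field) mpoly set" where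
  "edge_ideal V E = Idl\<^bsub>polynomial_ring V\<^esub> {variable x * variable y | x y. {x, y} \<in> E}"

end

theory Submission
  imports Defs
begin

text \<open>
  If \<open>S/I\<close> is Cohen-Macaulay for the squarefree ideal \<open>I\<close> generated by a family \<open>F\<close> of vertex sets, all
  minimal covers of \<open>F\<close> have the same size: after localizing at the ideal of all variables, a cover
  \<open>C\<close> gives a chain of \<open>|V| - |C|\<close> primes, while a minimal cover \<open>D\<close> gives the associated prime
  \<open>(D) = I : \<Prod>(V - D)\<close>, from which every regular sequence climbs to a chain of primes of its own
  length; such chains have length at most \<open>|V| - |D|\<close>.

  Let \<open>M\<close> be a maximum matching that is induced, and call a vertex outer if it is not on \<open>M\<close>. If
  some edge of \<open>M\<close> has just one end \<open>a\<close> adjacent to an outer vertex, then \<open>a\<close> lies in every maximum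
  matching and the \<open>\<nu>\<close>-th power has covers of different sizes. Otherwise connectedness leaves \<open>K\<^sub>2\<close>
  or \<open>t\<close> triangles sharing one vertex, and then the minimal cover \<open>\<Union>M\<close> of size \<open>2t\<close> and a cover of
  size \<open>t + 1\<close> force \<open>t = 1\<close>. Conversely the edge ideal of \<open>K\<^sub>n\<close> is the intersection of the ideals of
  the coordinate axes, so the quotient is one-dimensional, and prime avoidance yields a
  nonzerodivisor in every maximal ideal.
\<close>

section \<open>Primes above a regular sequence\<close>

text \<open>Depth and dimension are both controlled by one bound: chains of primes in the polynomial
  ring have length at most |V|. Prepending the chain from 0 to (C), one variable at a time, sharpens
  it to |V| - |C| above the prime (C). For (D) this bounds the depth from above; for the ideal of an
  axis, with its |V| - 1 variables, it bounds the dimension by one. The bound itself is a count: a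
  chain of length n yields n algebraically independent polynomials, whose products with exponents
  below N are N^n in number, against a space of dimension of order N^|V|. The passage from R to the
  localization of R/I is made in one step, through a homomorphism whose denominators and kernel are
  described in R, so that primes and annihilators can be moved back to the polynomial ring. Finite
  generation is part of the assumption in one direction. In the other it is assembled from the axes:
  modulo the ideal of the x-axis there is division with remainder as in K[x], and finite generation
  modulo two ideals carries over to their intersection.\<close>

lemma (in noetherian_ring) maximal_ideal_in_family:
  assumes "\<A> \<noteq> {}" and "\<And>I. I \<in> \<A> \<Longrightarrow> ideal I R"
  obtains I where "I \<in> \<A>" and "\<And>J. J \<in> \<A> \<Longrightarrow> I \<subseteq> J \<Longrightarrow> J = I"
proof -
  have "\<exists>I\<in>\<A>. \<forall>J\<in>\<A>. I \<subseteq> J \<longrightarrow> J = I"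
  proof (rule subset_Zorn_nonempty[OF assms(1)])
    fix \<C> assume "\<C> \<noteq> {}" and chain: "subset.chain \<A> \<C>"
    then have "\<Union>\<C> \<in> \<C>"
      using assms(2) by (intro ideal_chain_is_trivial) (auto simp: subset_chain_def)
    then show "\<Union>\<C> \<in> \<A>" using chain by (auto simp: subset_chain_def)
  qed
  then show thesis using that by blast
qed

definition colon :: "('a, 'b) ring_scheme \<Rightarrow> 'a set \<Rightarrow> 'a \<Rightarrow> 'a set" where
  "colon R J w = {a \<in> carrier R. a \<otimes>\<^bsub>R\<^esub> w \<in> J}"

lemma (in cring) colon_ideal:
  assumes "ideal J R" and "w \<in> carrier R"
  shows "ideal (colon R J w) R"
proof -
  interpret J: ideal J R by fact
  show ?thesis
  proof (rule idealI)
    show "subgroup (colon R J w) (add_monoid R)"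
    proof (rule add.subgroupI)
      show "colon R J w \<noteq> {}" using assms(2) by (auto simp: colon_def intro!: exI[of _ \<zero>])
    qed (use assms(2) in \<open>auto simp: colon_def l_distr l_minus\<close>)
    fix a x assume "a \<in> colon R J w" "x \<in> carrier R"
    then show "x \<otimes> a \<in> colon R J w"
      using assms(2) by (auto simp: colon_def m_assoc J.I_l_closed)
    then show "a \<otimes> x \<in> colon R J w"
      using \<open>a \<in> _\<close> \<open>x \<in> _\<close> by (simp add: colon_def m_comm)
  qed (rule ring_axioms)
qed

text \<open>A maximal annihilator is prime: take J : w maximal among the colons by elements outside
  J that contain J : c. If ab is in it and b is not, then bw is outside J and J : bw contains J : w,
  so the two agree and a lies in both. These primes are the associated primes of R/J.\<close>

lemma (in cring) exists_prime_colon: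
  assumes "noetherian_ring R" "ideal J R" "c \<in> carrier R" "c \<notin> J"
  obtains w where "w \<in> carrier R" "w \<notin> J" "primeideal (colon R J w) R"
    "colon R J c \<subseteq> colon R J w"
proof -
  interpret noetherian_ring R by fact
  interpret J: ideal J R by fact
  define \<A> where "\<A> = {colon R J w | w. w \<in> carrier R \<and> w \<notin> J \<and> colon R J c \<subseteq> colon R J w}"
  have "\<A> \<noteq> {}" using assms by (auto simp: \<A>_def)
  moreover have "ideal I R" if "I \<in> \<A>" for I
    using that colon_ideal[OF assms(2)] by (auto simp: \<A>_def)
  ultimately obtain P where P: "P \<in> \<A>" and max: "\<And>J. J \<in> \<A> \<Longrightarrow> P \<subseteq> J \<Longrightarrow> J = P"
    using maximal_ideal_in_family[of \<A>] by blast
  then obtain w where w: "w \<in> carrier R" "w \<notin> J" "colon R J c \<subseteq> P" "P = colon R J w"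
    by (auto simp: \<A>_def)
  have "primeideal P R"
  proof (rule primeidealI)
    show "ideal P R" using w colon_ideal[OF assms(2)] by simp
    have "\<one> \<notin> P" using w by (simp add: colon_def)
    then show "carrier R \<noteq> P" by blast
    fix a b assume ab: "a \<in> carrier R" "b \<in> carrier R" "a \<otimes> b \<in> P"
    show "a \<in> P \<or> b \<in> P"
    proof (cases "b \<in> P")
      case False
      have sub: "P \<subseteq> colon R J (b \<otimes> w)"
      proof
        fix x assume "x \<in> P"
        then have "x \<in> carrier R" "b \<otimes> (x \<otimes> w) \<in> J" using w ab by (auto simp: colon_def J.I_l_closed)
        then show "x \<in> colon R J (b \<otimes> w)" using w ab by (simp add: colon_def m_lcomm)
      qed
      then have "colon R J (b \<otimes> w) \<in> \<A>"
        using w ab False unfolding \<A>_def by (auto simp: colon_def)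
      then have "colon R J (b \<otimes> w) = P" using sub by (rule max)
      moreover have "a \<in> colon R J (b \<otimes> w)" using ab w by (simp add: colon_def m_assoc)
      ultimately show ?thesis by simp
    qed simp
  qed (rule is_cring)
  then show thesis using that w by simp
qed

text \<open>If 1 - ax were not a unit, an ideal maximal among those that contain it and avoid 1
  would be a maximal ideal, hence M; since ax is in M as well, so would be 1.\<close>

lemma (in cring) local_ring_unit:
  assumes "noetherian_local_ring M R" "x \<in> M" "a \<in> carrier R"
  shows "\<one> \<ominus> a \<otimes> x \<in> Units R"
proof (rule ccontr)
  interpret noetherian_ring R using assms(1) by (simp add: noetherian_local_ring_def)
  have M: "maximalideal M R" using assms(1) by (auto simp: noetherian_local_ring_def)
  interpret M: maximalideal M R by fact
  let ?u = "\<one> \<ominus> a \<otimes> x"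
  assume nu: "?u \<notin> Units R"
  have u: "?u \<in> carrier R" using M.Icarr[OF assms(2)] assms(3) by simp
  define \<A> where "\<A> = {I. ideal I R \<and> ?u \<in> I \<and> \<one> \<notin> I}"
  have "\<one> \<notin> PIdl ?u"
  proof
    assume "\<one> \<in> PIdl ?u"
    then obtain b where "b \<in> carrier R" "b \<otimes> ?u = \<one>" by (auto simp: cgenideal_def)
    then show False using nu u by (auto simp: Units_def m_comm)
  qed
  then have "\<A> \<noteq> {}" using cgenideal_ideal[OF u] cgenideal_self[OF u] by (auto simp: \<A>_def)
  moreover have "ideal I R" if "I \<in> \<A>" for I using that by (simp add: \<A>_def)
  ultimately obtain N where N: "N \<in> \<A>" and max: "\<And>J. J \<in> \<A> \<Longrightarrow> N \<subseteq> J \<Longrightarrow> J = N"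
    using maximal_ideal_in_family[of \<A>] by blast
  interpret N: ideal N R using N by (simp add: \<A>_def)
  have "maximalideal N R"
  proof (rule maximalidealI)
    show "carrier R \<noteq> N" using N by (auto simp: \<A>_def)
    fix J assume J: "ideal J R" "N \<subseteq> J" "J \<subseteq> carrier R"
    show "J = N \<or> J = carrier R"
    proof (cases "\<one> \<in> J")
      case True then show ?thesis using J(1) by (simp add: ideal.one_imp_carrier)
    next
      case False then show ?thesis using J N max[of J] by (auto simp: \<A>_def)
    qed
  qed (rule N.is_ideal)
  then have "N = M" using assms(1) by (auto simp: noetherian_local_ring_def)
  then have "?u \<oplus> a \<otimes> x \<in> M"
    using N assms(2,3) by (auto simp: \<A>_def M.I_l_closed)
  moreover have "?u \<oplus> a \<otimes> x = \<one>"
    using M.Icarr[OF assms(2)] assms(3) by algebra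
  ultimately show False using M.I_notcarr M.one_imp_carrier by simp
qed

lemma (in cring) add_cgenideal_mem:
  "z \<in> J <+>\<^bsub>R\<^esub> PIdl v \<longleftrightarrow> (\<exists>j\<in>J. \<exists>a\<in>carrier R. z = j \<oplus> a \<otimes> v)"
  by (auto simp: set_add_def' cgenideal_def)

lemma (in cring) add_cgenideal_memI:
  assumes "j \<in> J" "a \<in> carrier R" "z = j \<oplus> a \<otimes> v"
  shows "z \<in> J <+>\<^bsub>R\<^esub> PIdl v"
  using assms by (auto simp: add_cgenideal_mem)

text \<open>
  A Nakayama argument: if the annihilator \<open>N\<close> of \<open>Q\<close> modulo \<open>J\<close> were contained in \<open>J + (x)\<close>, then
  \<open>N \<subseteq> J + x N\<close>, because \<open>x\<close> is a nonzerodivisor modulo \<open>J\<close>, and hence \<open>N \<subseteq> J\<close>.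
\<close>

lemma (in cring) annihilator_mod_regular:
  assumes loc: "noetherian_local_ring M R" and J: "ideal J R" and x: "x \<in> M"
    and reg: "\<And>a. a \<in> carrier R \<Longrightarrow> x \<otimes> a \<in> J \<Longrightarrow> a \<in> J"
    and Q: "Q \<subseteq> colon R J w" "w \<in> carrier R" "w \<notin> J"
  obtains v where "v \<in> carrier R" "v \<notin> J <+>\<^bsub>R\<^esub> PIdl x" "Q \<subseteq> colon R (J <+>\<^bsub>R\<^esub> PIdl x) v"
    "x \<in> colon R (J <+>\<^bsub>R\<^esub> PIdl x) v"
proof -
  interpret noetherian_ring R using loc by (simp add: noetherian_local_ring_def)
  interpret J: ideal J R by fact
  have "maximalideal M R" using loc by (auto simp: noetherian_local_ring_def)
  then interpret M: maximalideal M R .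
  have xc: "x \<in> carrier R" using x by simp
  define N where "N = {v \<in> carrier R. Q \<subseteq> colon R J v}"
  have "\<exists>v\<in>N. v \<notin> J <+>\<^bsub>R\<^esub> PIdl x"
  proof (rule ccontr)
    assume "\<not> ?thesis"
    then have sub: "v \<in> J <+>\<^bsub>R\<^esub> PIdl x" if "v \<in> N" for v using that by blast
    \<comment> \<open>Maximality of J + (v) stands in for a finite set of generators of N. Writing v
      = j + yx, the element y is again in N - J, and J + (v) is contained in J + (y), so the two
      ideals agree.\<close>
    define \<A> where "\<A> = {J <+>\<^bsub>R\<^esub> PIdl v | v. v \<in> N \<and> v \<notin> J}"
    have "\<A> \<noteq> {}" using Q by (auto simp: \<A>_def N_def)
    moreover have "ideal I R" if "I \<in> \<A>" for I
      using that add_ideals[OF J cgenideal_ideal] by (auto simp: \<A>_def N_def)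
    ultimately obtain I where I: "I \<in> \<A>" and max: "\<And>K. K \<in> \<A> \<Longrightarrow> I \<subseteq> K \<Longrightarrow> K = I"
      using maximal_ideal_in_family[of \<A>] by blast
    then obtain v where v: "v \<in> N" "v \<notin> J" "I = J <+>\<^bsub>R\<^esub> PIdl v" by (auto simp: \<A>_def)
    have vc: "v \<in> carrier R" using v by (simp add: N_def)
    obtain j y where j: "j \<in> J" "y \<in> carrier R" "v = j \<oplus> y \<otimes> x"
      using sub[OF v(1)] by (auto simp: add_cgenideal_mem)
    have jc: "j \<in> carrier R" using j by simp
    have "Q \<subseteq> colon R J y"
    proof
      fix q assume "q \<in> Q"
      then have q: "q \<in> carrier R" "q \<otimes> v \<in> J" using v by (auto simp: N_def colon_def)
      have "x \<otimes> (q \<otimes> y) = q \<otimes> v \<ominus> q \<otimes> j"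
        unfolding j(3) using q j jc xc by algebra
      also have "\<dots> \<in> J" using q j by (simp add: J.I_l_closed a_minus_def)
      finally show "q \<in> colon R J y" using reg[of "q \<otimes> y"] q j by (simp add: colon_def)
    qed
    moreover have yJ: "y \<notin> J"
      using v(2) j xc J.I_r_closed[of y x] by auto
    ultimately have "J <+>\<^bsub>R\<^esub> PIdl y \<in> \<A>" using j by (auto simp: \<A>_def N_def)
    moreover have "I \<subseteq> J <+>\<^bsub>R\<^esub> PIdl y"
    proof
      fix z assume "z \<in> I"
      then obtain i a where z: "i \<in> J" "a \<in> carrier R" "z = i \<oplus> a \<otimes> v"
        unfolding v(3) by (auto simp: add_cgenideal_mem)
      have "z = (i \<oplus> a \<otimes> j) \<oplus> (a \<otimes> x) \<otimes> y"
        unfolding z(3) j(3) using z j jc xc J.Icarr[OF z(1)] by algebra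
      then show "z \<in> J <+>\<^bsub>R\<^esub> PIdl y"
        using z j xc by (intro add_cgenideal_memI[of "i \<oplus> a \<otimes> j"]) (auto simp: J.I_l_closed)
    qed
    ultimately have "J <+>\<^bsub>R\<^esub> PIdl y = I" by (rule max)
    moreover have "y \<in> J <+>\<^bsub>R\<^esub> PIdl y"
      using j by (intro add_cgenideal_memI[of \<zero> _ \<one>]) auto
    ultimately obtain i a where y: "i \<in> J" "a \<in> carrier R" "y = i \<oplus> a \<otimes> v"
      unfolding v(3) by (auto simp: add_cgenideal_mem)
    have ic: "i \<in> carrier R" using y(1) by simp
    \<comment> \<open>Substituting v = j + yx into y = i + av gives (1 - ax) y = i + aj, an element
      of J, and 1 - ax is a unit.\<close>
    have "y \<ominus> i = a \<otimes> v"
      by (subst y(3)) (use y(2) ic vc in algebra)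
    then have "y \<ominus> i = a \<otimes> (j \<oplus> y \<otimes> x)" by (simp add: j(3)[symmetric])
    moreover have "(\<one> \<ominus> a \<otimes> x) \<otimes> y = (y \<ominus> i) \<oplus> (i \<ominus> a \<otimes> (y \<otimes> x))"
      using j(2) xc y(2) ic by algebra
    moreover have "a \<otimes> (j \<oplus> y \<otimes> x) \<oplus> (i \<ominus> a \<otimes> (y \<otimes> x)) = i \<oplus> a \<otimes> j"
      using j(2) jc xc y(2) ic by algebra
    ultimately have "(\<one> \<ominus> a \<otimes> x) \<otimes> y = i \<oplus> a \<otimes> j" by (simp only:)
    then have in_J: "(\<one> \<ominus> a \<otimes> x) \<otimes> y \<in> J" using y(1,2) j(1) by (simp add: J.I_l_closed)
    obtain e where e: "e \<in> carrier R" "e \<otimes> (\<one> \<ominus> a \<otimes> x) = \<one>"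
      using local_ring_unit[OF loc x y(2)] by (auto simp: Units_def)
    have "e \<otimes> ((\<one> \<ominus> a \<otimes> x) \<otimes> y) \<in> J" using in_J e(1) by (simp add: J.I_l_closed)
    moreover have "e \<otimes> ((\<one> \<ominus> a \<otimes> x) \<otimes> y) = y"
      using e j(2) xc y(2) by (subst m_assoc[symmetric]) auto
    ultimately show False using yJ by simp
  qed
  then obtain v where v: "v \<in> N" "v \<notin> J <+>\<^bsub>R\<^esub> PIdl x" by blast
  have vc: "v \<in> carrier R" using v by (simp add: N_def)
  have "J \<subseteq> J <+>\<^bsub>R\<^esub> PIdl x"
  proof
    fix j assume "j \<in> J"
    then show "j \<in> J <+>\<^bsub>R\<^esub> PIdl x"
      using xc by (intro add_cgenideal_memI[of j _ \<zero>]) auto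
  qed
  then have "Q \<subseteq> colon R (J <+>\<^bsub>R\<^esub> PIdl x) v" using v by (auto simp: N_def colon_def)
  moreover have "x \<in> colon R (J <+>\<^bsub>R\<^esub> PIdl x) v"
    using xc vc by (auto simp: colon_def m_comm intro!: add_cgenideal_memI[of \<zero> _ v])
  ultimately show thesis by (rule that[OF vc v(2)])
qed

definition prime_chain :: "('a, 'b) ring_scheme \<Rightarrow> nat \<Rightarrow> (nat \<Rightarrow> 'a set) \<Rightarrow> bool" where
  "prime_chain R n P \<longleftrightarrow> (\<forall>i\<le>n. primeideal (P i) R) \<and> (\<forall>i<n. P i \<subset> P (Suc i))"

lemma (in cring) genideal_insert:
  assumes "X \<subseteq> carrier R" "x \<in> carrier R"
  shows "Idl (insert x X) = Idl X <+>\<^bsub>R\<^esub> PIdl x"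
proof -
  have 1: "Idl X \<union> PIdl x \<subseteq> carrier R"
    by (intro Un_least additive_subgroup.a_subset ideal.axioms(1) genideal_ideal cgenideal_ideal assms)
  have 2: "insert x X \<subseteq> carrier R" using assms by simp
  have "Idl (insert x X) = Idl (Idl X \<union> PIdl x)"
  proof (rule equalityI)
    have "insert x X \<subseteq> Idl X \<union> PIdl x"
      using genideal_self[OF assms(1)] cgenideal_self[OF assms(2)] by blast
    then have "insert x X \<subseteq> Idl (Idl X \<union> PIdl x)"
      using genideal_self[OF 1] by (rule order_trans)
    then show "Idl (insert x X) \<subseteq> Idl (Idl X \<union> PIdl x)"
      by (rule genideal_minimal[OF genideal_ideal[OF 1]])
    have "Idl X \<subseteq> Idl (insert x X)"
      using genideal_self[OF 2] by (intro genideal_minimal[OF genideal_ideal[OF 2]]) blast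
    moreover have "PIdl x \<subseteq> Idl (insert x X)"
      using genideal_self[OF 2] by (intro cgenideal_minimal[OF genideal_ideal[OF 2]]) blast
    ultimately have "Idl X \<union> PIdl x \<subseteq> Idl (insert x X)" by (rule Un_least)
    then show "Idl (Idl X \<union> PIdl x) \<subseteq> Idl (insert x X)"
      by (rule genideal_minimal[OF genideal_ideal[OF 2]])
  qed
  also have "\<dots> = Idl X <+>\<^bsub>R\<^esub> PIdl x"
    using union_genideal[OF genideal_ideal[OF assms(1)] cgenideal_ideal[OF assms(2)]] .
  finally show ?thesis .
qed

text \<open>Let J_i be generated by the first i elements. The induction keeps the top prime in the
  form J_i : w with w outside J_i. The next element x is a nonzerodivisor modulo J_i and so avoids
  this prime, while the next prime contains both the old one and x: the inclusion is strict.
  Starting above 0 : c ties the whole chain to a chosen annihilator.\<close>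

lemma (in cring) regular_sequence_prime_chain:
  assumes loc: "noetherian_local_ring M R" and xs: "regular_sequence R xs" "set xs \<subseteq> M"
    and c: "c \<in> carrier R" "c \<noteq> \<zero>"
  obtains Q where "prime_chain R (length xs) Q" "colon R {\<zero>} c \<subseteq> Q 0"
proof -
  interpret noetherian_ring R using loc by (simp add: noetherian_local_ring_def)
  define J where "J i = Idl (set (take i xs))" for i
  have sub: "set (take i xs) \<subseteq> carrier R" for i
    using xs(1) set_take_subset[of i xs] by (meson order_trans regular_sequence_def)
  have J: "ideal (J i) R" for i unfolding J_def by (rule genideal_ideal[OF sub])
  have "\<exists>Q w. prime_chain R i Q \<and> colon R {\<zero>} c \<subseteq> Q 0 \<and> w \<in> carrier R \<and> w \<notin> J i \<and>
     Q i = colon R (J i) w" if "i \<le> length xs" for i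
    using that
  proof (induction i)
    case 0
    have "J 0 = {\<zero>}" 
      using genideal_minimal[OF zeroideal, of "{}"] additive_subgroup.zero_closed[OF ideal.axioms(1)[OF J[of 0]]] 
      by (auto simp: J_def)
    with c obtain w where "w \<in> carrier R" "w \<notin> J 0" "primeideal (colon R (J 0) w) R"
      "colon R {\<zero>} c \<subseteq> colon R (J 0) w"
      using exists_prime_colon[OF noetherian_ring_axioms J[of 0] c(1)] by auto
    then show ?case by (intro exI[of _ "\<lambda>_. colon R (J 0) w"] exI[of _ w]) (auto simp: prime_chain_def)
  next
    case (Suc i)
    then obtain Q w where Q: "prime_chain R i Q" "colon R {\<zero>} c \<subseteq> Q 0" "w \<in> carrier R"
      "w \<notin> J i" "Q i = colon R (J i) w" by auto
    let ?x = "xs ! i"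
    have x: "?x \<in> M" "?x \<in> carrier R"
      using Suc.prems xs by (auto simp: regular_sequence_def subset_iff)
    have reg: "a \<in> J i" if "a \<in> carrier R" "?x \<otimes> a \<in> J i" for a
      using that xs(1) Suc.prems by (auto simp: regular_sequence_def J_def)
    have J': "J (Suc i) = J i <+>\<^bsub>R\<^esub> PIdl ?x"
      using genideal_insert[OF sub x(2)] Suc.prems by (simp add: J_def take_Suc_conv_app_nth)
    obtain v where v: "v \<in> carrier R" "v \<notin> J (Suc i)" "Q i \<subseteq> colon R (J (Suc i)) v"
        "?x \<in> colon R (J (Suc i)) v"
      unfolding J' using annihilator_mod_regular[OF loc J x(1) reg _ Q(3,4), of "Q i"] Q(5) by blast
    obtain u where u: "u \<in> carrier R" "u \<notin> J (Suc i)" "primeideal (colon R (J (Suc i)) u) R"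
        "colon R (J (Suc i)) v \<subseteq> colon R (J (Suc i)) u"
      using exists_prime_colon[OF noetherian_ring_axioms J v(1,2)] by blast
    let ?Q = "Q(Suc i := colon R (J (Suc i)) u)"
    have "?x \<notin> Q i"
      using Q(3-5) reg[of w] by (auto simp: colon_def)
    then have "Q i \<subset> colon R (J (Suc i)) u" using v u by blast
    then have "prime_chain R (Suc i) ?Q"
      using Q(1) u(3) by (auto simp: prime_chain_def le_Suc_eq less_Suc_eq)
    moreover have "colon R {\<zero>} c \<subseteq> ?Q 0" using Q by simp
    ultimately show ?case using u(1,2) by (metis fun_upd_same)
  qed
  then show thesis using that by blast
qed

section \<open>Contraction and extension along a localization\<close>

lemma (in ideal) unit_mult_cancel:
  assumes "u \<in> Units R" "x \<in> carrier R" "u \<otimes> x \<in> I"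
  shows "x \<in> I"
proof -
  obtain v where v: "v \<in> carrier R" "v \<otimes> u = \<one>" using assms(1) by (auto simp: Units_def)
  have "v \<otimes> (u \<otimes> x) \<in> I" using v assms(3) by (simp add: I_l_closed)
  moreover have "v \<otimes> (u \<otimes> x) = x"
    using v assms Units_closed[OF assms(1)] by (subst m_assoc[symmetric]) auto
  ultimately show ?thesis by simp
qed

text \<open>Ideals of S are compared with ideals of R through numerators, whatever the construction
  of S. The instances are R/I, with 1 as the single denominator, and the localizations of
  R/I.\<close>

locale fraction_hom = ring_hom_cring R S h for R (structure) and S (structure) and h +
  fixes U
  assumes denominators_closed: "U \<subseteq> carrier R"
    and denominators_unit: "s \<in> U \<Longrightarrow> h s \<in> Units S"
    and fraction: "x \<in> carrier S \<Longrightarrow> \<exists>a\<in>carrier R. \<exists>s\<in>U. h s \<otimes>\<^bsub>S\<^esub> x = h a"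
begin

definition contraction :: "'c set \<Rightarrow> 'a set" where
  "contraction Q = {r \<in> carrier R. h r \<in> Q}"

lemma contraction_ideal: "ideal Q S \<Longrightarrow> ideal (contraction Q) R"
  unfolding contraction_def by (rule ring.ideal_vimage)

lemma contraction_prime: "primeideal Q S \<Longrightarrow> primeideal (contraction Q) R"
  unfolding contraction_def by (rule ring.primeideal_vimage[OF R.is_cring])

text \<open>Each x in S has the form \<open>h a\<close> divided by a unit \<open>h s\<close>, so an
  ideal of S is determined by the numerators \<open>h a\<close> in it.\<close>

lemma contraction_subset_iff:
  assumes "ideal Q S" "ideal Q' S"
  shows "contraction Q \<subseteq> contraction Q' \<longleftrightarrow> Q \<subseteq> Q'"
proof
  assume sub: "contraction Q \<subseteq> contraction Q'"
  show "Q \<subseteq> Q'"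
  proof
    fix x assume "x \<in> Q"
    then have x: "x \<in> carrier S" using assms(1) by (simp add: ideal.Icarr)
    then obtain a s where as: "a \<in> carrier R" "s \<in> U" "h s \<otimes>\<^bsub>S\<^esub> x = h a" using fraction by blast
    have "h s \<in> carrier S" using as denominators_unit by blast
    then have "h a \<in> Q" using as(3) ideal.I_l_closed[OF assms(1) \<open>x \<in> Q\<close>] by metis
    then have "h s \<otimes>\<^bsub>S\<^esub> x \<in> Q'" using sub as by (auto simp: contraction_def)
    then show "x \<in> Q'" by (rule ideal.unit_mult_cancel[OF assms(2) denominators_unit[OF as(2)] x])
  qed
qed (auto simp: contraction_def)

lemma contraction_prime_chain:
  assumes "prime_chain S n P"
  shows "prime_chain R n (\<lambda>i. contraction (P i))"
proof -
  have "ideal (P i) S" if "i \<le> n" for i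
    using assms that by (auto simp: prime_chain_def primeideal.axioms)
  then show ?thesis
    using assms contraction_subset_iff unfolding prime_chain_def
    by (simp add: contraction_prime less_le_not_le)
qed

text \<open>The contraction of J contains I, so it is generated by a finite X together with I. As I
  maps to zero, the images of X alone generate J. The hypothesis speaks of ideals above I because
  that is the finiteness proved for the coordinate axes.\<close>

lemma noetherian_fractions:
  assumes ker: "\<And>a. a \<in> I \<Longrightarrow> a \<in> carrier R \<and> h a = \<zero>\<^bsub>S\<^esub>"
    and fg: "\<And>J. ideal J R \<Longrightarrow> I \<subseteq> J \<Longrightarrow> \<exists>X\<subseteq>carrier R. finite X \<and> J = Idl (X \<union> I)"
  shows "noetherian_ring S"
proof (rule S.noetherian_ringI)
  fix J assume J: "ideal J S"
  interpret J: ideal J S by fact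
  have "I \<subseteq> contraction J" using ker by (auto simp: contraction_def)
  then obtain X where X: "X \<subseteq> carrier R" "finite X" "contraction J = Idl (X \<union> I)"
    using fg[OF contraction_ideal[OF J]] by blast
  have hX: "h ` X \<subseteq> carrier S" using X(1) by auto
  have id: "ideal (Idl\<^bsub>S\<^esub> (h ` X)) S" by (rule S.genideal_ideal[OF hX])
  then have "\<zero>\<^bsub>S\<^esub> \<in> Idl\<^bsub>S\<^esub> (h ` X)" by (simp add: additive_subgroup.zero_closed ideal.axioms)
  then have "X \<union> I \<subseteq> contraction (Idl\<^bsub>S\<^esub> (h ` X))"
    using X(1) ker S.genideal_self[OF hX] by (auto simp: contraction_def)
  then have "contraction J \<subseteq> contraction (Idl\<^bsub>S\<^esub> (h ` X))"
    unfolding X(3) by (rule R.genideal_minimal[OF contraction_ideal[OF id]])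
  then have "J \<subseteq> Idl\<^bsub>S\<^esub> (h ` X)" using contraction_subset_iff[OF J id] by simp
  moreover have "X \<union> I \<subseteq> contraction J"
    unfolding X(3) using X(1) ker by (intro R.genideal_self) auto
  then have "Idl\<^bsub>S\<^esub> (h ` X) \<subseteq> J"
    by (intro S.genideal_minimal[OF J]) (auto simp: contraction_def)
  ultimately show "\<exists>A\<subseteq>carrier S. finite A \<and> J = Idl\<^bsub>S\<^esub> A"
    using X(2) hX by (intro exI[of _ "h ` X"]) auto
qed

end

section \<open>Localizing a quotient at a prime\<close>

lemma (in primeideal) mult_notin:
  assumes "a \<in> carrier R - I" "b \<in> carrier R - I"
  shows "a \<otimes> b \<in> carrier R - I"
  using assms I_prime by auto

text \<open>The hypotheses describe the localization of \<open>R/I\<close> at the image of the prime \<open>N\<close>.\<close>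

locale local_fraction_hom = ring_hom_cring R S h for R (structure) and S (structure) and h +
  fixes I N
  assumes N: "primeideal N R" and I: "ideal I R" and I_subset: "I \<subseteq> N"
    and unit_outside: "s \<in> carrier R - N \<Longrightarrow> h s \<in> Units S"
    and fraction_outside: "x \<in> carrier S \<Longrightarrow> \<exists>a\<in>carrier R. \<exists>s\<in>carrier R - N. h s \<otimes>\<^bsub>S\<^esub> x = h a"
    and hom_zero_iff: "a \<in> carrier R \<Longrightarrow> h a = \<zero>\<^bsub>S\<^esub> \<longleftrightarrow> (\<exists>s\<in>carrier R - N. s \<otimes> a \<in> I)"

sublocale local_fraction_hom \<subseteq> fraction_hom R S h "carrier R - N"
  using unit_outside fraction_outside by unfold_locales auto

context local_fraction_hom
begin

text \<open>For an ideal P this is the extended ideal P S: sums of multiples of elements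
  \<open>h p\<close> can be brought to a common denominator.\<close>

definition extension :: "'a set \<Rightarrow> 'c set" where
  "extension P = {x \<in> carrier S. \<exists>a\<in>P. \<exists>s\<in>carrier R - N. h s \<otimes>\<^bsub>S\<^esub> x = h a}"

lemma I_zero: "a \<in> I \<Longrightarrow> h a = \<zero>\<^bsub>S\<^esub>"
proof -
  assume a: "a \<in> I"
  interpret I: ideal I R by (rule I)
  interpret N: primeideal N R by (rule N)
  have "\<one> \<in> carrier R - N" using N.I_notcarr N.one_imp_carrier by auto
  moreover have "a \<in> carrier R" "\<one> \<otimes> a \<in> I" using a by auto
  ultimately show ?thesis using hom_zero_iff[of a] by blast
qed

context
  fixes P
  assumes P: "primeideal P R" and IP: "I \<subseteq> P" and PN: "P \<subseteq> N"
begin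

interpretation P: primeideal P R by (rule P)
interpretation N: primeideal N R by (rule N)

text \<open>The equation \<open>h (s a) = h b\<close> only says that t (s a - b) lies in I for some
  t outside N. Since P is a prime between I and N, both t and s can be cancelled modulo P.\<close>

lemma hom_mem_extension_iff:
  assumes "a \<in> carrier R"
  shows "h a \<in> extension P \<longleftrightarrow> a \<in> P"
proof
  assume "h a \<in> extension P"
  then obtain b s where b: "b \<in> P" "s \<in> carrier R - N" "h s \<otimes>\<^bsub>S\<^esub> h a = h b"
    by (auto simp: extension_def)
  have c: "s \<in> carrier R" "b \<in> carrier R" using b by auto
  have "h (s \<otimes> a \<ominus> b) = h s \<otimes>\<^bsub>S\<^esub> h a \<ominus>\<^bsub>S\<^esub> h b"
    using assms c by (simp add: a_minus_def)
  also have "\<dots> = \<zero>\<^bsub>S\<^esub>" unfolding b(3) using c by (simp add: S.r_right_minus_eq)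
  finally obtain t where t: "t \<in> carrier R - N" "t \<otimes> (s \<otimes> a \<ominus> b) \<in> I"
    using assms c hom_zero_iff[of "s \<otimes> a \<ominus> b"] by auto
  then have "s \<otimes> a \<ominus> b \<in> P"
    using IP PN P.I_prime[of t "s \<otimes> a \<ominus> b"] assms c by auto
  then have "(s \<otimes> a \<ominus> b) \<oplus> b \<in> P" using b by simp
  moreover have "(s \<otimes> a \<ominus> b) \<oplus> b = s \<otimes> a" using assms c by algebra
  ultimately have "s \<otimes> a \<in> P" by simp
  then show "a \<in> P" using P.I_prime[of s a] assms b PN by auto
next
  assume "a \<in> P"
  moreover have "\<one> \<in> carrier R - N" using N.I_notcarr N.one_imp_carrier by auto
  ultimately show "h a \<in> extension P" using assms by (force simp: extension_def)
qed

lemma contraction_extension: "contraction (extension P) = P"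
  using hom_mem_extension_iff by (auto simp: contraction_def)

lemma extension_prime: "primeideal (extension P) S"
proof -
  have memI: "x \<in> extension P" if "x \<in> carrier S" "a \<in> P" "s \<in> carrier R - N" "h s \<otimes>\<^bsub>S\<^esub> x = h a" for x a s
    using that by (auto simp: extension_def)
  have mult: "y \<otimes>\<^bsub>S\<^esub> x \<in> extension P" if x: "x \<in> extension P" and y: "y \<in> carrier S" for x y
  proof -
    obtain a s where a: "x \<in> carrier S" "a \<in> P" "s \<in> carrier R - N" "h s \<otimes>\<^bsub>S\<^esub> x = h a"
      using x by (auto simp: extension_def)
    obtain b t where b: "b \<in> carrier R" "t \<in> carrier R - N" "h t \<otimes>\<^bsub>S\<^esub> y = h b"
      using fraction y by blast
    have "h (t \<otimes> s) \<otimes>\<^bsub>S\<^esub> (y \<otimes>\<^bsub>S\<^esub> x) = (h t \<otimes>\<^bsub>S\<^esub> y) \<otimes>\<^bsub>S\<^esub> (h s \<otimes>\<^bsub>S\<^esub> x)"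
      using a(1,3) b(1,2) y by (simp add: S.m_ac)
    also have "\<dots> = h (b \<otimes> a)" unfolding a(4) b(3) using a(2) b(1) by simp
    finally show ?thesis
      using a(1-3) b(1,2) y N.mult_notin[OF b(2) a(3)]
      by (intro memI[of _ "b \<otimes> a" "t \<otimes> s"]) (auto simp: P.I_l_closed)
  qed
  have id: "ideal (extension P) S"
  proof (rule idealI)
    show "subgroup (extension P) (add_monoid S)"
    proof (rule S.add.subgroupI)
      show "extension P \<subseteq> carrier S" by (auto simp: extension_def)
      show "extension P \<noteq> {}" using hom_mem_extension_iff[of \<zero>] by auto
      fix x assume x: "x \<in> extension P"
      then have xc: "x \<in> carrier S" by (simp add: extension_def)
      have "\<ominus>\<^bsub>S\<^esub> x = (\<ominus>\<^bsub>S\<^esub> \<one>\<^bsub>S\<^esub>) \<otimes>\<^bsub>S\<^esub> x" using xc by algebra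
      then show "\<ominus>\<^bsub>S\<^esub> x \<in> extension P" using mult[OF x, of "\<ominus>\<^bsub>S\<^esub> \<one>\<^bsub>S\<^esub>"] by simp
      fix y assume "y \<in> extension P"
      then obtain b t where b: "y \<in> carrier S" "b \<in> P" "t \<in> carrier R - N" "h t \<otimes>\<^bsub>S\<^esub> y = h b"
        by (auto simp: extension_def)
      obtain a s where a: "a \<in> P" "s \<in> carrier R - N" "h s \<otimes>\<^bsub>S\<^esub> x = h a"
        using x by (auto simp: extension_def)
      have "h (t \<otimes> s) \<otimes>\<^bsub>S\<^esub> (x \<oplus>\<^bsub>S\<^esub> y) =
          h t \<otimes>\<^bsub>S\<^esub> (h s \<otimes>\<^bsub>S\<^esub> x) \<oplus>\<^bsub>S\<^esub> h s \<otimes>\<^bsub>S\<^esub> (h t \<otimes>\<^bsub>S\<^esub> y)"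
        using a(2) b(1,3) xc by (simp add: S.r_distr S.m_ac)
      also have "\<dots> = h (t \<otimes> a \<oplus> s \<otimes> b)" unfolding a(3) b(4) using a(1,2) b(2,3) by simp
      finally show "x \<oplus>\<^bsub>S\<^esub> y \<in> extension P"
        using a(1,2) b(1-3) xc N.mult_notin[OF b(3) a(2)]
        by (intro memI[of _ "t \<otimes> a \<oplus> s \<otimes> b" "t \<otimes> s"]) (auto simp: P.I_l_closed)
    qed
    fix x y assume "x \<in> extension P" "y \<in> carrier S"
    then show "y \<otimes>\<^bsub>S\<^esub> x \<in> extension P" by (rule mult)
    moreover have "x \<in> carrier S" using \<open>x \<in> extension P\<close> by (simp add: extension_def)
    ultimately show "x \<otimes>\<^bsub>S\<^esub> y \<in> extension P" using \<open>y \<in> carrier S\<close> by (simp add: S.m_comm)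
  qed (rule S.ring_axioms)
  show ?thesis
  proof (rule primeidealI[OF id S.is_cring])
    have "h \<one> \<notin> extension P"
      using P.I_notcarr P.one_imp_carrier by (subst hom_mem_extension_iff) auto
    then show "carrier S \<noteq> extension P" by auto
    fix x y assume xy: "x \<in> carrier S" "y \<in> carrier S" "x \<otimes>\<^bsub>S\<^esub> y \<in> extension P"
    obtain a s where a: "a \<in> carrier R" "s \<in> carrier R - N" "h s \<otimes>\<^bsub>S\<^esub> x = h a"
      using fraction xy(1) by blast
    obtain b t where b: "b \<in> carrier R" "t \<in> carrier R - N" "h t \<otimes>\<^bsub>S\<^esub> y = h b"
      using fraction xy(2) by blast
    have "h (s \<otimes> t) \<otimes>\<^bsub>S\<^esub> (x \<otimes>\<^bsub>S\<^esub> y) = (h s \<otimes>\<^bsub>S\<^esub> x) \<otimes>\<^bsub>S\<^esub> (h t \<otimes>\<^bsub>S\<^esub> y)"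
      using a(2) b(2) xy(1,2) by (simp add: S.m_ac)
    also have "\<dots> = h (a \<otimes> b)" unfolding a(3) b(3) using a(1) b(1) by simp
    finally have "h (a \<otimes> b) = h (s \<otimes> t) \<otimes>\<^bsub>S\<^esub> (x \<otimes>\<^bsub>S\<^esub> y)" by simp
    then have "h (a \<otimes> b) \<in> extension P" using mult[OF xy(3), of "h (s \<otimes> t)"] a b by simp
    then have "a \<otimes> b \<in> P" using a(1) b(1) hom_mem_extension_iff[of "a \<otimes> b"] by blast
    then have "a \<in> P \<or> b \<in> P" using P.I_prime a b by simp
    then show "x \<in> extension P \<or> y \<in> extension P" using memI a b xy by blast
  qed
qed

end

text \<open>Extending every prime of the chain gives primes of S, and the inclusions remain strict
  because contraction recovers each \<open>P i\<close>.\<close>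

lemma krull_dim_ge:
  assumes chain: "prime_chain R n P" and "I \<subseteq> P 0" "P n \<subseteq> N"
  shows "enat n \<le> krull_dim S"
proof -
  have mono: "P i \<subseteq> P j" if "i \<le> j" "j \<le> n" for i j
    using that(1,2)
  proof (induction j rule: dec_induct)
    case (step j)
    then have "P j \<subset> P (Suc j)" using chain by (simp add: prime_chain_def)
    then show ?case using step by force
  qed simp
  have P: "primeideal (P i) R" "I \<subseteq> P i" "P i \<subseteq> N" if "i \<le> n" for i
    using chain mono[of 0 i] mono[of i n] assms(2,3) that by (auto simp: prime_chain_def)
  have ext: "primeideal (extension (P i)) S" "contraction (extension (P i)) = P i" if "i \<le> n" for i
    using extension_prime[OF P] contraction_extension[OF P] that by auto
  have "extension (P i) \<subset> extension (P (Suc i))" if "i < n" for i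
  proof -
    have "P i \<subset> P (Suc i)" using chain that by (simp add: prime_chain_def)
    then show ?thesis
      using that ext[of i] ext[of "Suc i"]
        contraction_subset_iff[of "extension (P i)" "extension (P (Suc i))"]
        contraction_subset_iff[of "extension (P (Suc i))" "extension (P i)"]
      by (simp add: less_le_not_le primeideal.axioms)
  qed
  then have "prime_chain S n (\<lambda>i. extension (P i))" using ext by (simp add: prime_chain_def)
  then show ?thesis
    unfolding krull_dim_def by (intro SUP_upper) (auto simp: prime_chain_def)
qed

lemma unit_outside_extension:
  assumes "x \<in> carrier S" "x \<notin> extension N"
  shows "x \<in> Units S"
proof -
  obtain a s where a: "a \<in> carrier R" "s \<in> carrier R - N" "h s \<otimes>\<^bsub>S\<^esub> x = h a"
    using fraction assms(1) by blast
  then have "a \<in> carrier R - N" using assms by (auto simp: extension_def)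
  then have u: "h s \<otimes>\<^bsub>S\<^esub> x \<in> Units S" using a(3) unit_outside by simp
  then show ?thesis
    using S.unit_factor[of x "h s"] assms(1) a(2) by (simp add: S.m_comm)
qed

text \<open>Everything outside \<open>extension N\<close> is a unit, so every proper ideal of S is
  contained in it.\<close>

lemma maximal_ideals: "{M. maximalideal M S} = {extension N}"
proof -
  have prime: "primeideal (extension N) S" using extension_prime[OF N I_subset] by simp
  interpret E: primeideal "extension N" S by fact
  have proper: "J \<subseteq> extension N" if "ideal J S" "J \<noteq> carrier S" for J
  proof
    fix x assume "x \<in> J"
    interpret J: ideal J S by fact
    show "x \<in> extension N"
    proof (rule ccontr)
      assume "x \<notin> extension N"
      then have "x \<in> Units S" using \<open>x \<in> J\<close> by (intro unit_outside_extension) auto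
      then have "\<one>\<^bsub>S\<^esub> \<in> J" using J.unit_mult_cancel[of x "\<one>\<^bsub>S\<^esub>"] \<open>x \<in> J\<close> by simp
      then show False using that(2) J.one_imp_carrier by simp
    qed
  qed
  have "maximalideal (extension N) S"
    using E.I_notcarr proper by (intro maximalidealI) (auto intro: E.is_ideal)
  moreover have "M = extension N" if "maximalideal M S" for M
  proof -
    interpret M: maximalideal M S by fact
    have "M \<subseteq> extension N" using M.I_notcarr by (intro proper M.is_ideal) auto
    then show ?thesis
      using M.I_maximal[OF E.is_ideal] E.I_notcarr E.a_subset by blast
  qed
  ultimately show ?thesis by blast
qed

end

lemma FactRing_zero: "\<zero>\<^bsub>R Quot I\<^esub> = I"
  by (simp add: FactRing_def)

lemma FactRing_carrier_rep:
  assumes "x \<in> carrier (R Quot I)"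
  obtains a where "a \<in> carrier R" "x = I +>\<^bsub>R\<^esub> a"
  using assms by (auto simp: FactRing_def A_RCOSETS_def')

text \<open>The map is R -> R/I followed by the localization map. Denominators outside M are the
  classes of elements outside the preimage N, which turns the fraction condition and the kernel into
  statements about R.\<close>

lemma quotient_localization_hom:
  assumes "cring R" and I: "ideal I R" and M: "primeideal M (R Quot I)"
  defines "T \<equiv> carrier (R Quot I) - M" and "N \<equiv> {a \<in> carrier R. I +>\<^bsub>R\<^esub> a \<in> M}"
  shows "local_fraction_hom R (localization_at (R Quot I) M)
    (\<lambda>a. loc_frac (R Quot I) T (I +>\<^bsub>R\<^esub> a) \<one>\<^bsub>R Quot I\<^esub>) I N"
proof -
  let ?Q = "R Quot I" and ?L = "localization_at (R Quot I) M"
  let ?h = "\<lambda>a. loc_frac ?Q T (I +>\<^bsub>R\<^esub> a) \<one>\<^bsub>?Q\<^esub>"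
  interpret R: cring R by fact
  interpret I: ideal I R by fact
  interpret q: ring_hom_cring R ?Q "(+>\<^bsub>R\<^esub>) I" by (rule I.rcos_ring_hom_cring[OF R.is_cring])
  interpret M: primeideal M ?Q by fact
  have one: "\<one>\<^bsub>?Q\<^esub> \<in> T" using M.I_notcarr M.one_imp_carrier by (auto simp: T_def)
  interpret T: mult_subset ?Q T
    using one by unfold_locales (auto simp: T_def dest: M.I_prime)
  have L: "?L = localization ?Q T" by (simp add: localization_at_def T_def)
  have Lcring: "cring ?L" unfolding L by (rule T.localization_cring)
  have surj: "\<exists>a\<in>carrier R. x = I +>\<^bsub>R\<^esub> a" if "x \<in> carrier ?Q" for x
    using that by (rule FactRing_carrier_rep) blast
  have zero_iff: "I +>\<^bsub>R\<^esub> a = \<zero>\<^bsub>?Q\<^esub> \<longleftrightarrow> a \<in> I" if a: "a \<in> carrier R" for a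
    unfolding FactRing_zero
  proof
    assume "I +>\<^bsub>R\<^esub> a = I"
    then show "a \<in> I" using I.a_rcos_self[OF a] by simp
  qed (rule I.a_rcos_const)
  have T_iff: "I +>\<^bsub>R\<^esub> s \<in> T \<longleftrightarrow> s \<in> carrier R - N" if "s \<in> carrier R" for s
    using that q.hom_closed[OF that] unfolding T_def N_def by blast
  show ?thesis
  proof (intro local_fraction_hom.intro local_fraction_hom_axioms.intro)
    show "ring_hom_cring R ?L ?h"
    proof (intro ring_hom_cring.intro ring_hom_cring_axioms.intro ring_hom_memI)
      show "cring R" "cring ?L" by fact+
      show "?h \<one>\<^bsub>R\<^esub> = \<one>\<^bsub>?L\<^esub>" by (simp add: L T.localization_one)
      fix a assume a: "a \<in> carrier R"
      then show "?h a \<in> carrier ?L"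
        unfolding L T.localization_carrier_iff using one q.hom_closed by blast
      fix b assume b: "b \<in> carrier R"
      show "?h (a \<otimes>\<^bsub>R\<^esub> b) = ?h a \<otimes>\<^bsub>?L\<^esub> ?h b"
        using a b one by (simp add: L T.localization_mult)
      show "?h (a \<oplus>\<^bsub>R\<^esub> b) = ?h a \<oplus>\<^bsub>?L\<^esub> ?h b"
        using a b one by (simp add: L T.localization_add)
    qed
    show "primeideal N R"
      unfolding N_def using q.ring.primeideal_vimage[OF R.is_cring M] .
    show "ideal I R" by fact
    show "I \<subseteq> N"
    proof
      fix a assume "a \<in> I"
      then have "a \<in> carrier R" "I +>\<^bsub>R\<^esub> a = \<zero>\<^bsub>?Q\<^esub>" using zero_iff I.Icarr by auto
      then show "a \<in> N" using M.zero_closed by (simp add: N_def)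
    qed
  next
    fix s assume s: "s \<in> carrier R - N"
    then have sT: "I +>\<^bsub>R\<^esub> s \<in> T" using T_iff by auto
    have inv: "loc_frac ?Q T \<one>\<^bsub>?Q\<^esub> (I +>\<^bsub>R\<^esub> s) \<in> carrier ?L"
      unfolding L T.localization_carrier_iff using sT by blast
    moreover have hs: "?h s \<in> carrier ?L"
      unfolding L T.localization_carrier_iff using one sT s by blast
    moreover have eq: "?h s \<otimes>\<^bsub>?L\<^esub> loc_frac ?Q T \<one>\<^bsub>?Q\<^esub> (I +>\<^bsub>R\<^esub> s) = \<one>\<^bsub>?L\<^esub>"
      using sT one s
      by (auto simp: L T.localization_mult T.localization_one T.loc_frac_eq_iff
          intro!: exI[of _ "\<one>\<^bsub>?Q\<^esub>"])
    ultimately show "?h s \<in> Units ?L"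
      using comm_monoid.m_comm[OF cring.axioms(2)[OF Lcring] hs inv]
      by (auto simp: Units_def intro!: bexI[OF _ inv])
  next
    fix x assume "x \<in> carrier ?L"
    then obtain y t where y: "y \<in> carrier ?Q" "t \<in> T" "x = loc_frac ?Q T y t"
      unfolding L T.localization_carrier_iff by blast
    obtain a where a: "a \<in> carrier R" "y = I +>\<^bsub>R\<^esub> a" using surj[OF y(1)] by blast
    obtain s where s: "s \<in> carrier R" "t = I +>\<^bsub>R\<^esub> s" using surj[of t] y(2) by (auto simp: T_def)
    have "?h s \<otimes>\<^bsub>?L\<^esub> x = loc_frac ?Q T (t \<otimes>\<^bsub>?Q\<^esub> y) (t \<otimes>\<^bsub>?Q\<^esub> \<one>\<^bsub>?Q\<^esub>)"
      using y one by (simp add: s(2)[symmetric] L T.localization_mult)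
    also have "\<dots> = ?h a"
      unfolding a(2)[symmetric] using y one by (intro T.loc_frac_scale)
    finally show "\<exists>a\<in>carrier R. \<exists>s\<in>carrier R - N. ?h s \<otimes>\<^bsub>?L\<^esub> x = ?h a"
      using a s y(2) T_iff by blast
  next
    fix a assume a: "a \<in> carrier R"
    have "?h a = \<zero>\<^bsub>?L\<^esub> \<longleftrightarrow> (\<exists>u\<in>T. u \<otimes>\<^bsub>?Q\<^esub> (I +>\<^bsub>R\<^esub> a) = \<zero>\<^bsub>?Q\<^esub>)"
      using a one q.hom_closed[OF a] by (simp add: L T.localization_zero T.loc_frac_eq_iff)
    also have "\<dots> \<longleftrightarrow> (\<exists>s\<in>carrier R - N. (I +>\<^bsub>R\<^esub> s) \<otimes>\<^bsub>?Q\<^esub> (I +>\<^bsub>R\<^esub> a) = \<zero>\<^bsub>?Q\<^esub>)"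
      using surj T_iff unfolding T_def by (metis Diff_iff)
    also have "\<dots> \<longleftrightarrow> (\<exists>s\<in>carrier R - N. s \<otimes>\<^bsub>R\<^esub> a \<in> I)"
      using a zero_iff by (metis Diff_iff R.m_closed q.hom_mult)
    finally show "?h a = \<zero>\<^bsub>?L\<^esub> \<longleftrightarrow> (\<exists>s\<in>carrier R - N. s \<otimes>\<^bsub>R\<^esub> a \<in> I)" .
  qed
qed

context local_fraction_hom
begin

text \<open>The chain in S starts above the annihilator of \<open>h c\<close>. Multiplication by c
  sends I : c into I, which \<open>h\<close> kills, so the contracted chain starts above I :
  c.\<close>

lemma regular_sequence_contracted_chain:
  assumes "noetherian_local_ring M S" "regular_sequence S xs" "set xs \<subseteq> M"
    and c: "c \<in> carrier R" "h c \<noteq> \<zero>\<^bsub>S\<^esub>"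
  obtains Q where "prime_chain R (length xs) Q" "colon R I c \<subseteq> Q 0"
proof -
  obtain Q where Q: "prime_chain S (length xs) Q" "colon S {\<zero>\<^bsub>S\<^esub>} (h c) \<subseteq> Q 0"
    using S.regular_sequence_prime_chain[OF assms(1-3) _ c(2)] c(1) by blast
  have "colon R I c \<subseteq> contraction (Q 0)"
  proof
    fix a assume "a \<in> colon R I c"
    then have a: "a \<in> carrier R" "a \<otimes> c \<in> I" by (auto simp: colon_def)
    then have "h a \<otimes>\<^bsub>S\<^esub> h c = \<zero>\<^bsub>S\<^esub>" using I_zero[of "a \<otimes> c"] c(1) by simp
    then show "a \<in> contraction (Q 0)" using Q(2) a(1) by (auto simp: colon_def contraction_def)
  qed
  then show thesis using that contraction_prime_chain[OF Q(1)] by blast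
qed

lemma ideal_depth_le:
  assumes "noetherian_local_ring M S" and c: "c \<in> carrier R" "h c \<noteq> \<zero>\<^bsub>S\<^esub>"
    and bound: "\<And>n Q. prime_chain R n Q \<Longrightarrow> colon R I c \<subseteq> Q 0 \<Longrightarrow> n \<le> d"
  shows "ideal_depth M S \<le> enat d"
  unfolding ideal_depth_def
proof (rule SUP_least, clarsimp)
  fix xs assume "regular_sequence S xs" "set xs \<subseteq> M"
  then show "length xs \<le> d"
    using regular_sequence_contracted_chain[OF assms(1) _ _ c] bound by metis
qed

lemma krull_dim_le:
  assumes "\<And>n Q. prime_chain R n Q \<Longrightarrow> I \<subseteq> Q 0 \<Longrightarrow> n \<le> d"
  shows "krull_dim S \<le> enat d"
  unfolding krull_dim_def
proof (rule SUP_least, clarsimp)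
  fix n P assume "\<forall>i\<le>n. primeideal (P i) S" "\<forall>i<n. P i \<subset> P (Suc i)"
  then have P: "prime_chain S n P" by (simp add: prime_chain_def)
  then have "primeideal (P 0) S" by (simp add: prime_chain_def)
  then have "\<zero>\<^bsub>S\<^esub> \<in> P 0"
    by (simp add: primeideal_def ideal_def additive_subgroup.zero_closed)
  then have "I \<subseteq> contraction (P 0)"
    using I_zero ideal.Icarr[OF I] by (auto simp: contraction_def)
  then show "n \<le> d" using assms[OF contraction_prime_chain[OF P]] by blast
qed

text \<open>Depth and dimension are both squeezed to one. The image of f is a regular sequence of
  length one, and the prime chain produced by a regular sequence bounds the dimension from below
  too; both upper bounds come from the chains above I.\<close>

lemma cohen_macaulay_local_dim_one:
  assumes noeth: "noetherian_ring S"
    and dim: "\<And>n Q. prime_chain R n Q \<Longrightarrow> I \<subseteq> Q 0 \<Longrightarrow> n \<le> 1"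
    and f: "f \<in> N" "\<And>a. a \<in> carrier R \<Longrightarrow> f \<otimes> a \<in> I \<Longrightarrow> a \<in> I"
  shows "cohen_macaulay_local_ring S"
proof -
  interpret N: primeideal N R by (rule N)
  let ?M = "extension N"
  have E: "primeideal ?M S" by (rule extension_prime[OF N I_subset]) simp
  interpret E: primeideal ?M S by (rule E)
  have loc: "noetherian_local_ring ?M S"
    using noeth maximal_ideals S.is_cring by (simp add: noetherian_local_ring_def)
  have fc: "f \<in> carrier R" using f(1) by simp
  have hf: "h f \<in> ?M"
    using hom_mem_extension_iff[OF N I_subset _ fc] f(1) by simp
  have zero: "Idl\<^bsub>S\<^esub> {} = {\<zero>\<^bsub>S\<^esub>}"
    using S.genideal_minimal[OF S.zeroideal, of "{}"]
      additive_subgroup.zero_closed[OF ideal.axioms(1)[OF S.genideal_ideal[of "{}"]]] by auto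
  have nzd: "x = \<zero>\<^bsub>S\<^esub>" if x: "x \<in> carrier S" and 0: "h f \<otimes>\<^bsub>S\<^esub> x = \<zero>\<^bsub>S\<^esub>" for x
  proof -
    obtain a s where a: "a \<in> carrier R" "s \<in> carrier R - N" "h s \<otimes>\<^bsub>S\<^esub> x = h a"
      using fraction x by blast
    have "h (f \<otimes> a) = h s \<otimes>\<^bsub>S\<^esub> (h f \<otimes>\<^bsub>S\<^esub> x)"
      using a(1,2) x fc by (simp add: a(3)[symmetric] S.m_lcomm)
    also have "\<dots> = \<zero>\<^bsub>S\<^esub>" unfolding 0 using a(2) by simp
    finally obtain t where t: "t \<in> carrier R - N" "t \<otimes> (f \<otimes> a) \<in> I"
      using hom_zero_iff[of "f \<otimes> a"] a fc by auto
    have "f \<otimes> (t \<otimes> a) \<in> I" using t a(1) fc by (simp add: R.m_lcomm)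
    then have "t \<otimes> a \<in> I" using f(2)[of "t \<otimes> a"] t(1) a(1) by simp
    then have "h a = \<zero>\<^bsub>S\<^esub>" using hom_zero_iff[OF a(1)] t(1) by blast
    then have "h s \<otimes>\<^bsub>S\<^esub> x \<in> {\<zero>\<^bsub>S\<^esub>}" using a(3) by simp
    then show ?thesis
      using ideal.unit_mult_cancel[OF S.zeroideal unit_outside[OF a(2)] x] by simp
  qed
  have reg: "regular_sequence S [h f]"
    unfolding regular_sequence_def
  proof (intro conjI allI impI ballI)
    have "Idl\<^bsub>S\<^esub> {h f} \<subseteq> ?M" by (rule S.genideal_minimal[OF E.is_ideal]) (simp add: hf)
    then show "Idl\<^bsub>S\<^esub> (set [h f]) \<noteq> carrier S" using E.I_notcarr E.a_subset by auto
  qed (use fc nzd zero in auto)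
  have ne: "h \<one> \<noteq> \<zero>\<^bsub>S\<^esub>"
    using E.I_notcarr E.one_imp_carrier E.zero_closed by (metis hom_one)
  have "1 \<le> ideal_depth ?M S"
    unfolding ideal_depth_def using reg hf by (intro SUP_upper2[of "[h f]"]) (auto simp: one_enat_def)
  \<comment> \<open>With c = 1 the annihilator I : 1 contains I, so the bound on the dimension also
    bounds the depth.\<close>
  moreover have "ideal_depth ?M S \<le> enat 1"
  proof (rule ideal_depth_le[OF loc _ ne])
    fix n Q assume Q: "prime_chain R n Q" "colon R I \<one> \<subseteq> Q 0"
    have "I \<subseteq> colon R I \<one>" using ideal.Icarr[OF I] by (auto simp: colon_def)
    then show "n \<le> 1" using dim Q by blast
  qed simp
  moreover have "krull_dim S \<le> enat 1" using dim by (rule krull_dim_le)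
  moreover have "1 \<le> krull_dim S"
  proof -
    obtain Q where "prime_chain S (length [h f]) Q"
      using S.regular_sequence_prime_chain[OF loc reg, of "h \<one>"] hf ne by auto
    then show ?thesis
      unfolding krull_dim_def
      by (intro SUP_upper2[of 1]) (auto simp: prime_chain_def one_enat_def)
  qed
  ultimately show ?thesis
    using loc by (auto simp: cohen_macaulay_local_ring_def one_enat_def)
qed

end

section \<open>Ideals of polynomials determined by monomials\<close>

abbreviation (input) keys where "keys \<equiv> Poly_Mapping.keys"
abbreviation (input) lookup where "lookup \<equiv> Poly_Mapping.lookup"
abbreviation (input) single where "single \<equiv> Poly_Mapping.single"

section \<open>Coefficients and leading terms of products\<close>

lemma poly_mapping_sum_single: "(\<Sum>m\<in>keys p. single m (lookup p m)) = p"
proof (rule poly_mapping_eqI)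
  fix k
  have "lookup (\<Sum>m\<in>keys p. single m (lookup p m)) k = (\<Sum>m\<in>keys p. if m = k then lookup p m else 0)"
    by (auto simp: lookup_sum lookup_single when_def intro!: sum.cong)
  also have "\<dots> = lookup p k" by (auto simp: in_keys_iff)
  finally show "lookup (\<Sum>m\<in>keys p. single m (lookup p m)) k = lookup p k" .
qed

lemma lookup_mult_sum:
  fixes p q :: "'a::monoid_add \<Rightarrow>\<^sub>0 'b::semiring_0"
  shows "lookup (p * q) k = (\<Sum>a\<in>keys p. \<Sum>b\<in>keys q. if a + b = k then lookup p a * lookup q b else 0)"
proof -
  have "p * q = (\<Sum>a\<in>keys p. single a (lookup p a)) * (\<Sum>b\<in>keys q. single b (lookup q b))"
    by (simp add: poly_mapping_sum_single)
  also have "\<dots> = (\<Sum>a\<in>keys p. \<Sum>b\<in>keys q. single (a + b) (lookup p a * lookup q b))"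
    by (simp add: sum_product mult_single)
  finally show ?thesis by (auto simp: lookup_sum lookup_single when_def intro!: sum.cong)
qed

lemma keys_add_nat: "keys (m + n) = keys m \<union> keys n" for m n :: "'v \<Rightarrow>\<^sub>0 nat"
  by (auto simp: in_keys_iff lookup_add)

text \<open>Exponents are read as digits: with a base B above every exponent occurring in A, the
  code is additive and determines the exponent vector on A. Each induction step inserts a new lowest
  digit. The code serves as the weight in a leading term argument.\<close>

lemma finite_exponents_additive_injective:
  fixes A :: "('v \<Rightarrow>\<^sub>0 nat) set"
  assumes "finite V" "finite A" "\<And>m. m \<in> A \<Longrightarrow> keys m \<subseteq> V"
  shows "\<exists>\<phi> :: ('v \<Rightarrow>\<^sub>0 nat) \<Rightarrow> nat. inj_on \<phi> A \<and> (\<forall>m n. \<phi> (m + n) = \<phi> m + \<phi> n)"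
proof -
  define B where "B = Suc (\<Sum>m\<in>A. \<Sum>v\<in>V. lookup m v)"
  have less: "lookup m v < B" if "m \<in> A" "v \<in> V" for m v
  proof -
    have "lookup m v \<le> (\<Sum>v\<in>V. lookup m v)" using assms(1) that by (intro member_le_sum) auto
    also have "\<dots> \<le> (\<Sum>m\<in>A. \<Sum>v\<in>V. lookup m v)"
      using assms(2) that(1) by (intro member_le_sum[of m A "\<lambda>m. \<Sum>v\<in>V. lookup m v"]) auto
    finally show ?thesis by (simp add: B_def)
  qed
  have "\<exists>\<phi> :: ('v \<Rightarrow>\<^sub>0 nat) \<Rightarrow> nat. (\<forall>m\<in>A. \<forall>n\<in>A. \<phi> m = \<phi> n \<longrightarrow> (\<forall>v\<in>W. lookup m v = lookup n v)) \<and>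
     (\<forall>m n. \<phi> (m + n) = \<phi> m + \<phi> n)" if "W \<subseteq> V" for W
    using finite_subset[OF that assms(1)] that
  proof (induction W rule: finite_induct)
    case empty
    then show ?case by (intro exI[of _ "\<lambda>_. 0"]) simp
  next
    case (insert v W)
    have "W \<subseteq> V" using insert.prems by simp
    from insert.IH[OF this] obtain \<phi> :: "('v \<Rightarrow>\<^sub>0 nat) \<Rightarrow> nat" where
      \<phi>: "\<forall>m\<in>A. \<forall>n\<in>A. \<phi> m = \<phi> n \<longrightarrow> (\<forall>v\<in>W. lookup m v = lookup n v)"
      "\<forall>m n. \<phi> (m + n) = \<phi> m + \<phi> n" by (elim exE conjE)
    show ?case
    proof (intro exI[of _ "\<lambda>m. lookup m v + B * \<phi> m"] conjI allI ballI impI)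
      fix m n u assume mn: "m \<in> A" "n \<in> A" and eq: "lookup m v + B * \<phi> m = lookup n v + B * \<phi> n"
        and u: "u \<in> insert v W"
      have l: "lookup m v < B" "lookup n v < B" using less mn insert.prems by auto
      have "lookup m v = (lookup m v + B * \<phi> m) mod B" using l by simp
      also have "\<dots> = lookup n v" unfolding eq using l by simp
      finally have 1: "lookup m v = lookup n v" .
      then have "\<phi> m = \<phi> n" using eq l by simp
      then show "lookup m u = lookup n u" using \<phi>(1)[rule_format, OF mn] 1 u by blast
    qed (simp add: lookup_add \<phi>(2) algebra_simps)
  qed
  from this[OF subset_refl] obtain \<phi> :: "('v \<Rightarrow>\<^sub>0 nat) \<Rightarrow> nat" where
    \<phi>: "\<forall>m\<in>A. \<forall>n\<in>A. \<phi> m = \<phi> n \<longrightarrow> (\<forall>v\<in>V. lookup m v = lookup n v)"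
    and add: "\<forall>m n. \<phi> (m + n) = \<phi> m + \<phi> n" by (elim exE conjE)
  have "inj_on \<phi> A"
  proof (rule inj_onI, rule poly_mapping_eqI)
    fix m n v assume mn: "m \<in> A" "n \<in> A" "\<phi> m = \<phi> n"
    show "lookup m v = lookup n v"
    proof (cases "v \<in> V")
      case False
      then have "v \<notin> keys m" "v \<notin> keys n" using assms(3) mn by blast+
      then show ?thesis by (simp add: in_keys_iff)
    qed (rule \<phi>[rule_format, OF mn])
  qed
  then show ?thesis using add by (intro exI[of _ \<phi>] conjI)
qed

text \<open>Take the keys a of p and b of q of largest weight among those avoiding C. If c + d = a +
  b, then c and d avoid C as well, because the support of a sum is the union of the supports; by
  maximality and injectivity c = a and d = b. The coefficient at a + b is therefore a single nonzero
  product.\<close>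

lemma mult_key_outside:
  fixes p q :: "('v, 'k::field) mpoly"
  assumes fin: "finite V" "\<And>m. m \<in> keys p \<union> keys q \<Longrightarrow> keys m \<subseteq> V"
    and p: "m \<in> keys p" "keys m \<inter> C = {}" and q: "n \<in> keys q" "keys n \<inter> C = {}"
  shows "\<exists>k\<in>keys (p * q). keys k \<inter> C = {}"
proof -
  have "\<exists>\<phi> :: ('v \<Rightarrow>\<^sub>0 nat) \<Rightarrow> nat. inj_on \<phi> (keys p \<union> keys q) \<and> (\<forall>m n. \<phi> (m + n) = \<phi> m + \<phi> n)"
    using fin(2) by (intro finite_exponents_additive_injective[OF fin(1)]) auto
  then obtain \<phi> :: "('v \<Rightarrow>\<^sub>0 nat) \<Rightarrow> nat" where inj: "inj_on \<phi> (keys p \<union> keys q)"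
    and add: "\<forall>m n. \<phi> (m + n) = \<phi> m + \<phi> n"
    by (elim exE conjE)
  define A where "A r = {m \<in> keys r. keys m \<inter> C = {}}" for r :: "('v, 'k) mpoly"
  have fA: "finite (A r)" for r by (simp add: A_def)
  have max: "\<exists>m\<in>A r. \<forall>m'\<in>A r. \<phi> m' \<le> \<phi> m" if "A r \<noteq> {}" for r
  proof -
    have "Max (\<phi> ` A r) \<in> \<phi> ` A r" using fA that by (intro Max_in) auto
    then obtain m where "m \<in> A r" "\<phi> m = Max (\<phi> ` A r)" by auto
    then show ?thesis using fA by (metis Max_ge finite_imageI image_eqI)
  qed
  obtain a where a: "a \<in> A p" "\<And>m. m \<in> A p \<Longrightarrow> \<phi> m \<le> \<phi> a" using max[of p] p by (auto simp: A_def)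
  obtain b where b: "b \<in> A q" "\<And>m. m \<in> A q \<Longrightarrow> \<phi> m \<le> \<phi> b" using max[of q] q by (auto simp: A_def)
  have eq: "c = a \<and> d = b" if cd: "c \<in> keys p" "d \<in> keys q" "c + d = a + b" for c d
  proof -
    have "keys c \<union> keys d = keys a \<union> keys b" using cd(3) by (metis keys_add_nat)
    then have "c \<in> A p" "d \<in> A q" using a(1) b(1) cd by (auto simp: A_def)
    moreover have "\<phi> c + \<phi> d = \<phi> a + \<phi> b" using cd(3) add by metis
    ultimately have "\<phi> c = \<phi> a" "\<phi> d = \<phi> b" using a(2)[of c] b(2)[of d] by auto
    then show ?thesis using inj cd a(1) b(1) by (auto simp: A_def inj_on_def)
  qed
  have ab: "a \<in> keys p" "b \<in> keys q" using a b by (auto simp: A_def)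
  have "lookup (p * q) (a + b) =
      (\<Sum>c\<in>keys p. \<Sum>d\<in>keys q. if c = a then (if d = b then lookup p a * lookup q b else 0) else 0)"
    unfolding lookup_mult_sum using eq by (intro sum.cong refl) auto
  also have "\<dots> = lookup p a * lookup q b"
    using ab by (subst sum.swap) (simp add: in_keys_iff)
  finally have "a + b \<in> keys (p * q)" using ab by (simp add: in_keys_iff)
  moreover have "keys (a + b) \<inter> C = {}" using a(1) b(1) by (auto simp: A_def keys_add_nat)
  ultimately show ?thesis by blast
qed

section \<open>Ideals and primes of the polynomial ring\<close>

lemma polynomial_ring_simps [simp]:
  "p \<in> carrier (polynomial_ring V) \<longleftrightarrow> (\<forall>m\<in>keys p. keys m \<subseteq> V)"
  "p \<otimes>\<^bsub>polynomial_ring V\<^esub> q = p * q"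
  "p \<oplus>\<^bsub>polynomial_ring V\<^esub> q = p + q"
  "\<one>\<^bsub>polynomial_ring V\<^esub> = 1"
  "\<zero>\<^bsub>polynomial_ring V\<^esub> = 0"
  by (simp_all add: polynomial_ring_def)

lemma polynomial_ring_idealI:
  fixes J :: "('v, 'k::field) mpoly set"
  assumes "\<And>p. p \<in> J \<Longrightarrow> p \<in> carrier (polynomial_ring V)" "0 \<in> J"
    "\<And>p q. p \<in> J \<Longrightarrow> q \<in> J \<Longrightarrow> p + q \<in> J"
    "\<And>p q. p \<in> carrier (polynomial_ring V) \<Longrightarrow> q \<in> J \<Longrightarrow> p * q \<in> J"
  shows "ideal J (polynomial_ring V)"
proof -
  interpret cring "polynomial_ring V :: ('v, 'k) mpoly ring" by (rule polynomial_ring_cring)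
  show ?thesis
  proof (rule idealI)
    show "subgroup J (add_monoid (polynomial_ring V))"
    proof (rule add.subgroupI)
      fix p assume p: "p \<in> J"
      then have c: "p \<in> carrier (polynomial_ring V)" by (rule assms)
      have "\<ominus>\<^bsub>polynomial_ring V\<^esub> p = (\<ominus>\<^bsub>polynomial_ring V\<^esub> \<one>\<^bsub>polynomial_ring V\<^esub>) \<otimes>\<^bsub>polynomial_ring V\<^esub> p"
        using c by algebra
      then show "\<ominus>\<^bsub>polynomial_ring V\<^esub> p \<in> J"
        using assms(4)[OF a_inv_closed[OF one_closed] p] by simp
    qed (use assms in auto)
    fix p q :: "('v, 'k) mpoly" assume "p \<in> J" "q \<in> carrier (polynomial_ring V)"
    then show "q \<otimes>\<^bsub>polynomial_ring V\<^esub> p \<in> J" "p \<otimes>\<^bsub>polynomial_ring V\<^esub> q \<in> J"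
      using assms(4)[of q p] by (simp_all add: mult.commute)
  qed (rule ring_axioms)
qed

lemma polynomial_ring_primeidealI:
  fixes J :: "('v, 'k::field) mpoly set"
  assumes "ideal J (polynomial_ring V)" "1 \<notin> J"
    "\<And>p q. p \<in> carrier (polynomial_ring V) \<Longrightarrow> q \<in> carrier (polynomial_ring V) \<Longrightarrow>
       p * q \<in> J \<Longrightarrow> p \<in> J \<or> q \<in> J"
  shows "primeideal J (polynomial_ring V)"
  using assms by (intro primeidealI polynomial_ring_cring) auto

context
  fixes J :: "('v, 'k::field) mpoly set" and V
  assumes J: "ideal J (polynomial_ring V)"
begin

interpretation J: ideal J "polynomial_ring V" by (rule J)

lemma polynomial_ideal_carrier: "p \<in> J \<Longrightarrow> m \<in> keys p \<Longrightarrow> keys m \<subseteq> V"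
  using J.Icarr[of p] by simp

lemma polynomial_ideal_zero: "0 \<in> J"
  using additive_subgroup.zero_closed[OF ideal.axioms(1)[OF J]] unfolding polynomial_ring_simps .

lemma polynomial_ideal_add: "p \<in> J \<Longrightarrow> q \<in> J \<Longrightarrow> p + q \<in> J"
  using additive_subgroup.a_closed[OF ideal.axioms(1)[OF J], of p q] unfolding polynomial_ring_simps .

lemma polynomial_ideal_mult: "p \<in> carrier (polynomial_ring V) \<Longrightarrow> q \<in> J \<Longrightarrow> p * q \<in> J"
  using J.I_l_closed[of q p] unfolding polynomial_ring_simps by blast

lemma polynomial_ideal_diff: "p \<in> J \<Longrightarrow> q \<in> J \<Longrightarrow> p - q \<in> J"
proof -
  assume "p \<in> J" "q \<in> J"
  \<comment> \<open>The constant polynomial c is \<open>single 0 c\<close>; here c = -1.\<close>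
  then have "p + single 0 (- 1) * q \<in> J"
    by (intro polynomial_ideal_add polynomial_ideal_mult) auto
  moreover have "p + single 0 (- 1) * q = p - q"
    by (simp add: single_uminus)
  ultimately show ?thesis by simp
qed

lemma polynomial_ideal_sum: "(\<And>i. i \<in> A \<Longrightarrow> f i \<in> J) \<Longrightarrow> sum f A \<in> J"
  by (induction A rule: infinite_finite_induct) (auto simp: polynomial_ideal_zero polynomial_ideal_add)

lemma polynomial_ideal_unit: "single 0 c \<in> J \<Longrightarrow> c \<noteq> 0 \<Longrightarrow> J = carrier (polynomial_ring V)"
proof -
  assume "single 0 c \<in> J" "c \<noteq> 0"
  then have "single 0 (inverse c) * single 0 c \<in> J" by (intro polynomial_ideal_mult) auto
  then show ?thesis using \<open>c \<noteq> 0\<close> J.one_imp_carrier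
    unfolding polynomial_ring_simps by (simp add: mult_single)
qed

end

lemma polynomial_mult_closed:
  fixes p q :: "('v, 'k::field) mpoly"
  assumes "p \<in> carrier (polynomial_ring V)" "q \<in> carrier (polynomial_ring V)"
  shows "p * q \<in> carrier (polynomial_ring V)"
  using cring.cring_simprules(5)[OF polynomial_ring_cring assms] unfolding polynomial_ring_simps .

lemma polynomial_add_closed:
  fixes p q :: "('v, 'k::field) mpoly"
  assumes "p \<in> carrier (polynomial_ring V)" "q \<in> carrier (polynomial_ring V)"
  shows "p + q \<in> carrier (polynomial_ring V)"
  using cring.cring_simprules(1)[OF polynomial_ring_cring assms] unfolding polynomial_ring_simps .

text \<open>The common form of all monomial ideals below, given by a condition on each exponent
  vector. It is an ideal as soon as the condition survives adding exponents, and membership is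
  checked one monomial at a time.\<close>

definition key_ideal :: "'v set \<Rightarrow> (('v \<Rightarrow>\<^sub>0 nat) \<Rightarrow> bool) \<Rightarrow> ('v, 'k::field) mpoly set" where
  "key_ideal V K = {p. \<forall>m\<in>keys p. keys m \<subseteq> V \<and> K m}"

lemma key_ideal_ideal:
  assumes up: "\<And>m n. K m \<Longrightarrow> K (n + m)"
  shows "ideal (key_ideal V K :: ('v, 'k::field) mpoly set) (polynomial_ring V)"
proof (rule polynomial_ring_idealI)
  fix p q :: "('v, 'k) mpoly" assume p: "p \<in> key_ideal V K"
  then show "p \<in> carrier (polynomial_ring V)" by (simp add: key_ideal_def)
  show "p + q \<in> key_ideal V K" if "q \<in> key_ideal V K"
    using p that Poly_Mapping.keys_add[of p q] by (auto simp: key_ideal_def)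
  show "q * p \<in> key_ideal V K" if "q \<in> carrier (polynomial_ring V)"
    using p that keys_mult[of q p] by (fastforce simp: key_ideal_def keys_add_nat up)
qed (simp add: key_ideal_def)

lemma genideal_monomials:
  assumes "\<And>g. g \<in> G \<Longrightarrow> keys g \<subseteq> V"
  shows "Idl\<^bsub>polynomial_ring V\<^esub> (monomial ` G) =
    (key_ideal V (\<lambda>m. \<exists>g\<in>G. \<exists>n. m = n + g) :: ('v, 'k::field) mpoly set)"
    (is "Idl\<^bsub>?S\<^esub> ?X = ?J")
proof
  interpret cring ?S by (rule polynomial_ring_cring)
  have J: "ideal ?J ?S"
    by (rule key_ideal_ideal) (metis add.assoc)
  have X: "?X \<subseteq> carrier ?S" using assms by (auto simp: monomial_def)
  have id: "ideal (Idl\<^bsub>?S\<^esub> ?X) ?S" by (rule genideal_ideal[OF X])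
  have "?X \<subseteq> ?J"
    using assms by (force simp: key_ideal_def monomial_def intro: exI[of _ 0])
  then show "Idl\<^bsub>?S\<^esub> ?X \<subseteq> ?J" by (rule genideal_minimal[OF J])
  show "?J \<subseteq> Idl\<^bsub>?S\<^esub> ?X"
  proof
    fix p assume p: "p \<in> ?J"
    have "single m (lookup p m) \<in> Idl\<^bsub>?S\<^esub> ?X" if m: "m \<in> keys p" for m
    proof -
      obtain g n where g: "g \<in> G" "m = n + g" "keys m \<subseteq> V" using p m by (auto simp: key_ideal_def)
      then have "single m (lookup p m) = single n (lookup p m) * monomial g"
        by (simp add: monomial_def mult_single)
      also have "\<dots> \<in> Idl\<^bsub>?S\<^esub> ?X"
        using g genideal_self[OF X] by (intro polynomial_ideal_mult[OF id]) (auto simp: keys_add_nat)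
      finally show ?thesis .
    qed
    then have "(\<Sum>m\<in>keys p. single m (lookup p m)) \<in> Idl\<^bsub>?S\<^esub> ?X"
      by (intro polynomial_ideal_sum[OF id])
    then show "p \<in> Idl\<^bsub>?S\<^esub> ?X" by (simp add: poly_mapping_sum_single)
  qed
qed

text \<open>For C inside V this is the ideal generated by the variables in C. The cases C = {} and C
  = V are the zero ideal and the irrelevant ideal.\<close>

definition var_ideal :: "'v set \<Rightarrow> 'v set \<Rightarrow> ('v, 'k::field) mpoly set" where
  "var_ideal V C = key_ideal V (\<lambda>m. keys m \<inter> C \<noteq> {})"

lemma var_ideal_iff:
  "p \<in> var_ideal V C \<longleftrightarrow> (\<forall>m\<in>keys p. keys m \<subseteq> V \<and> keys m \<inter> C \<noteq> {})"
  by (simp add: var_ideal_def key_ideal_def)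

lemma var_ideal_prime:
  assumes "finite V"
  shows "primeideal (var_ideal V C :: ('v, 'k::field) mpoly set) (polynomial_ring V)"
proof (rule polynomial_ring_primeidealI)
  show "ideal (var_ideal V C :: ('v, 'k::field) mpoly set) (polynomial_ring V)"
    unfolding var_ideal_def by (rule key_ideal_ideal) (auto simp: keys_add_nat)
  show "1 \<notin> (var_ideal V C :: ('v, 'k) mpoly set)" by (simp add: var_ideal_iff)
  fix p q :: "('v, 'k) mpoly"
  assume pq: "p \<in> carrier (polynomial_ring V)" "q \<in> carrier (polynomial_ring V)" "p * q \<in> var_ideal V C"
  show "p \<in> var_ideal V C \<or> q \<in> var_ideal V C"
  proof (rule ccontr)
    assume "\<not> ?thesis"
    then obtain m n where "m \<in> keys p" "keys m \<inter> C = {}" "n \<in> keys q" "keys n \<inter> C = {}"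
      using pq(1,2) by (auto simp: var_ideal_iff)
    then have "\<exists>k\<in>keys (p * q). keys k \<inter> C = {}"
      using pq(1,2) by (intro mult_key_outside[OF assms, of p q m C n]) auto
    then show False using pq(3) by (auto simp: var_ideal_iff)
  qed
qed

lemma var_ideal_subset:
  fixes J :: "('v, 'k::field) mpoly set"
  assumes "ideal J (polynomial_ring V)" "C \<subseteq> V" "\<And>x. x \<in> C \<Longrightarrow> variable x \<in> J"
  shows "var_ideal V C \<subseteq> J"
proof -
  interpret cring "polynomial_ring V :: ('v, 'k) mpoly ring" by (rule polynomial_ring_cring)
  let ?G = "(\<lambda>x. single x 1) ` C :: ('v \<Rightarrow>\<^sub>0 nat) set"
  have "(var_ideal V C :: ('v, 'k) mpoly set) \<subseteq> key_ideal V (\<lambda>m. \<exists>g\<in>?G. \<exists>n. m = n + g)"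
  proof
    fix p :: "('v, 'k) mpoly" assume p: "p \<in> var_ideal V C"
    have "\<exists>x\<in>C. \<exists>n. m = n + single x 1" if m: "m \<in> keys p" for m
    proof -
      obtain x where x: "x \<in> C" "x \<in> keys m" using p m by (auto simp: var_ideal_iff)
      have "m = (m - single x 1) + single x 1"
        using x(2)
        by (intro poly_mapping_eqI) (auto simp: lookup_add lookup_minus lookup_single when_def in_keys_iff)
      then show ?thesis using x(1) by blast
    qed
    then show "p \<in> key_ideal V (\<lambda>m. \<exists>g\<in>?G. \<exists>n. m = n + g)"
      using p by (auto simp: key_ideal_def var_ideal_iff)
  qed
  also have "\<dots> = Idl\<^bsub>polynomial_ring V\<^esub> (monomial ` ?G)"
    using assms(2) by (intro genideal_monomials[symmetric]) auto
  also have "\<dots> \<subseteq> J"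
    using assms(3) by (intro genideal_minimal assms(1)) (auto simp: variable_def)
  finally show ?thesis .
qed

lemma variable_in_var_ideal_iff: "variable x \<in> var_ideal V C \<longleftrightarrow> x \<in> V \<and> x \<in> C"
  by (simp add: variable_def monomial_def var_ideal_iff)

lemma var_ideal_mono: "C \<subseteq> D \<Longrightarrow> var_ideal V C \<subseteq> var_ideal V D"
  unfolding var_ideal_def key_ideal_def by blast

lemma var_ideal_chain:
  assumes "finite V" "C \<subseteq> D" "D \<subseteq> V"
  obtains P :: "nat \<Rightarrow> ('v, 'k::field) mpoly set"
  where "prime_chain (polynomial_ring V) (card (D - C)) P"
    "P 0 = var_ideal V C" "P (card (D - C)) = var_ideal V D"
proof -
  let ?n = "card (D - C)"
  have "finite (D - C)" using assms finite_subset by blast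
  then obtain f where f: "bij_betw f {0..<?n} (D - C)" using ex_bij_betw_nat_finite by blast
  define P :: "nat \<Rightarrow> ('v, 'k) mpoly set" where "P i = var_ideal V (C \<union> f ` {0..<i})" for i
  have "P i \<subset> P (Suc i)" if i: "i < ?n" for i
  proof -
    have fi: "f i \<in> D - C" using f i by (auto simp: bij_betw_def)
    moreover have "f i \<notin> f ` {0..<i}" using f i by (fastforce simp: bij_betw_def inj_on_def)
    ultimately have "variable (f i) \<in> P (Suc i)" "variable (f i) \<notin> P i"
      using assms(3) by (auto simp: P_def variable_in_var_ideal_iff)
    moreover have "P i \<subseteq> P (Suc i)" unfolding P_def by (rule var_ideal_mono) auto
    ultimately show ?thesis by blast
  qed
  then have "prime_chain (polynomial_ring V) ?n P"
    by (simp add: prime_chain_def P_def var_ideal_prime[OF assms(1)])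
  moreover have "P 0 = var_ideal V C" by (simp add: P_def)
  moreover have "C \<union> (D - C) = D" using assms(2) by blast
  then have "P ?n = var_ideal V D" using f by (simp add: P_def bij_betw_def)
  ultimately show thesis by (rule that)
qed

section \<open>The dimension of polynomial rings\<close>

lemma polynomial_power_closed:
  "p \<in> carrier (polynomial_ring V) \<Longrightarrow> p ^ n \<in> carrier (polynomial_ring V)"
  for p :: "('v, 'k::field) mpoly"
proof (induction n)
  case (Suc n)
  then show ?case unfolding power_Suc by (intro polynomial_mult_closed)
qed simp

lemma polynomial_sum_closed:
  fixes f :: "'a \<Rightarrow> ('v, 'k::field) mpoly"
  assumes "\<And>a. a \<in> A \<Longrightarrow> f a \<in> carrier (polynomial_ring V)"
  shows "sum f A \<in> carrier (polynomial_ring V)"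
  using assms
proof (induction A rule: infinite_finite_induct)
  case (insert a A)
  then show ?case by (subst sum.insert) (auto intro!: polynomial_add_closed simp del: polynomial_ring_simps)
qed simp_all

lemma polynomial_prime_mult:
  assumes "primeideal P (polynomial_ring V)" "p \<in> carrier (polynomial_ring V)"
    "q \<in> carrier (polynomial_ring V)" "p * q \<in> P"
  shows "p \<in> P \<or> q \<in> P"
  using primeideal.I_prime[OF assms(1-3)] assms(4) by simp

lemma polynomial_prime_one:
  assumes "primeideal P (polynomial_ring V)"
  shows "1 \<notin> P"
proof
  assume "1 \<in> P"
  then have "P = carrier (polynomial_ring V)"
    using ideal.one_imp_carrier[OF primeideal.axioms(1)[OF assms]] by simp
  then show False using primeideal.I_notcarr[OF assms] by simp
qed

lemma polynomial_prime_power: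
  assumes P: "primeideal P (polynomial_ring V)" and p: "p \<in> carrier (polynomial_ring V)" "p \<notin> P"
  shows "p ^ n \<notin> P"
proof (induction n)
  case 0
  then show ?case using polynomial_prime_one[OF P] by simp
next
  case (Suc n)
  then show ?case
    using polynomial_prime_mult[OF P p(1) polynomial_power_closed[OF p(1)], of n] p(2) by auto
qed

definition power_product :: "'a::comm_monoid_mult list \<Rightarrow> nat list \<Rightarrow> 'a" where
  "power_product xs \<alpha> = prod_list (map2 (^) xs \<alpha>)"

lemma power_product_simps [simp]:
  "power_product [] \<alpha> = 1"
  "power_product (x # xs) (a # \<alpha>) = x ^ a * power_product xs \<alpha>"
  by (simp_all add: power_product_def)

lemma power_product_closed:
  fixes xs :: "('v, 'k::field) mpoly list"
  assumes "set xs \<subseteq> carrier (polynomial_ring V)"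
  shows "power_product xs \<alpha> \<in> carrier (polynomial_ring V)"
  using assms
proof (induction xs arbitrary: \<alpha>)
  case (Cons x xs)
  show ?case
  proof (cases \<alpha>)
    case Nil then show ?thesis by (simp add: power_product_def)
  next
    case (Cons a \<beta>)
    show ?thesis unfolding Cons power_product_simps
      using Cons.IH Cons.prems
      by (intro polynomial_mult_closed polynomial_power_closed) (auto simp del: polynomial_ring_simps)
  qed
qed simp

text \<open>
  Following Coquand and Lombardi, along a chain of primes \<open>P\<^sub>0 \<subset> \<dots> \<subset> P\<^sub>r\<close> with \<open>x\<^sub>i \<in> P\<^bsub>i+1\<^esub> - P\<^sub>i\<close> the
  lexicographically smallest exponent of a polynomial relation between the \<open>x\<^sub>i\<close> would have a
  coefficient in \<open>P\<^sub>r\<close>.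
\<close>

lemma prime_chain_independent:
  fixes xs :: "('v, 'k::field) mpoly list"
  assumes "\<And>i. i \<le> length xs \<Longrightarrow> primeideal (P i) (polynomial_ring V)"
    and "\<And>i. i < length xs \<Longrightarrow> P i \<subseteq> P (Suc i)"
    and "\<And>i. i < length xs \<Longrightarrow> xs ! i \<in> P (Suc i) - P i"
    and "finite A" "A \<noteq> {}" "\<And>\<alpha>. \<alpha> \<in> A \<Longrightarrow> length \<alpha> = length xs" "\<And>\<alpha>. \<alpha> \<in> A \<Longrightarrow> c \<alpha> \<noteq> 0"
  shows "(\<Sum>\<alpha>\<in>A. single 0 (c \<alpha>) * power_product xs \<alpha>) \<notin> P 0"
  using assms
proof (induction xs arbitrary: P A c)
  case Nil
  then have A: "A = {[]}" by auto
  have P0: "primeideal (P 0) (polynomial_ring V)" using Nil.prems(1) by simp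
  have "single 0 (c []) \<notin> P 0"
    using polynomial_ideal_unit[OF primeideal.axioms(1)[OF P0]] primeideal.I_notcarr[OF P0]
      Nil.prems(7)[of "[]"] A by auto
  then show ?case by (simp add: A)
next
  case (Cons x xs)
  let ?S = "polynomial_ring V :: ('v, 'k) mpoly ring"
  \<comment> \<open>The factor x^m comes out of the whole sum and is cancelled, since x is outside
    \<open>P 0\<close>. Every term not in \<open>A0\<close> still has a factor x, which lies in
    \<open>P 1\<close>; modulo \<open>P 1\<close> the terms of \<open>A0\<close> remain and form a
    relation for the shifted chain.\<close>
  define m where "m = Min (hd ` A)"
  define A0 where "A0 = {\<alpha> \<in> A. hd \<alpha> = m}"
  define g where "g \<alpha> = single 0 (c \<alpha>) * power_product xs (tl \<alpha>)" for \<alpha>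
  define Y where "Y = (\<Sum>\<alpha>\<in>A - A0. x ^ (hd \<alpha> - Suc m) * g \<alpha>)"
  have P: "primeideal (P i) ?S" "ideal (P i) ?S" if "i \<le> Suc (length xs)" for i
    using Cons.prems(1)[of i] that by (auto simp: primeideal.axioms)
  have car: "set (x # xs) \<subseteq> carrier ?S"
  proof
    fix y assume "y \<in> set (x # xs)"
    then obtain i where "i < length (x # xs)" "y = (x # xs) ! i" by (metis in_set_conv_nth)
    then show "y \<in> carrier ?S"
      using Cons.prems(3)[of i] ideal.Icarr[OF P(2)[of "Suc i"]] by (simp del: polynomial_ring_simps)
  qed
  then have xc: "x \<in> carrier ?S" and xsc: "set xs \<subseteq> carrier ?S" by (auto simp del: polynomial_ring_simps)
  have gc: "g \<alpha> \<in> carrier ?S" for \<alpha>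
    unfolding g_def by (intro polynomial_mult_closed power_product_closed xsc) simp
  have Yc: "Y \<in> carrier ?S"
    unfolding Y_def by (intro polynomial_sum_closed polynomial_mult_closed polynomial_power_closed xc gc)
  have m: "m \<le> hd \<alpha>" if "\<alpha> \<in> A" for \<alpha>
    unfolding m_def using Cons.prems(4) that by simp
  have "m \<in> hd ` A" unfolding m_def using Cons.prems(4,5) by (intro Min_in) auto
  then have A0: "A0 \<noteq> {}" "finite A0" "A0 \<subseteq> A" using Cons.prems(4) by (auto simp: A0_def)
  have cons: "\<alpha> = hd \<alpha> # tl \<alpha>" if "\<alpha> \<in> A" for \<alpha>
    using Cons.prems(6)[OF that] by (cases \<alpha>) auto
  have "(\<Sum>\<alpha>\<in>A. single 0 (c \<alpha>) * power_product (x # xs) \<alpha>) = (\<Sum>\<alpha>\<in>A. x ^ hd \<alpha> * g \<alpha>)"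
  proof (rule sum.cong[OF refl])
    fix \<alpha> assume "\<alpha> \<in> A"
    have "power_product (x # xs) \<alpha> = x ^ hd \<alpha> * power_product xs (tl \<alpha>)"
      by (subst cons[OF \<open>\<alpha> \<in> A\<close>]) simp
    then show "single 0 (c \<alpha>) * power_product (x # xs) \<alpha> = x ^ hd \<alpha> * g \<alpha>"
      by (simp add: g_def mult_ac)
  qed
  also have "\<dots> = (\<Sum>\<alpha>\<in>A0. x ^ hd \<alpha> * g \<alpha>) + (\<Sum>\<alpha>\<in>A - A0. x ^ hd \<alpha> * g \<alpha>)"
    using sum.subset_diff[OF A0(3) Cons.prems(4)] by (simp add: add.commute)
  also have "(\<Sum>\<alpha>\<in>A0. x ^ hd \<alpha> * g \<alpha>) = x ^ m * (\<Sum>\<alpha>\<in>A0. g \<alpha>)"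
    by (simp add: A0_def sum_distrib_left)
  also have "(\<Sum>\<alpha>\<in>A - A0. x ^ hd \<alpha> * g \<alpha>) = x ^ m * (x * Y)"
    unfolding Y_def sum_distrib_left
  proof (rule sum.cong[OF refl])
    fix \<alpha> assume "\<alpha> \<in> A - A0"
    then have "hd \<alpha> = m + Suc (hd \<alpha> - Suc m)" using m[of \<alpha>] by (auto simp: A0_def)
    then have "x ^ hd \<alpha> = x ^ m * (x * x ^ (hd \<alpha> - Suc m))" by (metis power_Suc power_add)
    then show "x ^ hd \<alpha> * g \<alpha> = x ^ m * (x * (x ^ (hd \<alpha> - Suc m) * g \<alpha>))" by (simp add: mult.assoc)
  qed
  finally have sum: "(\<Sum>\<alpha>\<in>A. single 0 (c \<alpha>) * power_product (x # xs) \<alpha>) = x ^ m * ((\<Sum>\<alpha>\<in>A0. g \<alpha>) + x * Y)"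
    by (simp add: distrib_left)
  show ?case
  proof
    assume "(\<Sum>\<alpha>\<in>A. single 0 (c \<alpha>) * power_product (x # xs) \<alpha>) \<in> P 0"
    then have "x ^ m * ((\<Sum>\<alpha>\<in>A0. g \<alpha>) + x * Y) \<in> P 0" by (simp only: sum)
    moreover have sc: "(\<Sum>\<alpha>\<in>A0. g \<alpha>) \<in> carrier ?S" by (rule polynomial_sum_closed[OF gc])
    moreover have "x ^ m \<notin> P 0"
      using Cons.prems(3)[of 0] by (intro polynomial_prime_power[OF P(1) xc]) auto
    ultimately have "(\<Sum>\<alpha>\<in>A0. g \<alpha>) + x * Y \<in> P 0"
      using polynomial_prime_mult[OF P(1)[of 0], of "x ^ m" "(\<Sum>\<alpha>\<in>A0. g \<alpha>) + x * Y"]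
        polynomial_power_closed[OF xc, of m]
        polynomial_add_closed[OF sc polynomial_mult_closed[OF xc Yc]]
      by blast
    then have "(\<Sum>\<alpha>\<in>A0. g \<alpha>) + Y * x \<in> P (Suc 0)" using Cons.prems(2)[of 0] by (auto simp: mult.commute)
    moreover have "Y * x \<in> P (Suc 0)"
      using Cons.prems(3)[of 0] by (intro polynomial_ideal_mult[OF P(2)] Yc) auto
    ultimately have "(\<Sum>\<alpha>\<in>A0. g \<alpha>) + Y * x - Y * x \<in> P (Suc 0)"
      by (intro polynomial_ideal_diff[OF P(2)]) auto
    moreover have "(\<Sum>\<alpha>\<in>A0. g \<alpha>) = (\<Sum>\<beta>\<in>tl ` A0. single 0 (c (m # \<beta>)) * power_product xs \<beta>)"
    proof (subst sum.reindex)
      have eq: "\<alpha> = m # tl \<alpha>" if "\<alpha> \<in> A0" for \<alpha> using cons[of \<alpha>] that by (auto simp: A0_def)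
      then show "inj_on tl A0" by (metis inj_onI)
      show "(\<Sum>\<alpha>\<in>A0. g \<alpha>) = (\<Sum>\<alpha>\<in>A0. ((\<lambda>\<beta>. single 0 (c (m # \<beta>)) * power_product xs \<beta>) \<circ> tl) \<alpha>)"
        using eq by (intro sum.cong refl) (simp add: g_def flip: eq)
    qed
    moreover have "(\<Sum>\<beta>\<in>tl ` A0. single 0 (c (m # \<beta>)) * power_product xs \<beta>) \<notin> (\<lambda>i. P (Suc i)) 0"
    proof (rule Cons.IH)
      fix i
      show "primeideal (P (Suc i)) ?S" if "i \<le> length xs" using P that by simp
      show "P (Suc i) \<subseteq> P (Suc (Suc i))" if "i < length xs" using Cons.prems(2)[of "Suc i"] that by simp
      show "xs ! i \<in> P (Suc (Suc i)) - P (Suc i)" if "i < length xs" using Cons.prems(3)[of "Suc i"] that by simp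
    next
      show "finite (tl ` A0)" "tl ` A0 \<noteq> {}" using A0 by auto
      fix \<beta> assume "\<beta> \<in> tl ` A0"
      then obtain \<alpha> where "\<alpha> \<in> A" "\<alpha> = m # \<beta>" using cons by (auto simp: A0_def)
      then show "length \<beta> = length xs" "c (m # \<beta>) \<noteq> 0" using Cons.prems(6,7)[of \<alpha>] by auto
    qed
    ultimately show False by simp
  qed
qed

text \<open>Each exponent is bounded separately and not the total degree, so the monomials allowed
  in the variables V form a box of (d + 1)^|V| elements.\<close>

definition exponents_le :: "nat \<Rightarrow> ('v, 'k::field) mpoly \<Rightarrow> bool" where
  "exponents_le d p \<longleftrightarrow> (\<forall>m\<in>keys p. \<forall>v. lookup m v \<le> d)"

lemma exponents_le_mult:
  assumes "exponents_le d p" "exponents_le e q"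
  shows "exponents_le (d + e) (p * q)"
  unfolding exponents_le_def
proof (intro ballI allI)
  fix m v assume "m \<in> keys (p * q)"
  then obtain a b where "a \<in> keys p" "b \<in> keys q" "m = a + b" using keys_mult[of p q] by blast
  then show "lookup m v \<le> d + e"
    using assms by (auto simp: exponents_le_def lookup_add intro!: add_mono)
qed

lemma exponents_le_power: "exponents_le d p \<Longrightarrow> exponents_le (n * d) (p ^ n)"
proof (induction n)
  case (Suc n)
  then show ?case using exponents_le_mult[of d p "n * d" "p ^ n"] by simp
qed (simp add: exponents_le_def)

lemma exponents_le_power_product:
  assumes "\<And>x. x \<in> set xs \<Longrightarrow> exponents_le d x" "length \<alpha> = length xs" "set \<alpha> \<subseteq> {..<N}"
  shows "exponents_le (length xs * (N * d)) (power_product xs \<alpha>)"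
  using assms(2,1,3)
proof (induction \<alpha> xs rule: list_induct2)
  case (Cons a \<alpha> x xs)
  have "exponents_le (a * d) (x ^ a)" using Cons.prems by (intro exponents_le_power) simp
  moreover have "a * d \<le> N * d" using Cons.prems by simp
  ultimately have "exponents_le (N * d) (x ^ a)"
    unfolding exponents_le_def using le_trans by blast
  then show ?case using exponents_le_mult[of "N * d" "x ^ a"] Cons by simp
qed (simp add: exponents_le_def)

lemma exponents_le_exists: "\<exists>d. \<forall>x\<in>set xs. exponents_le d x"
proof (induction xs)
  case (Cons x xs)
  then obtain d where d: "\<forall>x\<in>set xs. exponents_le d x" by blast
  let ?e = "\<Sum>m\<in>keys x. \<Sum>v\<in>keys m. lookup m v"
  have "lookup m v \<le> ?e" if "m \<in> keys x" for m v
  proof (cases "v \<in> keys m")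
    case True
    then have "lookup m v \<le> (\<Sum>v\<in>keys m. lookup m v)" by (intro member_le_sum) auto
    also have "\<dots> \<le> ?e"
      using that by (intro member_le_sum[of m "keys x" "\<lambda>m. \<Sum>v\<in>keys m. lookup m v"]) auto
    finally show ?thesis .
  qed (simp add: in_keys_iff)
  then have "\<forall>y\<in>set (x # xs). exponents_le (d + ?e) y"
    using d by (auto simp: exponents_le_def intro: trans_le_add1 trans_le_add2)
  then show ?case by blast
qed simp

lemma mpoly_vector_space:
  "vector_space (\<lambda>(c :: 'k) (p :: ('v, 'k::field) mpoly). single 0 c * p)"
  by unfold_locales (simp_all add: algebra_simps single_add mult_single flip: mult.assoc)

lemma exponents_le_span:
  fixes p :: "('v, 'k::field) mpoly"
  assumes "finite V" "p \<in> carrier (polynomial_ring V)" "exponents_le d p"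
  shows "p \<in> module.span (\<lambda>c p. single 0 c * p)
    ((\<lambda>f. single (\<Sum>v\<in>V. single v (f v)) 1) ` (V \<rightarrow>\<^sub>E {..d}))"
    (is "_ \<in> module.span _ ?T")
proof -
  interpret vs: vector_space "\<lambda>(c :: 'k) (p :: ('v, 'k) mpoly). single 0 c * p"
    by (rule mpoly_vector_space)
  have "single m (lookup p m) \<in> vs.span ?T" if m: "m \<in> keys p" for m
  proof -
    have sub: "keys m \<subseteq> V" using assms(2) m by simp
    have "(\<Sum>v\<in>V. single v (restrict (lookup m) V v)) = (\<Sum>v\<in>V. single v (lookup m v))"
      by (intro sum.cong) auto
    also have "\<dots> = (\<Sum>v\<in>keys m. single v (lookup m v))"
      using sub assms(1) by (intro sum.mono_neutral_right) (auto simp: in_keys_iff)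
    finally have "(\<Sum>v\<in>V. single v (restrict (lookup m) V v)) = (\<Sum>v\<in>keys m. single v (lookup m v))" .
    then have "single m 1 = (\<lambda>f. single (\<Sum>v\<in>V. single v (f v)) 1) (restrict (lookup m) V)"
      by (simp add: poly_mapping_sum_single)
    moreover have "restrict (lookup m) V \<in> V \<rightarrow>\<^sub>E {..d}"
      using assms(3) m by (auto simp: exponents_le_def)
    ultimately have "single m 1 \<in> ?T" by blast
    then have "single 0 (lookup p m) * single m 1 \<in> vs.span ?T"
      by (intro vs.span_scale vs.span_base)
    then show ?thesis by (simp add: mult_single)
  qed
  then have "(\<Sum>m\<in>keys p. single m (lookup p m)) \<in> vs.span ?T" by (rule vs.span_sum)
  then show ?thesis by (simp add: poly_mapping_sum_single)
qed

text \<open>Elements x_i of \<open>P (Suc i) - P i\<close> satisfy no polynomial relation, so their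
  products with exponents below N are linearly independent. All of them have exponents at most n N
  d, where d bounds the exponents of the x_i; for n > |V| and large N there are too many of
  them.\<close>

theorem prime_chain_length_le:
  fixes P :: "nat \<Rightarrow> ('v, 'k::field) mpoly set"
  assumes "finite V" and chain: "prime_chain (polynomial_ring V) n P"
  shows "n \<le> card V"
proof (rule ccontr)
  assume "\<not> ?thesis"
  then have n: "Suc (card V) \<le> n" by simp
  interpret vs: vector_space "\<lambda>(c :: 'k) (p :: ('v, 'k) mpoly). single 0 c * p"
    by (rule mpoly_vector_space)
  have P: "primeideal (P i) (polynomial_ring V)" "ideal (P i) (polynomial_ring V)" if "i \<le> n" for i
    using chain that by (auto simp: prime_chain_def primeideal.axioms)
  have "\<forall>i\<in>{..<n}. \<exists>x. x \<in> P (Suc i) - P i" using chain by (auto simp: prime_chain_def)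
  then obtain x where x: "\<forall>i\<in>{..<n}. x i \<in> P (Suc i) - P i" by metis
  define xs where "xs = map x [0..<n]"
  have len: "length xs = n" by (simp add: xs_def)
  have xs_nth: "xs ! i \<in> P (Suc i) - P i" if "i < n" for i using x that by (simp add: xs_def)
  have car: "set xs \<subseteq> carrier (polynomial_ring V)"
  proof
    fix y assume "y \<in> set xs"
    then obtain i where "i < n" "y \<in> P (Suc i)" using x by (auto simp: xs_def)
    then show "y \<in> carrier (polynomial_ring V)" using ideal.Icarr[OF P(2)[of "Suc i"]] by simp
  qed
  obtain d where d: "\<forall>x\<in>set xs. exponents_le d x" using exponents_le_exists by blast
  \<comment> \<open>Chosen so that (n N d + 1)^|V| <= N^|V| (n d + 1)^|V| < N^(|V| + 1) <=
    N^n.\<close>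
  define N where "N = Suc ((n * d + 1) ^ card V)"
  define B where "B = {\<alpha>. set \<alpha> \<subseteq> {..<N} \<and> length \<alpha> = n}"
  have finB: "finite B" unfolding B_def by (rule finite_lists_length_eq) simp
  have cardB: "card B = N ^ n" unfolding B_def by (subst card_lists_length_eq) auto
  let ?e = "power_product xs"
  have indep: "(\<Sum>\<alpha>\<in>A. single 0 (c \<alpha>) * ?e \<alpha>) \<noteq> 0"
    if "A \<subseteq> B" "A \<noteq> {}" "\<And>\<alpha>. \<alpha> \<in> A \<Longrightarrow> c \<alpha> \<noteq> 0" for A and c :: "nat list \<Rightarrow> 'k"
  proof -
    have "(\<Sum>\<alpha>\<in>A. single 0 (c \<alpha>) * ?e \<alpha>) \<notin> P 0"
    proof (rule prime_chain_independent)
      show "finite A" using that(1) finB by (rule finite_subset)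
    qed (use that P xs_nth chain len in \<open>auto simp: B_def prime_chain_def\<close>)
    then show ?thesis using polynomial_ideal_zero[OF P(2)[of 0]] by auto
  qed
  \<comment> \<open>Linear independence concerns the set of products, so distinct exponent lists
    must first be shown to give distinct products; a coincidence would be a relation with
    coefficients 1 and -1.\<close>
  have inj: "inj_on ?e B"
  proof (rule inj_onI, rule ccontr)
    fix \<alpha> \<beta> assume ab: "\<alpha> \<in> B" "\<beta> \<in> B" "?e \<alpha> = ?e \<beta>" "\<alpha> \<noteq> \<beta>"
    have "(\<Sum>\<gamma>\<in>{\<alpha>, \<beta>}. single 0 (if \<gamma> = \<alpha> then 1 else - 1) * ?e \<gamma>) \<noteq> 0"
      using ab by (intro indep) (auto split: if_splits)
    then show False using ab(3,4) by (simp add: single_uminus)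
  qed
  have "vs.independent (?e ` B)"
  proof (rule vs.independent_if_scalars_zero)
    show "finite (?e ` B)" using finB by simp
    fix f y assume 0: "(\<Sum>y\<in>?e ` B. single 0 (f y) * y) = 0" and y: "y \<in> ?e ` B"
    let ?A = "{\<alpha> \<in> B. f (?e \<alpha>) \<noteq> 0}"
    have "0 = (\<Sum>\<alpha>\<in>B. single 0 (f (?e \<alpha>)) * ?e \<alpha>)" using 0 by (simp add: sum.reindex[OF inj])
    also have "\<dots> = (\<Sum>\<alpha>\<in>?A. single 0 (f (?e \<alpha>)) * ?e \<alpha>)"
      using finB by (intro sum.mono_neutral_right) auto
    finally have z: "(\<Sum>\<alpha>\<in>?A. single 0 (f (?e \<alpha>)) * ?e \<alpha>) = 0" ..
    have "?A = {}"
    proof (rule ccontr)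
      assume "?A \<noteq> {}"
      then have "(\<Sum>\<alpha>\<in>?A. single 0 (f (?e \<alpha>)) * ?e \<alpha>) \<noteq> 0" by (intro indep) auto
      then show False using z by (rule notE)
    qed
    then show "f y = 0" using y by auto
  qed
  moreover define T :: "('v, 'k) mpoly set" where
    "T = (\<lambda>f. single (\<Sum>v\<in>V. single v (f v)) 1) ` (V \<rightarrow>\<^sub>E {..n * (N * d)})"
  have finT: "finite T" using assms(1) by (simp add: T_def finite_PiE)
  moreover have "?e ` B \<subseteq> vs.span T"
  proof (intro image_subsetI)
    fix \<alpha> assume "\<alpha> \<in> B"
    then have "exponents_le (n * (N * d)) (?e \<alpha>)"
      using exponents_le_power_product[of xs d \<alpha> N] d len by (simp add: B_def)
    then show "?e \<alpha> \<in> vs.span T"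
      unfolding T_def by (intro exponents_le_span assms(1) power_product_closed car)
  qed
  ultimately have "card (?e ` B) \<le> card T" using vs.independent_span_bound by blast
  also have "\<dots> \<le> card (V \<rightarrow>\<^sub>E {..n * (N * d)})"
    unfolding T_def using assms(1) by (intro card_image_le finite_PiE) auto
  also have "\<dots> = (n * (N * d) + 1) ^ card V" using assms(1) by (simp add: card_PiE)
  also have "\<dots> \<le> (N * (n * d + 1)) ^ card V"
    by (intro power_mono) (simp_all add: N_def algebra_simps)
  also have "\<dots> = N ^ card V * (n * d + 1) ^ card V" by (rule power_mult_distrib)
  also have "\<dots> < N ^ card V * N" by (simp add: N_def)
  also have "\<dots> = N ^ Suc (card V)" by simp
  also have "\<dots> \<le> N ^ n" using n by (intro power_increasing) (auto simp: N_def)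
  finally show False using cardB card_image[OF inj] by simp
qed

text \<open>The chain from the zero ideal to (C) has length |C| and can be put below the given
  one.\<close>

lemma prime_chain_above_var_ideal:
  fixes Q :: "nat \<Rightarrow> ('v, 'k::field) mpoly set"
  assumes "finite V" "C \<subseteq> V" and Q: "prime_chain (polynomial_ring V) n Q" "var_ideal V C \<subseteq> Q 0"
  shows "card C + n \<le> card V"
proof -
  obtain P :: "nat \<Rightarrow> ('v, 'k) mpoly set" where
    P: "prime_chain (polynomial_ring V) (card (C - {})) P" "P (card (C - {})) = var_ideal V C"
    using var_ideal_chain[OF assms(1) empty_subsetI assms(2)] by blast
  \<comment> \<open>The last prime (C) of the lower chain is dropped, since \<open>Q 0\<close> may
    be equal to it; the total length is still |C| + n.\<close>
  define R where "R i = (if i < card C then P i else Q (i - card C))" for i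
  have "R i \<subset> R (Suc i)" if "i < card C + n" for i
  proof -
    consider "Suc i < card C" | "Suc i = card C" | "card C \<le> i" by linarith
    then show ?thesis
    proof cases
      case 2
      then have "i < card C" by simp
      then have "P i \<subset> P (Suc i)" using P(1) by (simp add: prime_chain_def)
      moreover have "P (Suc i) \<subseteq> Q 0" using P(2) Q(2) 2 by simp
      ultimately have "P i \<subset> Q 0" by (rule psubset_subset_trans)
      then show ?thesis using 2 by (simp add: R_def)
    next
      case 3
      then show ?thesis using Q(1) that by (simp add: R_def prime_chain_def Suc_diff_le)
    qed (use P in \<open>auto simp: R_def prime_chain_def\<close>)
  qed
  then have "prime_chain (polynomial_ring V) (card C + n) R"
    using P Q by (auto simp: R_def prime_chain_def)
  then show ?thesis by (rule prime_chain_length_le[OF assms(1)])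
qed

section \<open>Covers and Cohen-Macaulay squarefree ideals\<close>

lemma (in cring) quotient_rep_mem:
  assumes I: "ideal I R" and J: "ideal J R" "I \<subseteq> J" and a: "a \<in> carrier R"
    and eq: "I +> a \<in> (+>) I ` J"
  shows "a \<in> J"
proof -
  interpret I: ideal I R by fact
  interpret J: ideal J R by fact
  obtain j where j: "j \<in> J" "I +> a = I +> j" using eq by auto
  then have "a \<in> I +> j" using I.a_rcos_self[OF a] by simp
  then obtain i where "i \<in> I" "a = i \<oplus> j" by (auto simp: a_r_coset_def')
  then show ?thesis using j(1) J(2) by auto
qed

lemma (in cring) quotient_vimage_image:
  assumes I: "ideal I R" and J: "ideal J R" "I \<subseteq> J"
  shows "{a \<in> carrier R. I +> a \<in> (+>) I ` J} = J"
  using quotient_rep_mem[OF assms] ideal.Icarr[OF J(1)] by auto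

lemma (in cring) quotient_image_vimage:
  assumes "J \<subseteq> carrier (R Quot I)"
  shows "(+>) I ` {a \<in> carrier R. I +> a \<in> J} = J"
proof
  show "J \<subseteq> (+>) I ` {a \<in> carrier R. I +> a \<in> J}"
  proof
    fix x assume x: "x \<in> J"
    then obtain a where "a \<in> carrier R" "x = I +> a" using assms FactRing_carrier_rep by blast
    then show "x \<in> (+>) I ` {a \<in> carrier R. I +> a \<in> J}" using x by simp
  qed
qed auto

lemma (in cring) quotient_vimage_ideal:
  assumes I: "ideal I R" and J: "ideal J (R Quot I)"
  shows "ideal {a \<in> carrier R. I +> a \<in> J} R" "I \<subseteq> {a \<in> carrier R. I +> a \<in> J}"
proof -
  interpret I: ideal I R by fact
  show "ideal {a \<in> carrier R. I +> a \<in> J} R"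
    by (rule ring_hom_ring.ideal_vimage[OF I.rcos_ring_hom_ring J])
  have "I \<in> J"
    using additive_subgroup.zero_closed[OF ideal.axioms(1)[OF J]] by (simp only: FactRing_zero)
  then show "I \<subseteq> {a \<in> carrier R. I +> a \<in> J}"
    using I.a_rcos_const I.Icarr by auto
qed

lemma (in cring) quotient_maximalideal:
  assumes I: "ideal I R" and N: "maximalideal N R" "I \<subseteq> N"
  shows "maximalideal ((+>) I ` N) (R Quot I)"
proof -
  interpret N: maximalideal N R by fact
  show ?thesis
  proof (rule maximalidealI)
    show "ideal ((+>) I ` N) (R Quot I)" by (rule ring_ideal_imp_quot_ideal[OF I N.is_ideal])
    have "\<one> \<notin> N" using N.I_notcarr N.one_imp_carrier by blast
    then have "I +> \<one> \<notin> (+>) I ` N" using quotient_rep_mem[OF I N.is_ideal N(2)] by auto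
    moreover have "I +> \<one> \<in> carrier (R Quot I)"
      using ring_hom_closed[OF ideal.rcos_ring_hom[OF I] one_closed] .
    ultimately show "carrier (R Quot I) \<noteq> (+>) I ` N" by auto
    fix J assume J: "ideal J (R Quot I)" "(+>) I ` N \<subseteq> J" "J \<subseteq> carrier (R Quot I)"
    let ?K = "{a \<in> carrier R. I +> a \<in> J}"
    have "N \<subseteq> ?K" using J(2) N.Icarr by auto
    then consider "?K = N" | "?K = carrier R"
      using N.I_maximal[OF quotient_vimage_ideal(1)[OF I J(1)]] by auto
    then show "J = (+>) I ` N \<or> J = carrier (R Quot I)"
    proof cases
      case 1
      then show ?thesis using quotient_image_vimage[OF J(3)] by simp
    next
      case 2
      have "x \<in> J" if x: "x \<in> carrier (R Quot I)" for x
      proof -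
        obtain a where a: "a \<in> carrier R" "x = I +> a" using x by (rule FactRing_carrier_rep)
        then have "a \<in> ?K" using 2 by simp
        then show ?thesis using a(2) by simp
      qed
      then show ?thesis using J(3) by blast
    qed
  qed
qed

lemma (in cring) quotient_vimage_maximalideal:
  assumes I: "ideal I R" and M: "maximalideal M (R Quot I)"
  shows "maximalideal {a \<in> carrier R. I +> a \<in> M} R" (is "maximalideal ?N R")
proof -
  interpret I: ideal I R by fact
  interpret M: maximalideal M "R Quot I" by fact
  note N = quotient_vimage_ideal[OF I M.is_ideal]
  have M_eq: "(+>) I ` ?N = M" by (rule quotient_image_vimage[OF M.a_subset])
  show ?thesis
  proof (rule maximalidealI[OF N(1)])
    show "carrier R \<noteq> ?N"
    proof
      assume "carrier R = ?N"
      then have "I +> \<one> \<in> M" by auto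
      moreover have "I +> \<one> = \<one>\<^bsub>R Quot I\<^esub>" by (rule ring_hom_one[OF I.rcos_ring_hom])
      ultimately show False using M.I_notcarr M.one_imp_carrier by simp
    qed
    fix J assume J: "ideal J R" "?N \<subseteq> J" "J \<subseteq> carrier R"
    have IJ: "I \<subseteq> J" using N(2) J(2) by blast
    have "M \<subseteq> (+>) I ` J" using image_mono[OF J(2), of "(+>) I"] by (simp only: M_eq)
    moreover have id: "ideal ((+>) I ` J) (R Quot I)" by (rule ring_ideal_imp_quot_ideal[OF I J(1)])
    ultimately consider "(+>) I ` J = M" | "(+>) I ` J = carrier (R Quot I)"
      using M.I_maximal additive_subgroup.a_subset[OF ideal.axioms(1)[OF id]] by blast
    then show "J = ?N \<or> J = carrier R"
    proof cases
      case 1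
      then show ?thesis using quotient_vimage_image[OF I J(1) IJ] by simp
    next
      case 2
      then have "I +> \<one> \<in> (+>) I ` J" using ring_hom_closed[OF I.rcos_ring_hom one_closed] by simp
      then have "\<one> \<in> J" by (rule quotient_rep_mem[OF I J(1) IJ one_closed])
      then show ?thesis using ideal.one_imp_carrier[OF J(1)] by simp
    qed
  qed
qed

text \<open>If an ideal above the irrelevant ideal contains a polynomial with nonzero constant term,
  subtracting the other terms, which lie in the irrelevant ideal, leaves a unit.\<close>

lemma irrelevant_ideal_maximal:
  "maximalideal (var_ideal V V :: ('v, 'k::field) mpoly set) (polynomial_ring V)"
    (is "maximalideal ?N ?S")
proof (rule maximalidealI)
  show "ideal ?N ?S" unfolding var_ideal_def by (rule key_ideal_ideal) (auto simp: keys_add_nat)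
  have "1 \<in> carrier ?S" "1 \<notin> ?N" by (simp_all add: var_ideal_iff)
  then show "carrier ?S \<noteq> ?N" by blast
  fix J :: "('v, 'k) mpoly set"
  assume J: "ideal J ?S" "?N \<subseteq> J" "J \<subseteq> carrier ?S"
  show "J = ?N \<or> J = carrier ?S"
  proof (cases "\<exists>p\<in>J. lookup p 0 \<noteq> 0")
    case True
    then obtain p where p: "p \<in> J" "lookup p 0 \<noteq> 0" by blast
    let ?q = "p - single 0 (lookup p 0)"
    have "?q \<in> ?N"
      unfolding var_ideal_iff
    proof
      fix m assume m: "m \<in> keys ?q"
      then have "m \<noteq> 0" by (auto simp: in_keys_iff lookup_minus)
      then have "m \<in> keys p" using m by (auto simp: in_keys_iff lookup_minus lookup_single_not_eq)
      then have "keys m \<subseteq> V" by (rule polynomial_ideal_carrier[OF J(1) p(1)])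
      then show "keys m \<subseteq> V \<and> keys m \<inter> V \<noteq> {}" using \<open>m \<noteq> 0\<close>
        by (metis inf.absorb1 keys_eq_empty)
    qed
    then have "?q \<in> J" using J(2) by blast
    then have "p - ?q \<in> J" by (rule polynomial_ideal_diff[OF J(1) p(1)])
    then have "single 0 (lookup p 0) \<in> J" by simp
    then show ?thesis using polynomial_ideal_unit[OF J(1) _ p(2)] by blast
  next
    case False
    have "J \<subseteq> ?N"
    proof
      fix p assume p: "p \<in> J"
      have "keys m \<subseteq> V \<and> keys m \<inter> V \<noteq> {}" if m: "m \<in> keys p" for m
      proof -
        have "m \<noteq> 0" using False p m by (auto simp: in_keys_iff)
        then show ?thesis
          using polynomial_ideal_carrier[OF J(1) p m] by (metis inf.absorb1 keys_eq_empty)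
      qed
      then show "p \<in> ?N" by (simp add: var_ideal_iff)
    qed
    then show ?thesis using J(2) by blast
  qed
qed

section \<open>Squarefree monomial ideals and their covers\<close>

definition indicator_exponent :: "'v set \<Rightarrow> 'v \<Rightarrow>\<^sub>0 nat" where
  "indicator_exponent A = (\<Sum>v\<in>A. single v 1)"

lemma lookup_indicator_exponent:
  "finite A \<Longrightarrow> lookup (indicator_exponent A) v = (if v \<in> A then 1 else 0)"
  by (simp add: indicator_exponent_def lookup_sum lookup_single when_def)

lemma keys_indicator_exponent: "finite A \<Longrightarrow> keys (indicator_exponent A) = A"
  by (auto simp: in_keys_iff lookup_indicator_exponent split: if_splits)

definition squarefree_ideal :: "'v set \<Rightarrow> 'v set set \<Rightarrow> ('v, 'k::field) mpoly set" where
  "squarefree_ideal V F = key_ideal V (\<lambda>m. \<exists>f\<in>F. f \<subseteq> keys m)"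

lemma squarefree_ideal_iff:
  "p \<in> squarefree_ideal V F \<longleftrightarrow> (\<forall>m\<in>keys p. keys m \<subseteq> V \<and> (\<exists>f\<in>F. f \<subseteq> keys m))"
  by (simp add: squarefree_ideal_def key_ideal_def)

lemma squarefree_ideal_ideal:
  "ideal (squarefree_ideal V F :: ('v, 'k::field) mpoly set) (polynomial_ring V)"
  unfolding squarefree_ideal_def by (rule key_ideal_ideal) (auto simp: keys_add_nat)

lemma genideal_squarefree:
  assumes "finite V" "F \<subseteq> Pow V"
  shows "Idl\<^bsub>polynomial_ring V\<^esub> (monomial ` indicator_exponent ` F) =
    (squarefree_ideal V F :: ('v, 'k::field) mpoly set)"
proof -
  have fin: "finite f" if "f \<in> F" for f using that assms finite_subset by blast
  have iff: "(\<exists>n. m = n + indicator_exponent f) \<longleftrightarrow> f \<subseteq> keys m" if f: "f \<in> F" for f m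
  proof
    assume "f \<subseteq> keys m"
    then have "m = (m - indicator_exponent f) + indicator_exponent f"
      using fin[OF f]
      by (intro poly_mapping_eqI)
        (auto simp: lookup_add lookup_minus lookup_indicator_exponent in_keys_iff subset_iff)
    then show "\<exists>n. m = n + indicator_exponent f" by blast
  qed (auto simp: keys_add_nat keys_indicator_exponent[OF fin[OF f]])
  have "Idl\<^bsub>polynomial_ring V\<^esub> (monomial ` indicator_exponent ` F) =
    (key_ideal V (\<lambda>m. \<exists>g\<in>indicator_exponent ` F. \<exists>n. m = n + g) :: ('v, 'k) mpoly set)"
  proof (rule genideal_monomials)
    fix g assume "g \<in> indicator_exponent ` F"
    then obtain f where "f \<in> F" "g = indicator_exponent f" by blast
    then show "keys g \<subseteq> V" using assms(2) fin by (simp add: keys_indicator_exponent subset_iff)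
  qed
  also have "\<dots> = squarefree_ideal V F" using iff by (simp add: squarefree_ideal_def)
  finally show ?thesis .
qed

lemma lookup_mult_single:
  fixes p :: "('v, 'k::field) mpoly"
  shows "lookup (p * single m c) (k + m) = lookup p k * c"
proof (cases "c = 0")
  case False
  then have "lookup (p * single m c) (k + m) = (\<Sum>a\<in>keys p. if a = k then lookup p a * c else 0)"
    unfolding lookup_mult_sum by (intro sum.cong refl) simp
  then show ?thesis by (auto simp: in_keys_iff)
qed simp

theorem cohen_macaulay_cover_card_le:
  assumes V: "finite V"
    and CM: "cohen_macaulay_ideal V (squarefree_ideal V F :: ('v, 'k::field) mpoly set)"
    and C: "C \<subseteq> V" "\<And>f. f \<in> F \<Longrightarrow> f \<inter> C \<noteq> {}"
    and D: "D \<subseteq> V" "\<And>f. f \<in> F \<Longrightarrow> f \<inter> D \<noteq> {}" "\<And>x. x \<in> D \<Longrightarrow> \<exists>f\<in>F. f \<subseteq> V \<and> f \<inter> D = {x}"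
  shows "card D \<le> card C"
proof -
  let ?S = "polynomial_ring V :: ('v, 'k) mpoly ring"
  define I where "I = (squarefree_ideal V F :: ('v, 'k) mpoly set)"
  define N where "N = (var_ideal V V :: ('v, 'k) mpoly set)"
  define M where "M = (+>\<^bsub>?S\<^esub>) I ` N"
  define h where "h a = loc_frac (?S Quot I) (carrier (?S Quot I) - M) (I +>\<^bsub>?S\<^esub> a) \<one>\<^bsub>?S Quot I\<^esub>" for a
  let ?L = "localization_at (?S Quot I) M"
  interpret S: cring ?S by (rule polynomial_ring_cring)
  have I: "ideal I ?S" unfolding I_def by (rule squarefree_ideal_ideal)
  have I_iff: "p \<in> I \<longleftrightarrow> (\<forall>m\<in>keys p. keys m \<subseteq> V \<and> (\<exists>f\<in>F. f \<subseteq> keys m))" for p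
    by (simp add: I_def squarefree_ideal_iff)
  have N: "maximalideal N ?S" unfolding N_def by (rule irrelevant_ideal_maximal)
  have IC: "I \<subseteq> var_ideal V C"
  proof
    fix p assume "p \<in> I"
    then show "p \<in> var_ideal V C" using C(2) unfolding I_iff var_ideal_iff by blast
  qed
  then have IN: "I \<subseteq> N" unfolding N_def using var_ideal_mono[OF C(1)] by blast
  have M: "maximalideal M (?S Quot I)" unfolding M_def by (rule S.quotient_maximalideal[OF I N IN])
  have Mp: "primeideal M (?S Quot I)"
    by (rule cring.maximalideal_prime[OF ideal.quotient_is_cring[OF I S.is_cring] M])
  have N_eq: "{a \<in> carrier ?S. I +>\<^bsub>?S\<^esub> a \<in> M} = N"
    unfolding M_def by (rule S.quotient_vimage_image[OF I maximalideal.axioms(1)[OF N] IN])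
  interpret L: local_fraction_hom ?S ?L h I N
    using quotient_localization_hom[OF S.is_cring I Mp] unfolding N_eq h_def .
  have "cohen_macaulay_local_ring ?L"
    using CM M by (simp add: cohen_macaulay_ideal_def cohen_macaulay_ring_def I_def)
  then obtain M' where M': "noetherian_local_ring M' ?L" "ideal_depth M' ?L = krull_dim ?L"
    by (auto simp: cohen_macaulay_local_ring_def)

  define m where "m = indicator_exponent (V - D)"
  have km: "keys m = V - D" using V by (simp add: m_def keys_indicator_exponent)
  define c where "c = (monomial m :: ('v, 'k) mpoly)"
  \<comment> \<open>Otherwise s c lies in I for some s with nonzero constant term. Then the monomial
    c itself occurs in s c, and some member of F would be contained in V - D, against the covering
    property.\<close>
  have "h c \<noteq> \<zero>\<^bsub>?L\<^esub>"
  proof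
    assume "h c = \<zero>\<^bsub>?L\<^esub>"
    then obtain s where s: "s \<in> carrier ?S - N" "s * c \<in> I"
      using L.hom_zero_iff[of c] km by (auto simp: c_def monomial_def)
    obtain k where k: "k \<in> keys s" "keys k \<inter> V = {}" "keys k \<subseteq> V"
      using s(1) by (auto simp: N_def var_ideal_iff)
    then have "k = 0" by (metis inf.absorb1 keys_eq_empty)
    then have "0 \<in> keys s" using k(1) by simp
    then have "lookup (s * c) (0 + m) \<noteq> 0"
      unfolding c_def monomial_def lookup_mult_single by (simp add: in_keys_iff)
    then have "m \<in> keys (s * c)" by (simp add: in_keys_iff)
    then obtain f where "f \<in> F" "f \<subseteq> V - D" using s(2) km by (auto simp: I_iff)
    then show False using D(2) by blast
  qed
  \<comment> \<open>For x in D there is a member f of F with f - {x} outside D, so x times the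
    product of V - D is divisible by the monomial of f.\<close>
  moreover have "var_ideal V D \<subseteq> colon ?S I c"
  proof
    fix p :: "('v, 'k) mpoly" assume p: "p \<in> var_ideal V D"
    have "keys k \<subseteq> V \<and> (\<exists>f\<in>F. f \<subseteq> keys k)" if k: "k \<in> keys (p * c)" for k
    proof -
      obtain a where a: "a \<in> keys p" "k = a + m"
        using keys_mult[of p c] k by (auto simp: c_def monomial_def)
      then obtain x where x: "x \<in> keys a" "x \<in> D" "keys a \<subseteq> V" using p by (auto simp: var_ideal_iff)
      obtain f where f: "f \<in> F" "f \<subseteq> V" "f \<inter> D = {x}" using D(3)[OF x(2)] by blast
      have "keys k = keys a \<union> (V - D)" using a(2) km by (simp add: keys_add_nat)
      moreover have "f \<subseteq> insert x (V - D)" using f(2,3) by blast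
      ultimately have "keys k \<subseteq> V" "f \<subseteq> keys k" using x by auto
      then show ?thesis using f(1) by blast
    qed
    then have "p * c \<in> I" unfolding I_iff by blast
    then show "p \<in> colon ?S I c" using p by (simp add: colon_def var_ideal_iff)
  qed
  then have "n \<le> card V - card D" if "prime_chain ?S n Q" "colon ?S I c \<subseteq> Q 0" for n Q
    using prime_chain_above_var_ideal[OF V D(1) that(1)] that(2) by fastforce
  ultimately have depth: "ideal_depth M' ?L \<le> enat (card V - card D)"
    using km by (intro L.ideal_depth_le[OF M'(1), of c]) (auto simp: c_def monomial_def)
  obtain P :: "nat \<Rightarrow> ('v, 'k) mpoly set" where
    P: "prime_chain ?S (card (V - C)) P" "P 0 = var_ideal V C" "P (card (V - C)) = var_ideal V V"
    using var_ideal_chain[OF V C(1) subset_refl] by blast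
  have "enat (card (V - C)) \<le> krull_dim ?L"
    using IC P(2,3) by (intro L.krull_dim_ge[OF P(1)]) (auto simp: N_def)
  then have "card (V - C) \<le> card V - card D" using depth M'(2) by (metis enat_ord_simps(1) order_trans)
  moreover have "card D \<le> card V" "card C \<le> card V" using V C(1) D(1) by (auto intro: card_mono)
  moreover have "card (V - C) = card V - card C" using V C(1) by (simp add: card_Diff_subset finite_subset)
  ultimately show ?thesis by linarith
qed

section \<open>The complete graph\<close>

text \<open>For an ideal A this expresses that R/A is Noetherian in terms of ideals of R.\<close>

definition finitely_generated_above :: "('a, 'b) ring_scheme \<Rightarrow> 'a set \<Rightarrow> bool" where
  "finitely_generated_above R A \<longleftrightarrow>
     (\<forall>J. ideal J R \<longrightarrow> A \<subseteq> J \<longrightarrow> (\<exists>X\<subseteq>carrier R. finite X \<and> J = Idl\<^bsub>R\<^esub> (X \<union> A)))"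

text \<open>Generators of K + A modulo A split as k + a, and the components k in K generate the same
  ideal modulo A.\<close>

lemma (in cring) finite_generators_modulo:
  assumes fg: "finitely_generated_above R A" and A: "ideal A R" and K: "ideal K R"
  obtains Y where "Y \<subseteq> K" "finite Y" "K \<subseteq> Idl Y <+>\<^bsub>R\<^esub> A"
proof -
  interpret A: ideal A R by fact
  interpret K: ideal K R by fact
  have id: "ideal (K <+>\<^bsub>R\<^esub> A) R" by (rule add_ideals[OF K A])
  have "A \<subseteq> K <+>\<^bsub>R\<^esub> A"
  proof
    fix a assume "a \<in> A"
    then have "a = \<zero> \<oplus> a" by simp
    then show "a \<in> K <+>\<^bsub>R\<^esub> A"
      using \<open>a \<in> A\<close> additive_subgroup.zero_closed[OF ideal.axioms(1)[OF K]]
      unfolding set_add_def' by blast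
  qed
  then obtain X where X: "X \<subseteq> carrier R" "finite X" "K <+>\<^bsub>R\<^esub> A = Idl (X \<union> A)"
    using fg id unfolding finitely_generated_above_def by blast
  have "X \<subseteq> K <+>\<^bsub>R\<^esub> A"
    unfolding X(3) using genideal_self[of "X \<union> A"] X(1) A.a_subset by blast
  then have "\<forall>x\<in>X. \<exists>k. k \<in> K \<and> (\<exists>a\<in>A. x = k \<oplus> a)" by (auto simp: set_add_def')
  then obtain g where g: "\<forall>x\<in>X. g x \<in> K \<and> (\<exists>a\<in>A. x = g x \<oplus> a)" by metis
  let ?Y = "g ` X"
  have Yc: "?Y \<subseteq> carrier R" using g K.a_subset by blast
  have idY: "ideal (Idl ?Y) R" by (rule genideal_ideal[OF Yc])
  have id2: "ideal (Idl ?Y <+>\<^bsub>R\<^esub> A) R" by (rule add_ideals[OF idY A])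
  have "X \<subseteq> Idl ?Y <+>\<^bsub>R\<^esub> A"
  proof
    fix x assume "x \<in> X"
    then obtain a where "a \<in> A" "x = g x \<oplus> a" "g x \<in> Idl ?Y" using g genideal_self[OF Yc] by blast
    then show "x \<in> Idl ?Y <+>\<^bsub>R\<^esub> A" unfolding set_add_def' by blast
  qed
  moreover have "A \<subseteq> Idl ?Y <+>\<^bsub>R\<^esub> A"
  proof
    fix a assume "a \<in> A"
    then have "a = \<zero> \<oplus> a" by simp
    then show "a \<in> Idl ?Y <+>\<^bsub>R\<^esub> A"
      using \<open>a \<in> A\<close> additive_subgroup.zero_closed[OF ideal.axioms(1)[OF idY]]
      unfolding set_add_def' by blast
  qed
  ultimately have "K <+>\<^bsub>R\<^esub> A \<subseteq> Idl ?Y <+>\<^bsub>R\<^esub> A"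
    unfolding X(3) by (intro genideal_minimal[OF id2] Un_least)
  moreover have "K \<subseteq> K <+>\<^bsub>R\<^esub> A"
  proof
    fix k assume "k \<in> K"
    then have "k = k \<oplus> \<zero>" by simp
    then show "k \<in> K <+>\<^bsub>R\<^esub> A"
      using \<open>k \<in> K\<close> additive_subgroup.zero_closed[OF ideal.axioms(1)[OF A]]
      unfolding set_add_def' by blast
  qed
  ultimately have "K \<subseteq> Idl ?Y <+>\<^bsub>R\<^esub> A" by (rule order_trans[rotated])
  moreover have "?Y \<subseteq> K" using g by blast
  ultimately show thesis using that[of ?Y] X(2) by simp
qed

text \<open>Take finite generators Y of J modulo A and Z of the intersection of J and A modulo B.
  Subtracting a combination of Y moves an element of J into A, and subtracting a combination of Z,
  which stays in A, moves it into B.\<close>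

lemma (in cring) finitely_generated_above_Int:
  assumes A: "ideal A R" "finitely_generated_above R A"
    and B: "ideal B R" "finitely_generated_above R B"
  shows "finitely_generated_above R (A \<inter> B)"
  unfolding finitely_generated_above_def
proof (intro allI impI)
  fix J assume J: "ideal J R" "A \<inter> B \<subseteq> J"
  interpret A: ideal A R by fact
  interpret B: ideal B R by fact
  interpret J: ideal J R by fact
  have JA: "ideal (J \<inter> A) R" by (rule i_intersect[OF J(1) A(1)])
  obtain Y where Y: "Y \<subseteq> J" "finite Y" "J \<subseteq> Idl Y <+>\<^bsub>R\<^esub> A"
    by (rule finite_generators_modulo[OF A(2,1) J(1)])
  obtain Z where Z: "Z \<subseteq> J \<inter> A" "finite Z" "J \<inter> A \<subseteq> Idl Z <+>\<^bsub>R\<^esub> B"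
    by (rule finite_generators_modulo[OF B(2,1) JA])
  let ?X = "(Y \<union> Z) \<union> A \<inter> B"
  have YJ: "Idl Y \<subseteq> J" by (rule genideal_minimal[OF J(1) Y(1)])
  have ZJ: "Idl Z \<subseteq> J \<inter> A" by (rule genideal_minimal[OF JA Z(1)])
  have XJ: "?X \<subseteq> J" using Y(1) Z(1) J(2) by blast
  then have Xc: "?X \<subseteq> carrier R" using J.a_subset by blast
  have id: "ideal (Idl ?X) R" by (rule genideal_ideal[OF Xc])
  have sub: "Idl Y \<subseteq> Idl ?X" "Idl Z \<subseteq> Idl ?X" "A \<inter> B \<subseteq> Idl ?X"
    using genideal_self[OF Xc] genideal_minimal[OF id, of Y] genideal_minimal[OF id, of Z] by blast+
  have "J \<subseteq> Idl ?X"
  proof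
    fix j assume j: "j \<in> J"
    then obtain y a where y: "y \<in> Idl Y" "a \<in> A" "j = y \<oplus> a"
      using Y(3) unfolding set_add_def' by blast
    have c: "j \<in> carrier R" "y \<in> carrier R" "a \<in> carrier R" using j y YJ by auto
    have yJ: "y \<in> J" using y(1) YJ by blast
    have "j \<ominus> y \<in> J" using j yJ by (simp add: a_minus_def)
    moreover have "j \<ominus> y = a" unfolding y(3) using c by algebra
    ultimately have "a \<in> J \<inter> A" using y(2) by simp
    then obtain z b where z: "z \<in> Idl Z" "b \<in> B" "a = z \<oplus> b"
      using Z(3) unfolding set_add_def' by blast
    have zA: "z \<in> A" using z(1) ZJ by blast
    have d: "z \<in> carrier R" "b \<in> carrier R" using zA z(2) by auto
    have "a \<ominus> z \<in> A" using y(2) zA by (simp add: a_minus_def)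
    moreover have "a \<ominus> z = b" unfolding z(3) using d by algebra
    ultimately have "b \<in> A \<inter> B" using z(2) by simp
    then have "y \<in> Idl ?X" "z \<in> Idl ?X" "b \<in> Idl ?X" using y(1) z(1) sub by blast+
    then have "y \<oplus> (z \<oplus> b) \<in> Idl ?X"
      by (intro additive_subgroup.a_closed[OF ideal.axioms(1)[OF id]])
    then show "j \<in> Idl ?X" by (simp only: y(3) z(3))
  qed
  moreover have "Idl ?X \<subseteq> J" by (rule genideal_minimal[OF J(1) XJ])
  moreover have "Y \<union> Z \<subseteq> carrier R" using Xc by blast
  ultimately show "\<exists>X\<subseteq>carrier R. finite X \<and> J = Idl (X \<union> A \<inter> B)"
    using Y(2) Z(2) by (intro exI[of _ "Y \<union> Z"]) auto
qed

section \<open>The coordinate axes\<close>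

lemma keys_subset_singleton:
  fixes m :: "'v \<Rightarrow>\<^sub>0 nat"
  assumes "keys m \<subseteq> {x}"
  shows "m = single x (lookup m x)"
proof (rule poly_mapping_eqI)
  fix y
  show "lookup m y = lookup (single x (lookup m x)) y"
    using assms by (cases "y = x") (auto simp: lookup_single in_keys_iff)
qed

text \<open>Modulo the ideal of the x-axis only the powers of x survive, so this is division with
  remainder in K[x]: an ideal above it is generated, modulo it, by one element of least degree on
  the axis.\<close>

lemma coordinate_line_finitely_generated:
  fixes V :: "'v set"
  assumes "x \<in> V"
  shows "finitely_generated_above (polynomial_ring V) (var_ideal V (V - {x}) :: ('v, 'k::field) mpoly set)"
    (is "finitely_generated_above ?S ?P")
  unfolding finitely_generated_above_def
proof (intro allI impI)
  interpret cring ?S by (rule polynomial_ring_cring)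
  fix J assume J: "ideal J ?S" "?P \<subseteq> J"
  have Jc: "J \<subseteq> carrier ?S" by (rule additive_subgroup.a_subset[OF ideal.axioms(1)[OF J(1)]])
  have P_iff: "p \<in> ?P \<longleftrightarrow> (\<forall>k. lookup p (single x k) = 0)" if p: "p \<in> carrier ?S" for p :: "('v, 'k) mpoly"
  proof
    assume "p \<in> ?P"
    then have "single x k \<notin> keys p" for k by (cases "k = 0") (auto simp: var_ideal_iff)
    then show "\<forall>k. lookup p (single x k) = 0" by (simp add: in_keys_iff)
  next
    assume 0: "\<forall>k. lookup p (single x k) = 0"
    show "p \<in> ?P"
      unfolding var_ideal_iff
    proof
      fix m assume m: "m \<in> keys p"
      have "\<not> keys m \<subseteq> {x}" using keys_subset_singleton[of m x] 0 m by (metis in_keys_iff)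
      then show "keys m \<subseteq> V \<and> keys m \<inter> (V - {x}) \<noteq> {}" using p m by auto
    qed
  qed
  have bound: "\<exists>n. \<forall>k\<ge>n. lookup p (single x k) = 0" for p :: "('v, 'k) mpoly"
  proof -
    have "finite {k. single x k \<in> keys p}"
      using finite_vimageI[OF finite_keys[of p], of "single x"] inj_single[of x]
      by (simp add: vimage_def)
    then obtain n where "\<forall>k\<in>{k. single x k \<in> keys p}. k < n"
      using finite_nat_set_iff_bounded by blast
    then show ?thesis by (intro exI[of _ n]) (auto simp: in_keys_iff)
  qed
  show "\<exists>X\<subseteq>carrier ?S. finite X \<and> J = Idl\<^bsub>?S\<^esub> (X \<union> ?P)"
  proof (cases "J \<subseteq> ?P")
    case True
    then have "J = Idl\<^bsub>?S\<^esub> ({} \<union> ?P)"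
      using J genideal_minimal[OF J(1), of ?P] genideal_self[of ?P] Jc by auto
    then show ?thesis by blast
  next
    case False
    \<comment> \<open>The degree on the x-axis is a relation, since polynomials vanishing on the
      axis have none.\<close>
    define lead where "lead d f \<longleftrightarrow> f \<in> J \<and> lookup f (single x d) \<noteq> 0 \<and> (\<forall>k>d. lookup f (single x k) = 0)" for d f
    have lead: "\<exists>d<n. lead d g" if g: "g \<in> J" "g \<notin> ?P" "\<forall>k\<ge>n. lookup g (single x k) = 0" for g n
    proof -
      have "g \<in> carrier ?S" using g(1) Jc by blast
      then obtain k where k: "lookup g (single x k) \<noteq> 0" using g(2) P_iff by blast
      define d where "d = (GREATEST k. lookup g (single x k) \<noteq> 0)"
      have b: "k \<le> n" if "lookup g (single x k) \<noteq> 0" for k using that g(3) by (meson nat_le_linear)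
      have d: "lookup g (single x d) \<noteq> 0" unfolding d_def using k b by (rule GreatestI_nat)
      moreover have "lookup g (single x j) = 0" if "j > d" for j
        using Greatest_le_nat[of "\<lambda>k. lookup g (single x k) \<noteq> 0" j n] b that
        unfolding d_def by (meson not_less)
      ultimately show ?thesis using g by (metis lead_def not_le)
    qed
    obtain g where g: "g \<in> J" "g \<notin> ?P" using False by blast
    obtain n where "\<forall>k\<ge>n. lookup g (single x k) = 0" using bound by blast
    then have ex: "\<exists>d. \<exists>f. lead d f" using lead[OF g] by blast
    define d where "d = (LEAST d. \<exists>f. lead d f)"
    obtain f where f: "lead d f" using LeastI_ex[OF ex] unfolding d_def by blast
    have least: "d \<le> e" if "lead e g" for e g unfolding d_def using that by (intro Least_le) blast
    have fJ: "f \<in> J" using f by (simp add: lead_def)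
    then have Xc: "{f} \<union> ?P \<subseteq> carrier ?S" using Jc J(2) by blast
    have id: "ideal (Idl\<^bsub>?S\<^esub> ({f} \<union> ?P)) ?S" by (rule genideal_ideal[OF Xc])
    have in_Idl: "f \<in> Idl\<^bsub>?S\<^esub> ({f} \<union> ?P)" "?P \<subseteq> Idl\<^bsub>?S\<^esub> ({f} \<union> ?P)"
      using genideal_self[OF Xc] by auto
    have "g \<in> Idl\<^bsub>?S\<^esub> ({f} \<union> ?P)" if "g \<in> J" "\<forall>k\<ge>n. lookup g (single x k) = 0" for g n
      using that
    proof (induction n arbitrary: g)
      case 0
      then have "g \<in> ?P" using P_iff Jc by blast
      then show ?case using in_Idl by blast
    next
      case (Suc n)
      show ?case
      proof (cases "g \<in> ?P")
        case True
        then show ?thesis using in_Idl by blast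
      next
        case False
        then have dn: "d \<le> n" using lead[OF Suc.prems(1) _ Suc.prems(2)] least by (meson less_Suc_eq_le order_trans)
        \<comment> \<open>Multiplying f by c x^(n - d) moves its leading term on the axis to x^n
          with the coefficient of g, so that the difference has only powers below n.\<close>
        define c where "c = lookup g (single x n) / lookup f (single x d)"
        let ?q = "single (single x (n - d)) c"
        have q: "?q \<in> carrier ?S" using assms by auto
        have shift: "lookup (f * ?q) (single x k) = lookup f (single x (k - (n - d))) * c" if "k \<ge> n" for k
        proof -
          have "single x k = single x (k - (n - d)) + single x (n - d)"
            using that by (simp flip: single_add)
          then show ?thesis by (simp add: lookup_mult_single)
        qed
        have "g - ?q * f \<in> Idl\<^bsub>?S\<^esub> ({f} \<union> ?P)"
        proof (rule Suc.IH)
          show "g - ?q * f \<in> J"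
            by (rule polynomial_ideal_diff[OF J(1) Suc.prems(1) polynomial_ideal_mult[OF J(1) q fJ]])
          show "\<forall>k\<ge>n. lookup (g - ?q * f) (single x k) = 0"
          proof (intro allI impI)
            fix k assume k: "n \<le> k"
            have "lookup (g - ?q * f) (single x k) = lookup g (single x k) - lookup f (single x (k - (n - d))) * c"
              using shift[OF k] by (simp add: lookup_minus mult.commute)
            also have "\<dots> = 0"
            proof (cases "k = n")
              case True
              then show ?thesis using dn f by (simp add: c_def lead_def)
            next
              case False
              then have "k - (n - d) > d" "k \<ge> Suc n" using k dn by auto
              then show ?thesis using f Suc.prems(2) by (simp add: lead_def)
            qed
            finally show "lookup (g - ?q * f) (single x k) = 0" .
          qed
        qed
        then have "g - ?q * f + ?q * f \<in> Idl\<^bsub>?S\<^esub> ({f} \<union> ?P)"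
          by (rule polynomial_ideal_add[OF id _ polynomial_ideal_mult[OF id q in_Idl(1)]])
        then show ?thesis by simp
      qed
    qed
    then have "J \<subseteq> Idl\<^bsub>?S\<^esub> ({f} \<union> ?P)" using bound by blast
    moreover have "Idl\<^bsub>?S\<^esub> ({f} \<union> ?P) \<subseteq> J" using fJ J(2) by (intro genideal_minimal[OF J(1)]) blast
    moreover have "{f} \<subseteq> carrier ?S" using Xc by blast
    ultimately show ?thesis by (intro exI[of _ "{f}"]) auto
  qed
qed

text \<open>A monomial is divisible by an edge of the complete graph exactly if it involves two
  variables, that is, if for each x it involves a variable other than x.\<close>

lemma squarefree_ideal_complete:
  fixes V :: "'v set"
  assumes "V \<noteq> {}"
  shows "(squarefree_ideal V (complete_edges V) :: ('v, 'k::field) mpoly set) =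
    carrier (polynomial_ring V) \<inter> (\<Inter>x\<in>V. var_ideal V (V - {x}))"
proof -
  have iff: "(\<exists>e\<in>complete_edges V. e \<subseteq> keys m) \<longleftrightarrow> (\<forall>x\<in>V. keys m \<inter> (V - {x}) \<noteq> {})"
    if m: "keys m \<subseteq> V" for m :: "'v \<Rightarrow>\<^sub>0 nat"
  proof
    assume "\<exists>e\<in>complete_edges V. e \<subseteq> keys m"
    then obtain a b where "a \<noteq> b" "{a, b} \<subseteq> keys m"
      by (auto simp: complete_edges_def card_2_iff)
    then show "\<forall>x\<in>V. keys m \<inter> (V - {x}) \<noteq> {}" using m by blast
  next
    assume 1: "\<forall>x\<in>V. keys m \<inter> (V - {x}) \<noteq> {}"
    obtain y where y: "y \<in> keys m" using 1 assms by blast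
    then obtain z where z: "z \<in> keys m" "z \<noteq> y" using 1 m by blast
    have "{y, z} \<in> complete_edges V" using y z m by (auto simp: complete_edges_def)
    then show "\<exists>e\<in>complete_edges V. e \<subseteq> keys m" by (rule bexI[rotated]) (simp add: y z(1))
  qed
  show ?thesis
  proof (rule Set.set_eqI)
    fix p :: "('v, 'k) mpoly"
    have "p \<in> squarefree_ideal V (complete_edges V) \<longleftrightarrow>
        (\<forall>m\<in>keys p. keys m \<subseteq> V \<and> (\<forall>x\<in>V. keys m \<inter> (V - {x}) \<noteq> {}))"
      unfolding squarefree_ideal_iff by (intro ball_cong refl conj_cong iff)
    also have "\<dots> \<longleftrightarrow> p \<in> carrier (polynomial_ring V) \<inter> (\<Inter>x\<in>V. var_ideal V (V - {x}))"
      by (simp add: var_ideal_iff) blast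
    finally show "p \<in> squarefree_ideal V (complete_edges V) \<longleftrightarrow>
        p \<in> carrier (polynomial_ring V) \<inter> (\<Inter>x\<in>V. var_ideal V (V - {x}))" .
  qed
qed

text \<open>The intersection with \<open>carrier\<close> gives the induction its start: for X = {}
  the ideal is the whole ring.\<close>

lemma intersection_of_lines_finitely_generated:
  assumes "finite X" "X \<subseteq> V"
  defines "A \<equiv> carrier (polynomial_ring V) \<inter> (\<Inter>x\<in>X. var_ideal V (V - {x})) :: ('v, 'k::field) mpoly set"
  shows "ideal A (polynomial_ring V) \<and> finitely_generated_above (polynomial_ring V) A"
  using assms(1,2) unfolding A_def
proof (induction X rule: finite_induct)
  case empty
  interpret cring "polynomial_ring V :: ('v, 'k) mpoly ring" by (rule polynomial_ring_cring)
  let ?c = "carrier (polynomial_ring V) :: ('v, 'k) mpoly set"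
  have "\<exists>X\<subseteq>?c. finite X \<and> J = Idl\<^bsub>polynomial_ring V\<^esub> (X \<union> ?c)"
    if J: "ideal J (polynomial_ring V)" "?c \<subseteq> J" for J
  proof -
    have "J \<subseteq> ?c" by (rule additive_subgroup.a_subset[OF ideal.axioms(1)[OF J(1)]])
    then have "J = Idl\<^bsub>polynomial_ring V\<^esub> ({} \<union> ?c)"
      using J(2) genideal_minimal[OF J(1), of ?c] genideal_self[of ?c] by auto
    then show ?thesis by blast
  qed
  then show ?case using oneideal by (simp add: finitely_generated_above_def)
next
  case (insert x X)
  let ?S = "polynomial_ring V :: ('v, 'k) mpoly ring"
  interpret cring ?S by (rule polynomial_ring_cring)
  let ?A = "carrier ?S \<inter> (\<Inter>x\<in>X. var_ideal V (V - {x}))"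
  have x: "ideal (var_ideal V (V - {x})) ?S"
    unfolding var_ideal_def by (rule key_ideal_ideal) (auto simp: keys_add_nat)
  have fx: "finitely_generated_above ?S (var_ideal V (V - {x}))"
    using insert.prems by (intro coordinate_line_finitely_generated) simp
  have A: "ideal ?A ?S" "finitely_generated_above ?S ?A" using insert.IH insert.prems by blast+
  have eq: "carrier ?S \<inter> (\<Inter>x\<in>insert x X. var_ideal V (V - {x})) = ?A \<inter> var_ideal V (V - {x})"
    by blast
  show ?case
    unfolding eq using i_intersect[OF A(1) x] finitely_generated_above_Int[OF A x fx] by (rule conjI)
qed

text \<open>If some variable x is outside P, the products xy in P force every other variable y into
  P; if there is no such x, any vertex will do.\<close>

lemma prime_contains_line:
  fixes P :: "('v, 'k::field) mpoly set"
  assumes "V \<noteq> {}" and P: "primeideal P (polynomial_ring V)"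
    and sub: "squarefree_ideal V (complete_edges V) \<subseteq> P"
  shows "\<exists>x\<in>V. var_ideal V (V - {x}) \<subseteq> P"
proof -
  have id: "ideal P (polynomial_ring V)" by (rule primeideal.axioms(1)[OF P])
  have "\<exists>x\<in>V. \<forall>y\<in>V - {x}. variable y \<in> P"
  proof (cases "\<forall>y\<in>V. variable y \<in> P")
    case True
    then show ?thesis using assms(1) by blast
  next
    case False
    then obtain x where x: "x \<in> V" "variable x \<notin> P" by blast
    have "variable y \<in> P" if y: "y \<in> V - {x}" for y
    proof -
      have "{x, y} \<in> complete_edges V" using x y by (auto simp: complete_edges_def)
      moreover have "{x, y} = keys (single x 1 + single y (1 :: nat))" by (auto simp: keys_add_nat)
      ultimately have "(variable x * variable y :: ('v, 'k) mpoly) \<in> squarefree_ideal V (complete_edges V)"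
        using x y by (auto simp: squarefree_ideal_iff variable_def monomial_def mult_single keys_add_nat)
      then have "variable x * variable y \<in> P" using sub by blast
      moreover have "variable x \<in> carrier (polynomial_ring V)" "variable y \<in> carrier (polynomial_ring V)"
        using x y by (auto simp: variable_def monomial_def)
      ultimately show ?thesis using polynomial_prime_mult[OF P] x(2) by blast
    qed
    then show ?thesis using x(1) by blast
  qed
  then show ?thesis using var_ideal_subset[OF id] by (metis Diff_subset)
qed

text \<open>
  Prime avoidance for the coordinate lines: if \<open>g\<close> lies in \<open>N\<close> but not in the ideal of the
  \<open>x\<close>-axis, add to its part in the single variable \<open>x\<close> all the other variables.
\<close>

lemma avoid_all_lines:
  fixes N :: "('v, 'k::field) mpoly set"
  assumes V: "finite V" and N: "maximalideal N (polynomial_ring V)" and x: "x \<in> V"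
    and xN: "var_ideal V (V - {x}) \<subseteq> N"
  shows "\<exists>f\<in>N. \<forall>y\<in>V. f \<notin> var_ideal V (V - {y})"
proof -
  interpret N: maximalideal N "polynomial_ring V" by fact
  note id = N.is_ideal
  \<comment> \<open>Otherwise N would lie in the irrelevant ideal and, being maximal, equal it; but
    the irrelevant ideal contains x.\<close>
  have "\<not> N \<subseteq> var_ideal V (V - {x})"
  proof
    assume "N \<subseteq> var_ideal V (V - {x})"
    moreover have "var_ideal V (V - {x}) \<subseteq> (var_ideal V V :: ('v, 'k) mpoly set)" by (rule var_ideal_mono) blast
    moreover have m: "maximalideal (var_ideal V V :: ('v, 'k) mpoly set) (polynomial_ring V)"
      by (rule irrelevant_ideal_maximal)
    ultimately have "var_ideal V V = N"
      using N.I_maximal[OF maximalideal.axioms(1)[OF m]] maximalideal.I_notcarr[OF m]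
        additive_subgroup.a_subset[OF ideal.axioms(1)[OF maximalideal.axioms(1)[OF m]]] by blast
    then have "variable x \<in> (var_ideal V (V - {x}) :: ('v, 'k) mpoly set)"
      using \<open>N \<subseteq> _\<close> x variable_in_var_ideal_iff[of x V V] by blast
    then show False by (simp add: variable_in_var_ideal_iff)
  qed
  then obtain g where g: "g \<in> N" "g \<notin> var_ideal V (V - {x})" by blast
  then obtain m where m: "m \<in> keys g" "keys m \<inter> (V - {x}) = {}"
    using polynomial_ideal_carrier[OF id g(1)] by (auto simp: var_ideal_iff)
  define K where "K = {m \<in> keys g. keys m \<inter> (V - {x}) = {}}"
  define p where "p = (\<Sum>m\<in>K. single m (lookup g m))"
  define q where "q = (\<Sum>y\<in>V - {x}. variable y :: ('v, 'k) mpoly)"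
  have finK: "finite K" by (simp add: K_def)
  have p: "lookup p k = (if k \<in> K then lookup g k else 0)" for k
    using finK by (simp add: p_def lookup_sum lookup_single when_def)
  have q: "lookup q k = (\<Sum>y\<in>V - {x}. if single y 1 = k then 1 else 0)" for k
    by (simp add: q_def lookup_sum lookup_single when_def variable_def monomial_def)
  have "g - p \<in> var_ideal V (V - {x})"
    unfolding var_ideal_iff
  proof
    fix k assume "k \<in> keys (g - p)"
    then have "k \<in> keys g" "k \<notin> K" by (auto simp: in_keys_iff lookup_minus p split: if_splits)
    then show "keys k \<subseteq> V \<and> keys k \<inter> (V - {x}) \<noteq> {}"
      using polynomial_ideal_carrier[OF id g(1)] by (simp add: K_def)
  qed
  then have "g - p \<in> N" using xN by blast
  then have "g - (g - p) \<in> N" by (rule polynomial_ideal_diff[OF id g(1)])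
  then have "p \<in> N" by simp
  moreover have "q \<in> N"
    unfolding q_def using xN by (intro polynomial_ideal_sum[OF id]) (auto simp: variable_in_var_ideal_iff)
  ultimately have "p + q \<in> N" by (rule polynomial_ideal_add[OF id])
  moreover have "p + q \<notin> var_ideal V (V - {y})" if y: "y \<in> V" for y
  proof (cases "y = x")
    case True
    have "m \<in> K" using m by (simp add: K_def)
    moreover have "lookup q m = 0" unfolding q using m(2) by (intro sum.neutral) auto
    ultimately have "m \<in> keys (p + q)" using m(1) by (simp add: in_keys_iff lookup_add p)
    then show ?thesis using m(2) True unfolding var_ideal_iff by blast
  next
    case False
    \<comment> \<open>On the y-axis p contributes at most a constant, so y keeps its coefficient 1
      from q.\<close>
    have "single y 1 \<notin> K" using False y by (auto simp: K_def)
    moreover have "lookup q (single y 1) = (\<Sum>z\<in>V - {x}. if z = y then 1 else 0)"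
      unfolding q by (intro sum.cong refl) (auto dest: arg_cong[of _ _ keys])
    then have "lookup q (single y 1) = 1" using V y False by simp
    ultimately have "single y 1 \<in> keys (p + q)" by (simp add: in_keys_iff lookup_add p)
    moreover have "keys (single y (1 :: nat)) \<inter> (V - {y}) = {}" by simp
    ultimately show ?thesis unfolding var_ideal_iff by blast
  qed
  ultimately show ?thesis by blast
qed

theorem complete_graph_cohen_macaulay:
  fixes V :: "'v set"
  assumes V: "finite V" "V \<noteq> {}"
  shows "cohen_macaulay_ideal V (squarefree_ideal V (complete_edges V) :: ('v, 'k::field) mpoly set)"
proof -
  let ?S = "polynomial_ring V :: ('v, 'k) mpoly ring"
  define I where "I = (squarefree_ideal V (complete_edges V) :: ('v, 'k) mpoly set)"
  interpret S: cring ?S by (rule polynomial_ring_cring)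
  have I_eq: "I = carrier ?S \<inter> (\<Inter>x\<in>V. var_ideal V (V - {x}))"
    unfolding I_def by (rule squarefree_ideal_complete[OF V(2)])
  have I: "ideal I ?S" and fg: "finitely_generated_above ?S I"
    using intersection_of_lines_finitely_generated[OF V(1) subset_refl] unfolding I_eq by blast+
  have fgJ: "\<exists>X\<subseteq>carrier ?S. finite X \<and> J = Idl\<^bsub>?S\<^esub> (X \<union> I)" if "ideal J ?S" "I \<subseteq> J" for J
    using fg that unfolding finitely_generated_above_def by blast
  interpret I: ideal I ?S by (rule I)
  have cringQ: "cring (?S Quot I)" by (rule I.quotient_is_cring[OF S.is_cring])
  interpret q: ring_hom_cring ?S "?S Quot I" "(+>\<^bsub>?S\<^esub>) I" by (rule I.rcos_ring_hom_cring[OF S.is_cring])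
  \<comment> \<open>With 1 as the only denominator the quotient itself counts as a ring of
    fractions, so \<open>noetherian_fractions\<close> applies to it as well as to the
    localizations.\<close>
  interpret q: fraction_hom ?S "?S Quot I" "(+>\<^bsub>?S\<^esub>) I" "{\<one>\<^bsub>?S\<^esub>}"
  proof unfold_locales
    fix a assume a: "a \<in> carrier (?S Quot I)"
    then obtain b where b: "b \<in> carrier ?S" "a = I +>\<^bsub>?S\<^esub> b" by (rule FactRing_carrier_rep)
    have "(I +>\<^bsub>?S\<^esub> \<one>\<^bsub>?S\<^esub>) \<otimes>\<^bsub>?S Quot I\<^esub> a = a"
      using a by (simp only: q.hom_one q.S.l_one)
    then show "\<exists>b\<in>carrier ?S. \<exists>s\<in>{\<one>\<^bsub>?S\<^esub>}. (I +>\<^bsub>?S\<^esub> s) \<otimes>\<^bsub>?S Quot I\<^esub> a = I +>\<^bsub>?S\<^esub> b"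
      using b by blast
  next
    show "{\<one>\<^bsub>?S\<^esub>} \<subseteq> carrier ?S" using S.one_closed by blast
    fix s assume "s \<in> {\<one>\<^bsub>?S\<^esub>}"
    then show "I +>\<^bsub>?S\<^esub> s \<in> Units (?S Quot I)" by (simp only: singleton_iff q.hom_one q.S.Units_one_closed)
  qed
  have "I +>\<^bsub>?S\<^esub> a = \<zero>\<^bsub>?S Quot I\<^esub>" if "a \<in> I" for a
    unfolding FactRing_zero by (rule I.a_rcos_const[OF that])
  then have noethQ: "noetherian_ring (?S Quot I)"
    using I.Icarr by (intro q.noetherian_fractions[OF _ fgJ]) auto
  have line: "\<exists>x\<in>V. var_ideal V (V - {x}) \<subseteq> P" if "primeideal P ?S" "I \<subseteq> P" for P
    using prime_contains_line[OF V(2) that(1)] that(2) unfolding I_def by blast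
  have "cohen_macaulay_local_ring (localization_at (?S Quot I) M)" if M: "maximalideal M (?S Quot I)" for M
  proof -
    let ?L = "localization_at (?S Quot I) M"
    define N where "N = {a \<in> carrier ?S. I +>\<^bsub>?S\<^esub> a \<in> M}"
    define h where "h a = loc_frac (?S Quot I) (carrier (?S Quot I) - M) (I +>\<^bsub>?S\<^esub> a) \<one>\<^bsub>?S Quot I\<^esub>" for a
    have Mp: "primeideal M (?S Quot I)" by (rule cring.maximalideal_prime[OF cringQ M])
    interpret L: local_fraction_hom ?S ?L h I N
      using quotient_localization_hom[OF S.is_cring I Mp] unfolding N_def h_def .
    have N: "maximalideal N ?S" unfolding N_def by (rule S.quotient_vimage_maximalideal[OF I M])
    obtain x where x: "x \<in> V" "var_ideal V (V - {x}) \<subseteq> N" using line[OF L.N L.I_subset] by blast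
    obtain f where f: "f \<in> N" "\<forall>y\<in>V. f \<notin> var_ideal V (V - {y})"
      using avoid_all_lines[OF V(1) N x] by blast
    show ?thesis
    proof (rule L.cohen_macaulay_local_dim_one)
      show "noetherian_ring ?L"
        using I.Icarr L.I_zero by (intro L.noetherian_fractions[OF _ fgJ]) auto
      show "f \<in> N" by fact
    next
      fix n Q assume Q: "prime_chain ?S n Q" "I \<subseteq> Q 0"
      then have "primeideal (Q 0) ?S" by (simp add: prime_chain_def)
      then obtain y where y: "y \<in> V" "var_ideal V (V - {y}) \<subseteq> Q 0" using line Q(2) by blast
      \<comment> \<open>The axis ideal has |V| - 1 variables, which leaves room for chains of length
        at most one.\<close>
      have "card (V - {y}) + n \<le> card V"
        by (rule prime_chain_above_var_ideal[OF V(1) Diff_subset Q(1) y(2)])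
      then show "n \<le> 1" using V(1) y(1) by (simp add: card_Diff_singleton)
    next
      fix a assume a: "a \<in> carrier ?S" "f \<otimes>\<^bsub>?S\<^esub> a \<in> I"
      have fc: "f \<in> carrier ?S" using f(1) by (simp only: N_def mem_Collect_eq)
      \<comment> \<open>I is the intersection of the axis primes and f avoids every one of them, so
        f can be cancelled.\<close>
      have "a \<in> var_ideal V (V - {y})" if y: "y \<in> V" for y
      proof -
        have "f * a \<in> var_ideal V (V - {y})" using a(2) y unfolding I_eq polynomial_ring_simps(2) by blast
        then show ?thesis
          using polynomial_prime_mult[OF var_ideal_prime[OF V(1)] fc a(1)] f(2) y by blast
      qed
      then show "a \<in> I" using a(1) unfolding I_eq by blast
    qed
  qed
  then show ?thesis
    using cringQ noethQ by (simp add: cohen_macaulay_ideal_def cohen_macaulay_ring_def I_def)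
qed

section \<open>Maximum matchings that are induced\<close>

text \<open>These are the supports of the generators of the k-th matching power; matchings with the
  same vertex set give the same generator.\<close>

definition matched_sets :: "'v set set \<Rightarrow> nat \<Rightarrow> 'v set set" where
  "matched_sets E k = {\<Union>M | M. is_matching E M \<and> card M = k}"

lemma matched_sets_1: "matched_sets E 1 = E"
proof -
  have "is_matching E {e}" if "e \<in> E" for e using that by (simp add: is_matching_def)
  then show ?thesis
    unfolding matched_sets_def by (fastforce simp: card_1_singleton_iff is_matching_def)
qed

text \<open>Removing x from a minimal cover D uncovers some f, which then meets D in x alone. The
  cover is sought inside a prescribed T in order to keep it away from given vertices.\<close>

lemma minimal_cover_exists:
  assumes "finite T" "\<And>f. f \<in> F \<Longrightarrow> f \<inter> T \<noteq> {}"
  shows "\<exists>D\<subseteq>T. (\<forall>f\<in>F. f \<inter> D \<noteq> {}) \<and> (\<forall>x\<in>D. \<exists>f\<in>F. f \<inter> D = {x})"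
proof -
  define A where "A = {D. D \<subseteq> T \<and> (\<forall>f\<in>F. f \<inter> D \<noteq> {})}"
  have "finite A" "T \<in> A" using assms by (auto simp: A_def)
  then obtain D where D: "D \<in> A" "\<forall>D'\<in>A. D' \<subseteq> D \<longrightarrow> D' = D"
    using finite_has_minimal2[of A T] by auto
  have "\<exists>f\<in>F. f \<inter> D = {x}" if "x \<in> D" for x
  proof -
    have "D - {x} \<notin> A" using D(2) that by blast
    then obtain f where "f \<in> F" "f \<inter> (D - {x}) = {}" using D(1) by (auto simp: A_def)
    moreover from this have "f \<inter> D \<noteq> {}" using D(1) by (auto simp: A_def)
    ultimately show ?thesis by blast
  qed
  then show ?thesis using D(1) unfolding A_def by blast
qed

lemma graph_connected_closed:
  assumes "graph_connected V E" "Z \<subseteq> V" "Z \<noteq> {}"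
    and closed: "\<And>y z. y \<in> Z \<Longrightarrow> {y, z} \<in> E \<Longrightarrow> z \<in> Z"
  shows "Z = V"
proof -
  obtain x where x: "x \<in> Z" using assms(3) by blast
  have "v \<in> Z" if "v \<in> V" for v
  proof -
    have "(x, v) \<in> {(a, b). {a, b} \<in> E}\<^sup>*"
      using assms(1,2) x that by (auto simp: graph_connected_def)
    then show ?thesis using x by (induction rule: rtrancl_induct) (auto intro: closed)
  qed
  then show ?thesis using assms(2) by blast
qed

locale finite_simple_graph =
  fixes V :: "'v set" and E :: "'v set set"
  assumes finite_V: "finite V" and simple: "simple_graph V E"
begin

lemma edge_subset: "e \<in> E \<Longrightarrow> e \<subseteq> V"
  and card_edge: "e \<in> E \<Longrightarrow> card e = 2"
  using simple by (auto simp: simple_graph_def)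

lemma finite_E: "finite E"
  using edge_subset finite_V by (intro finite_subset[of E "Pow V"]) auto

lemma edge_neq: "{x, y} \<in> E \<Longrightarrow> x \<noteq> y"
  using card_edge[of "{x, y}"] by auto

lemma edge_pair: "e \<in> E \<Longrightarrow> x \<in> e \<Longrightarrow> \<exists>y. e = {x, y} \<and> y \<noteq> x"
  using card_edge[of e] by (auto simp: card_2_iff)

lemma matching_finite: "is_matching E M \<Longrightarrow> finite M"
  using finite_E finite_subset by (auto simp: is_matching_def)

lemma finite_matchings: "finite {M. is_matching E M}"
proof (rule finite_subset)
  show "{M. is_matching E M} \<subseteq> Pow E" by (auto simp: is_matching_def)
qed (simp add: finite_E)

lemma card_matching_le: "is_matching E M \<Longrightarrow> card M \<le> matching_number E"
  unfolding matching_number_def using finite_matchings by (intro Max_ge) auto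

lemma card_matched_vertices:
  assumes "is_matching E M"
  shows "card (\<Union>M) = 2 * card M"
proof -
  have "card (\<Union>M) = sum card M"
    using assms edge_subset finite_V unfolding is_matching_def
    by (intro card_Union_disjoint) (auto intro: finite_subset)
  also have "\<dots> = (\<Sum>e\<in>M. 2)"
    using assms by (intro sum.cong refl card_edge) (auto simp: is_matching_def)
  finally show ?thesis by simp
qed

lemma matched_sets_subset: "matched_sets E k \<subseteq> Pow V"
  using edge_subset by (auto simp: matched_sets_def is_matching_def)

lemma matching_insert:
  assumes "is_matching E M" "e \<in> E" "e \<inter> \<Union>M = {}"
  shows "is_matching E (insert e M)" "card (insert e M) = Suc (card M)"
proof -
  show "is_matching E (insert e M)"
    using assms by (auto simp: is_matching_def pairwise_insert disjnt_def)
  have "e \<noteq> {}" using card_edge[OF assms(2)] by auto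
  then have "e \<notin> M" using assms(3) by blast
  then show "card (insert e M) = Suc (card M)" using matching_finite[OF assms(1)] by simp
qed

lemma matching_subset: "is_matching E M \<Longrightarrow> N \<subseteq> M \<Longrightarrow> is_matching E N"
  unfolding is_matching_def by (blast intro: pairwise_subset)

lemma maximum_matching_meets:
  assumes "is_matching E M" "card M = matching_number E" "e \<in> E"
  shows "e \<inter> \<Union>M \<noteq> {}"
  using matching_insert[OF assms(1,3)] card_matching_le assms(2) by force

end

locale graph_with_induced_matching = finite_simple_graph +
  fixes M
  assumes induced: "is_induced_matching E M" and maximum: "card M = matching_number E"
begin

lemma matching: "is_matching E M"
  using induced by (simp add: is_induced_matching_def)

lemma M_subset: "M \<subseteq> E"
  using matching by (simp add: is_matching_def)

lemma same_edge: "e \<in> M \<Longrightarrow> f \<in> M \<Longrightarrow> x \<in> e \<Longrightarrow> x \<in> f \<Longrightarrow> e = f"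
  using matching unfolding is_matching_def pairwise_def disjnt_def by blast

text \<open>If the ends lie on two different edges of M, the induced condition leaves only these two
  edges on the four vertices. Ends on the same edge of M are settled by cardinality.\<close>

lemma edge_inside:
  assumes "f \<in> E" "f \<subseteq> \<Union>M"
  shows "f \<in> M"
proof -
  obtain x y where f: "f = {x, y}" using card_edge[OF assms(1)] by (auto simp: card_2_iff)
  obtain e e' where e: "e \<in> M" "e' \<in> M" "x \<in> e" "y \<in> e'" using assms(2) f by blast
  show ?thesis
  proof (cases "e = e'")
    case True
    then have "f \<subseteq> e" using f e by simp
    moreover have "e \<in> E" using e(1) M_subset by blast
    then have "finite e" "card e = card f"
      using finite_V edge_subset finite_subset card_edge assms(1) by (blast, metis)
    ultimately show ?thesis using e(1) card_subset_eq by metis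
  next
    case False
    then have "{g \<in> E. g \<subseteq> e \<union> e'} = {e, e'}"
      using induced e by (simp add: is_induced_matching_def)
    moreover have "f \<in> {g \<in> E. g \<subseteq> e \<union> e'}" using assms(1) f e(3,4) by simp
    ultimately have "f \<in> {e, e'}" by simp
    then show ?thesis using e by blast
  qed
qed

lemma remove_edge:
  assumes "e \<in> M"
  shows "is_matching E (M - {e})" "Suc (card (M - {e})) = card M" "\<Union>(M - {e}) = \<Union>M - e"
proof -
  show "is_matching E (M - {e})" using matching by (rule matching_subset) blast
  show "Suc (card (M - {e})) = card M" by (rule card_Suc_Diff1[OF matching_finite[OF matching] assms])
  show "\<Union>(M - {e}) = \<Union>M - e" using same_edge[OF _ assms] by blast
qed

text \<open>Otherwise \<open>{a, u}\<close> and \<open>{b, u'}\<close> could replace \<open>{a, b}\<close> in the maximum matching.\<close>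

lemma outer_neighbours_equal:
  assumes "{a, b} \<in> M" "{a, u} \<in> E" "{b, u'} \<in> E" "u \<notin> \<Union>M" "u' \<notin> \<Union>M"
  shows "u = u'"
proof (rule ccontr)
  assume "u \<noteq> u'"
  have ab: "a \<noteq> b" using assms(1) M_subset edge_neq by blast
  note r = remove_edge[OF assms(1)]
  have 1: "{a, u} \<inter> \<Union>(M - {{a, b}}) = {}" using r(3) assms(4) by auto
  note m = matching_insert[OF r(1) assms(2) 1]
  have "{b, u'} \<inter> \<Union>(insert {a, u} (M - {{a, b}})) = {}"
    using r(3) assms(1,4,5) \<open>u \<noteq> u'\<close> ab by auto
  note n = matching_insert[OF m(1) assms(3) this]
  show False using card_matching_le[OF n(1)] n(2) m(2) r(2) maximum by simp
qed

context
  fixes a b u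
  assumes ab: "{a, b} \<in> M" and au: "{a, u} \<in> E" "u \<notin> \<Union>M"
    and leaf: "\<And>u'. u' \<notin> \<Union>M \<Longrightarrow> {b, u'} \<notin> E"
begin

text \<open>Without outer neighbours every edge at b stays among the matched vertices, where all
  edges belong to M, and {a, b} is the only edge of M at b.\<close>

lemma leaf_neighbour:
  assumes "{b, y} \<in> E"
  shows "y = a"
proof -
  have "y \<in> \<Union>M" using assms leaf by blast
  moreover have "b \<in> \<Union>M" using ab by blast
  ultimately have "{b, y} \<in> M" using assms by (intro edge_inside) auto
  then have "{b, y} = {a, b}" using same_edge[of "{b, y}" "{a, b}" b] ab by blast
  then show ?thesis using edge_neq[OF assms] by (auto simp: doubleton_eq_iff)
qed

text \<open>A maximum matching that avoids a also avoids the leaf b, and {a, b} could be added to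
  it.\<close>

lemma stem_in_maximum_matching:
  assumes N: "is_matching E N" "card N = matching_number E"
  shows "a \<in> \<Union>N"
proof (rule ccontr)
  assume a: "a \<notin> \<Union>N"
  have "b \<notin> \<Union>N"
  proof
    assume "b \<in> \<Union>N"
    then obtain e where e: "e \<in> N" "b \<in> e" by blast
    then obtain y where "e = {b, y}" "{b, y} \<in> E" using edge_pair[of e b] N(1) by (auto simp: is_matching_def)
    then show False using leaf_neighbour e(1) a by blast
  qed
  then have "{a, b} \<inter> \<Union>N = {}" using a by blast
  moreover have "{a, b} \<in> E" using ab M_subset by blast
  ultimately show False using maximum_matching_meets[OF N] by blast
qed

text \<open>The cover is chosen among the vertices that are not common to all matched sets, so no
  single vertex of it can be a cover. It is meant for comparison with the cover {a}.\<close>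

lemma leaf_not_unmixed:
  "\<exists>D\<subseteq>V. (\<forall>f\<in>matched_sets E (matching_number E). f \<inter> D \<noteq> {}) \<and>
     (\<forall>x\<in>D. \<exists>f\<in>matched_sets E (matching_number E). f \<inter> D = {x}) \<and> 1 < card D"
proof -
  let ?F = "matched_sets E (matching_number E)"
  \<comment> \<open>Replacing {a, b} by {a, u} gives a second maximum matching, one that misses
    b.\<close>
  define N where "N = insert {a, u} (M - {{a, b}})"
  note r = remove_edge[OF ab]
  have 1: "{a, u} \<inter> \<Union>(M - {{a, b}}) = {}" using r(3) au(2) by auto
  note m = matching_insert[OF r(1) au(1) 1]
  have abne: "a \<noteq> b" using ab M_subset edge_neq by blast
  have "is_matching E N" "card N = matching_number E" using m r(2) maximum by (simp_all add: N_def)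
  then have F: "\<Union>M \<in> ?F" "\<Union>N \<in> ?F"
    using matching maximum unfolding matched_sets_def by blast+
  have bN: "b \<notin> \<Union>N" using r(3) ab abne au(2) by (auto simp: N_def)
  \<comment> \<open>A matched set inside the common part would be contained in the vertex set of M
    and miss b, although all matched sets here have the same size.\<close>
  have "f \<inter> (V - \<Inter>?F) \<noteq> {}" if f: "f \<in> ?F" for f
  proof
    assume "f \<inter> (V - \<Inter>?F) = {}"
    then have "f \<subseteq> \<Inter>?F" using f matched_sets_subset by blast
    then have "f \<subseteq> \<Union>M" "b \<notin> f" using F bN by blast+
    moreover have "b \<in> \<Union>M" using ab by blast
    ultimately have "f \<subset> \<Union>M" by blast
    moreover have "\<Union>M \<subseteq> V" using F(1) matched_sets_subset by blast
    then have "finite (\<Union>M)" using finite_V by (rule finite_subset)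
    ultimately have "card f < card (\<Union>M)" by (intro psubset_card_mono)
    moreover have "card f = card (\<Union>M)"
      using f F(1) card_matched_vertices by (auto simp: matched_sets_def)
    ultimately show False by simp
  qed
  then have "\<exists>D\<subseteq>V - \<Inter>?F. (\<forall>f\<in>?F. f \<inter> D \<noteq> {}) \<and> (\<forall>x\<in>D. \<exists>f\<in>?F. f \<inter> D = {x})"
    by (intro minimal_cover_exists finite_Diff finite_V)
  then obtain D where D: "D \<subseteq> V - \<Inter>?F" "\<forall>f\<in>?F. f \<inter> D \<noteq> {}" "\<forall>x\<in>D. \<exists>f\<in>?F. f \<inter> D = {x}"
    by (elim exE conjE)
  have finD: "finite D" using D(1) by (rule finite_subset) (simp add: finite_V)
  have "card D \<noteq> 0" using D(2) F(1) finD by auto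
  moreover have "card D \<noteq> 1"
  proof
    assume "card D = 1"
    then obtain d where d: "D = {d}" by (auto simp: card_1_singleton_iff)
    then have "d \<in> \<Inter>?F" using D(2) by blast
    then show False using D(1) d by blast
  qed
  ultimately have "1 < card D" by linarith
  then show ?thesis using D by (intro exI[of _ D]) blast
qed

end

end

text \<open>The hypothesis \<open>unmixed\<close> isolates what Cohen-Macaulayness contributes to
  the graph argument. It is applied to the highest power, to exclude leaves on M, and to the edge
  ideal itself, to reduce the triangles to one.\<close>

theorem cameron_walker_unmixed:
  fixes V :: "'v set" and E :: "'v set set"
  assumes "finite V" "simple_graph V E" "no_isolated_vertices V E" "cameron_walker V E"
    and unmixed: "\<And>k C D. 1 \<le> k \<Longrightarrow> k \<le> matching_number E \<Longrightarrow>
      C \<subseteq> V \<Longrightarrow> (\<And>f. f \<in> matched_sets E k \<Longrightarrow> f \<inter> C \<noteq> {}) \<Longrightarrow>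
      D \<subseteq> V \<Longrightarrow> (\<And>f. f \<in> matched_sets E k \<Longrightarrow> f \<inter> D \<noteq> {}) \<Longrightarrow>
      (\<And>x. x \<in> D \<Longrightarrow> \<exists>f\<in>matched_sets E k. f \<inter> D = {x}) \<Longrightarrow> card D \<le> card C"
  shows "E = complete_edges V \<and> (card V = 2 \<or> card V = 3)"
proof -
  interpret finite_simple_graph V E using assms(1,2) by unfold_locales
  have conn: "graph_connected V E" and eq: "matching_number E = induced_matching_number E"
    using assms(4) by (auto simp: cameron_walker_def)
  have "induced_matching_number E \<in> card ` {M. is_induced_matching E M}"
    unfolding induced_matching_number_def
  proof (rule Max_in)
    have "{M. is_induced_matching E M} \<subseteq> {M. is_matching E M}" by (auto simp: is_induced_matching_def)
    then show "finite (card ` {M. is_induced_matching E M})"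
      using finite_matchings finite_subset by blast
    have "is_induced_matching E {}" by (simp add: is_induced_matching_def is_matching_def)
    then show "card ` {M. is_induced_matching E M} \<noteq> {}" by blast
  qed
  then obtain M where M: "is_induced_matching E M" "card M = matching_number E" using eq by auto
  interpret graph_with_induced_matching V E M using M by unfold_locales
  let ?W = "\<Union>M"
  have W: "?W \<subseteq> V" using M_subset edge_subset by blast
  obtain v where "v \<in> V" using conn by (auto simp: graph_connected_def)
  then obtain e where e: "e \<in> E" using assms(3) by (auto simp: no_isolated_vertices_def)
  have "M \<noteq> {}" using maximum_matching_meets[OF matching maximum e] by auto
  then have pos: "1 \<le> matching_number E"
    using maximum matching_finite[OF matching] by (metis One_nat_def Suc_leI card_gt_0_iff)
  have meets: "f \<inter> ?W \<noteq> {}" if "f \<in> E" for f using maximum_matching_meets[OF matching maximum that] .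
  have both: "{b, u} \<in> E" if ab: "{a, b} \<in> M" and au: "{a, u} \<in> E" "u \<notin> ?W" for a b u
  proof (rule ccontr)
    assume bu: "{b, u} \<notin> E"
    have leaf: "{b, u'} \<notin> E" if "u' \<notin> ?W" for u'
      using outer_neighbours_equal[OF ab au(1) _ au(2) that] bu by blast
    obtain D where D: "D \<subseteq> V" "\<forall>f\<in>matched_sets E (matching_number E). f \<inter> D \<noteq> {}"
      "\<forall>x\<in>D. \<exists>f\<in>matched_sets E (matching_number E). f \<inter> D = {x}" "1 < card D"
      using leaf_not_unmixed[OF ab au leaf] by blast
    have "card D \<le> card {a}"
    proof (rule unmixed[OF pos order_refl _ _ D(1) D(2)[rule_format] D(3)[rule_format]])
      show "{a} \<subseteq> V" using ab W by blast
      fix f assume "f \<in> matched_sets E (matching_number E)"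
      then have "a \<in> f"
        using stem_in_maximum_matching[OF ab au leaf] by (auto simp: matched_sets_def)
      then show "f \<inter> {a} \<noteq> {}" by blast
    qed
    then show False using D(4) by simp
  qed
  show ?thesis
  proof (cases "\<exists>e\<in>M. \<forall>x\<in>e. \<forall>u. u \<notin> ?W \<longrightarrow> {x, u} \<notin> E")
    case True
    then obtain e where e: "e \<in> M" "\<And>x u. x \<in> e \<Longrightarrow> u \<notin> ?W \<Longrightarrow> {x, u} \<notin> E" by blast
    have eE: "e \<in> E" "card e = 2" using e(1) M_subset card_edge by auto
    \<comment> \<open>An edge of M without outer neighbours is a connected component, hence the
      whole graph.\<close>
    have "e = V"
    proof (rule graph_connected_closed[OF conn])
      show "e \<subseteq> V" by (rule edge_subset[OF eE(1)])
      show "e \<noteq> {}" using eE(2) by auto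
      fix y z assume yz: "y \<in> e" "{y, z} \<in> E"
      then have "{y, z} \<in> M" using e by (intro edge_inside) blast+
      then show "z \<in> e" using same_edge[of "{y, z}" e y] e(1) yz(1) by blast
    qed
    moreover have "f = V" if "f \<in> E" for f
      using that eE \<open>e = V\<close> edge_subset[OF that] card_edge[OF that] finite_V by (metis card_subset_eq)
    ultimately have "E = {V}" "card V = 2" using eE by auto
    moreover have "complete_edges V = {V}"
      using \<open>card V = 2\<close> card_subset_eq[OF finite_V] unfolding complete_edges_def
      by (metis (mono_tags, lifting) Collect_cong order_refl singleton_conv)
    ultimately show ?thesis by simp
  next
    case False
    then have ex: "\<exists>x\<in>e. \<exists>u. u \<notin> ?W \<and> {x, u} \<in> E" if "e \<in> M" for e using that by blast
    \<comment> \<open>Both ends of an edge of M have outer neighbours and these all coincide, so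
      each edge of M spans a triangle with exactly one outer vertex, its apex.\<close>
    have nb: "\<exists>u. u \<notin> ?W \<and> (\<forall>x\<in>e. {x, u} \<in> E \<and> (\<forall>z. z \<notin> ?W \<longrightarrow> {x, z} \<in> E \<longrightarrow> z = u))" if eM: "e \<in> M" for e
    proof -
      obtain x u where x: "x \<in> e" "u \<notin> ?W" "{x, u} \<in> E" using ex[OF eM] by blast
      obtain y where y: "e = {x, y}" using edge_pair[OF _ x(1)] eM M_subset by blast
      have xy: "{x, y} \<in> M" "{y, x} \<in> M" using eM y by (auto simp: insert_commute)
      have yu: "{y, u} \<in> E" by (rule both[OF xy(1) x(3,2)])
      have "z = u" if "z \<notin> ?W" "{x, z} \<in> E" for z
        by (rule outer_neighbours_equal[OF xy(1) that(2) yu that(1) x(2)])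
      moreover have "z = u" if "z \<notin> ?W" "{y, z} \<in> E" for z
        by (rule outer_neighbours_equal[OF xy(2) that(2) x(3) that(1) x(2)])
      ultimately show ?thesis using x yu y by (intro exI[of _ u]) blast
    qed
    then obtain h where h: "\<And>e. e \<in> M \<Longrightarrow> h e \<notin> ?W" "\<And>e x. e \<in> M \<Longrightarrow> x \<in> e \<Longrightarrow> {x, h e} \<in> E"
      "\<And>e x z. e \<in> M \<Longrightarrow> x \<in> e \<Longrightarrow> z \<notin> ?W \<Longrightarrow> {x, z} \<in> E \<Longrightarrow> z = h e" by metis
    obtain e0 where e0: "e0 \<in> M" using \<open>M \<noteq> {}\<close> by blast
    define u where "u = h e0"
    obtain x0 where x0: "x0 \<in> e0" using e0 M_subset card_edge[of e0] by fastforce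
    have uV: "u \<in> V" "u \<notin> ?W" using h(1)[OF e0] h(2)[OF e0 x0] edge_subset by (auto simp: u_def)
    \<comment> \<open>The triangles with apex u are closed under adjacency: by maximality of M an
      edge at u leads to a matched vertex, whose apex must be u, and an edge at one of their matched
      vertices leads to its partner or to u.\<close>
    have "insert u (\<Union>{e \<in> M. h e = u}) = V" (is "?Z = V")
    proof (rule graph_connected_closed[OF conn])
      show "?Z \<subseteq> V" using uV W by blast
      show "?Z \<noteq> {}" by blast
      fix y z assume y: "y \<in> ?Z" and yz: "{y, z} \<in> E"
      show "z \<in> ?Z"
      proof (cases "y = u")
        case True
        then obtain e where e: "e \<in> M" "z \<in> e" using meets[OF yz] uV(2) by blast
        have "u = h e" using h(3)[OF e uV(2)] yz True by (simp add: insert_commute)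
        then show ?thesis using e by blast
      next
        case False
        then obtain e where e: "e \<in> M" "h e = u" "y \<in> e" using y by blast
        show ?thesis
        proof (cases "z \<in> ?W")
          case True
          then have "{y, z} \<in> M" using e yz by (intro edge_inside) blast+
          then have "{y, z} = e" using same_edge[of "{y, z}" e y] e by blast
          then show ?thesis using e by blast
        next
          case False
          then show ?thesis using h(3)[OF e(1,3) False yz] e(2) by simp
        qed
      qed
    qed
    then have V_eq: "V = insert u ?W" and hu: "\<And>x. x \<in> ?W \<Longrightarrow> {x, u} \<in> E"
    proof -
      show 1: "V = insert u ?W" using \<open>?Z = V\<close> W uV by blast
      fix x assume x: "x \<in> ?W"
      then have "x \<in> ?Z" "x \<noteq> u" using \<open>?Z = V\<close> 1 uV(2) by blast+
      then show "{x, u} \<in> E" using h(2) by blast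
    qed
    have "\<forall>e\<in>M. \<exists>x. x \<in> e" using M_subset card_edge by (metis card.empty ex_in_conv subsetD zero_neq_numeral)
    then obtain g where g: "\<forall>e\<in>M. g e \<in> e" by metis
    \<comment> \<open>The cover of size t + 1 consists of the common vertex u and one end of every
      edge of M: an edge that avoids u lies among the matched vertices and hence belongs to
      M.\<close>
    have "card ?W \<le> card (insert u (g ` M))"
    proof (rule unmixed[OF order_refl pos], unfold matched_sets_1)
      show "insert u (g ` M) \<subseteq> V" using uV W g by blast
      show "f \<inter> insert u (g ` M) \<noteq> {}" if f: "f \<in> E" for f
      proof (cases "u \<in> f")
        case False
        then have "f \<subseteq> ?W" using edge_subset[OF f] V_eq by blast
        then have "f \<in> M" using f by (rule edge_inside[rotated])
        then show ?thesis using g by blast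
      qed blast
      show "?W \<subseteq> V" by (rule W)
      show "f \<inter> ?W \<noteq> {}" if "f \<in> E" for f using meets[OF that] .
      \<comment> \<open>The edge from x to the outer vertex u shows that x cannot be left
        out.\<close>
      show "\<exists>f\<in>E. f \<inter> ?W = {x}" if "x \<in> ?W" for x
        using hu[OF that] uV(2) that by (intro bexI[of _ "{x, u}"]) auto
    qed
    also have "\<dots> \<le> Suc (card M)"
      using matching_finite[OF matching] card_image_le[of M g] by (simp add: card_insert_if)
    finally have "card M = 1"
      using card_matched_vertices[OF matching] maximum pos by simp
    then have Me: "M = {e0}" using e0 by (auto simp: card_1_singleton_iff)
    then have V3: "V = insert u e0" "u \<notin> e0" using V_eq uV(2) by auto
    have ce: "card e0 = 2" "e0 \<in> E" using e0 M_subset card_edge by auto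
    then have "finite e0" by (metis card.infinite zero_neq_numeral)
    then have "card V = 3" using V3 ce by simp
    moreover have "complete_edges V \<subseteq> E"
    proof
      fix f assume "f \<in> complete_edges V"
      then have f: "f \<subseteq> V" "card f = 2" by (auto simp: complete_edges_def)
      show "f \<in> E"
      proof (cases "u \<in> f")
        case True
        then obtain x where "f = {x, u}" "x \<noteq> u" using f(2) by (auto simp: card_2_iff)
        then show ?thesis using f(1) V_eq hu by auto
      next
        case False
        then have "f \<subseteq> e0" using f(1) V3 by blast
        then have "f = e0" using ce(1) f(2) \<open>finite e0\<close> by (metis card_subset_eq)
        then show ?thesis using ce by simp
      qed
    qed
    moreover have "E \<subseteq> complete_edges V" using edge_subset card_edge by (auto simp: complete_edges_def)
    ultimately show ?thesis by blast
  qed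
qed

section \<open>Recognizing complete graphs and bounding matchings of small graphs\<close>

lemma isomorphic_to_complete_iff:
  assumes "finite V" "simple_graph V E"
  shows "isomorphic_to_complete V E n \<longleftrightarrow> E = complete_edges V \<and> card V = n"
proof
  assume "isomorphic_to_complete V E n"
  then obtain f where f: "bij_betw f V {..<n}"
    and iso: "\<And>x y. x \<in> V \<Longrightarrow> y \<in> V \<Longrightarrow> {x, y} \<in> E \<longleftrightarrow> {f x, f y} \<in> complete_edges {..<n}"
    by (auto simp: isomorphic_to_complete_def graph_isomorphic_def)
  have "{x, y} \<in> E" if "x \<in> V" "y \<in> V" "x \<noteq> y" for x y
  proof -
    have "f x \<noteq> f y" "f x \<in> {..<n}" "f y \<in> {..<n}" using f that by (auto simp: bij_betw_def inj_on_def)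
    then show ?thesis using iso[OF that(1,2)] by (auto simp: complete_edges_def)
  qed
  then have "complete_edges V \<subseteq> E" by (auto simp: complete_edges_def card_2_iff)
  moreover have "E \<subseteq> complete_edges V" using assms(2) by (auto simp: simple_graph_def complete_edges_def)
  moreover have "card V = n" using bij_betw_same_card[OF f] by simp
  ultimately show "E = complete_edges V \<and> card V = n" by blast
next
  assume E: "E = complete_edges V \<and> card V = n"
  then obtain f where f: "bij_betw f V {..<n}"
    using finite_same_card_bij[of V "{..<n}"] assms(1) by auto
  have "{x, y} \<in> E \<longleftrightarrow> {f x, f y} \<in> complete_edges {..<n}" if "x \<in> V" "y \<in> V" for x y
  proof -
    have "f x = f y \<longleftrightarrow> x = y" "f x \<in> {..<n}" "f y \<in> {..<n}"
      using f that by (auto simp: bij_betw_def inj_on_def)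
    \<comment> \<open>The isomorphism condition includes x = y, where both sides are false because a
      singleton is not an edge.\<close>
    then show ?thesis using E that by (cases "x = y") (auto simp: complete_edges_def)
  qed
  then show "isomorphic_to_complete V E n"
    using f by (auto simp: isomorphic_to_complete_def graph_isomorphic_def)
qed

lemma small_graph_matching_number:
  assumes "finite V" "simple_graph V E" "card V \<le> 3"
  shows "matching_number E \<le> 1"
proof -
  interpret finite_simple_graph V E using assms(1,2) by unfold_locales
  have "card M \<le> 1" if M: "is_matching E M" for M
  proof -
    have "card (\<Union>M) \<le> card V"
      using M edge_subset assms(1) by (intro card_mono) (auto simp: is_matching_def)
    then show ?thesis using card_matched_vertices[OF M] assms(3) by simp
  qed
  moreover have "is_matching E {}" by (simp add: is_matching_def)
  ultimately show ?thesis
    unfolding matching_number_def using finite_matchings by (subst Max_le_iff) auto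
qed

section \<open>Matching powers of edge ideals\<close>

lemma monomial_in_squarefree_ideal_iff:
  "monomial m \<in> (squarefree_ideal V F :: ('v, 'k::field) mpoly set) \<longleftrightarrow>
    keys m \<subseteq> V \<and> (\<exists>f\<in>F. f \<subseteq> keys m)"
  by (simp add: squarefree_ideal_iff monomial_def)

lemma indicator_exponent_le:
  assumes "finite A" "A \<subseteq> keys m"
  shows "lookup (indicator_exponent A) x \<le> lookup m x"
  using assms by (cases "x \<in> A") (auto simp: lookup_indicator_exponent in_keys_iff Suc_le_eq)

text \<open>Exponents add under multiplication, and disjointness keeps the sum of indicators an
  indicator.\<close>

lemma prod_indicator_monomials:
  fixes k :: nat and e :: "nat \<Rightarrow> 'v set"
  assumes "\<And>i. i < k \<Longrightarrow> finite (e i)"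
    and "\<And>i j. i < k \<Longrightarrow> j < k \<Longrightarrow> i \<noteq> j \<Longrightarrow> e i \<inter> e j = {}"
  shows "(\<Prod>i<k. monomial (indicator_exponent (e i))) =
    (monomial (indicator_exponent (\<Union>i<k. e i)) :: ('v, 'k::field) mpoly)"
proof -
  have "(\<Prod>i<n. monomial (u i)) = (monomial (\<Sum>i<n. u i) :: ('v, 'k) mpoly)" for n and u :: "nat \<Rightarrow> 'v \<Rightarrow>\<^sub>0 nat"
    by (induction n) (simp_all add: monomial_def mult_single)
  moreover have "(\<Sum>i<k. indicator_exponent (e i)) = indicator_exponent (\<Union>i<k. e i)"
    unfolding indicator_exponent_def using assms by (intro sum.UNION_disjoint[symmetric]) auto
  ultimately show ?thesis by simp
qed

context finite_simple_graph
begin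

lemma finite_edge: "e \<in> E \<Longrightarrow> finite e"
  using edge_subset finite_V finite_subset by blast

lemma edge_eqI: "e \<in> E \<Longrightarrow> f \<in> E \<Longrightarrow> e \<subseteq> f \<Longrightarrow> e = f"
  using card_edge finite_edge by (metis card_subset_eq)

lemma edge_ideal_eq_squarefree: "edge_ideal V E = (squarefree_ideal V E :: ('v, 'k::field) mpoly set)"
proof -
  have pair: "variable x * variable y = (monomial (indicator_exponent {x, y}) :: ('v, 'k) mpoly)"
    if "{x, y} \<in> E" for x y
    using edge_neq[OF that] by (simp add: variable_def monomial_def mult_single indicator_exponent_def)
  have "{variable x * variable y | x y. {x, y} \<in> E} =
      (monomial ` indicator_exponent ` E :: ('v, 'k) mpoly set)"
  proof (intro equalityI subsetI)
    fix p :: "('v, 'k) mpoly" assume "p \<in> {variable x * variable y | x y. {x, y} \<in> E}"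
    then obtain x y where "{x, y} \<in> E" "p = variable x * variable y" by blast
    then show "p \<in> monomial ` indicator_exponent ` E" using pair by simp
  next
    fix p :: "('v, 'k) mpoly" assume "p \<in> monomial ` indicator_exponent ` E"
    then obtain e where e: "e \<in> E" "p = monomial (indicator_exponent e)" by blast
    obtain x y where "e = {x, y}" using card_edge[OF e(1)] by (auto simp: card_2_iff)
    then have "{x, y} \<in> E" "p = variable x * variable y" using e pair[of x y] by simp_all
    then show "p \<in> {variable x * variable y | x y. {x, y} \<in> E}" by blast
  qed
  then show ?thesis
    unfolding edge_ideal_def using edge_subset
    by (simp only:) (intro genideal_squarefree[OF finite_V], blast)
qed

text \<open>Every monomial of the edge ideal is divisible by an edge monomial, and no edge contains
  another because all have two vertices.\<close>

lemma minimal_generators_edge_ideal: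
  "minimal_generators (edge_ideal V E :: ('v, 'k::field) mpoly set) = indicator_exponent ` E"
proof (intro equalityI subsetI)
  fix m assume m: "m \<in> minimal_generators (edge_ideal V E :: ('v, 'k) mpoly set)"
  then have "monomial m \<in> (squarefree_ideal V E :: ('v, 'k) mpoly set)"
    by (simp add: minimal_generators_def edge_ideal_eq_squarefree)
  then obtain e where e: "e \<in> E" "e \<subseteq> keys m" by (auto simp: monomial_in_squarefree_ideal_iff)
  have "monomial (indicator_exponent e) \<in> (squarefree_ideal V E :: ('v, 'k) mpoly set)"
    using e(1) edge_subset[OF e(1)] finite_edge[OF e(1)]
    by (auto simp: monomial_in_squarefree_ideal_iff keys_indicator_exponent)
  then have "indicator_exponent e = m"
    using m indicator_exponent_le[OF finite_edge[OF e(1)] e(2)]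
    by (simp add: minimal_generators_def edge_ideal_eq_squarefree)
  then show "m \<in> indicator_exponent ` E" using e(1) by blast
next
  fix m :: "'v \<Rightarrow>\<^sub>0 nat" assume "m \<in> indicator_exponent ` E"
  then obtain e where e: "e \<in> E" "m = indicator_exponent e" by blast
  have km: "keys m = e" using e finite_edge by (simp add: keys_indicator_exponent)
  have "n = m" if n: "monomial n \<in> (squarefree_ideal V E :: ('v, 'k) mpoly set)"
    and le: "\<forall>x. lookup n x \<le> lookup m x" for n
  proof -
    obtain f where f: "f \<in> E" "f \<subseteq> keys n" using n by (auto simp: monomial_in_squarefree_ideal_iff)
    have sub: "keys n \<subseteq> e" unfolding km[symmetric]
    proof
      fix x assume "x \<in> keys n"
      then show "x \<in> keys m" using le[rule_format, of x] by (simp add: in_keys_iff)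
    qed
    have "f = e" using f sub e(1) by (intro edge_eqI) auto
    show "n = m"
    proof (rule poly_mapping_eqI)
      fix x
      show "lookup n x = lookup m x"
        using le[rule_format, of x] indicator_exponent_le[of e n x] f(2) \<open>f = e\<close> finite_edge[OF e(1)]
        by (simp add: e(2))
    qed
  qed
  moreover have "monomial m \<in> (squarefree_ideal V E :: ('v, 'k) mpoly set)"
    using km e(1) edge_subset[OF e(1)] by (auto simp: monomial_in_squarefree_ideal_iff)
  ultimately show "m \<in> minimal_generators (edge_ideal V E :: ('v, 'k) mpoly set)"
    by (simp add: minimal_generators_def edge_ideal_eq_squarefree)
qed

lemma matching_power_eq_squarefree:
  "matching_power V (edge_ideal V E) k = (squarefree_ideal V (matched_sets E k) :: ('v, 'k::field) mpoly set)"
proof -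
  let ?X = "{\<Prod>i<k. monomial (u i) | u. (\<forall>i<k. u i \<in> minimal_generators (edge_ideal V E :: ('v, 'k) mpoly set)) \<and>
     (\<forall>i<k. \<forall>j<k. i \<noteq> j \<longrightarrow> keys (u i) \<inter> keys (u j) = {})} :: ('v, 'k) mpoly set"
  have "?X = monomial ` indicator_exponent ` matched_sets E k"
  proof (intro equalityI subsetI)
    fix p assume "p \<in> ?X"
    then obtain u where u: "p = (\<Prod>i<k. monomial (u i))" "\<forall>i<k. u i \<in> indicator_exponent ` E"
      "\<forall>i<k. \<forall>j<k. i \<noteq> j \<longrightarrow> keys (u i) \<inter> keys (u j) = {}"
      unfolding minimal_generators_edge_ideal by blast
    have "\<forall>i. \<exists>e. i < k \<longrightarrow> e \<in> E \<and> u i = indicator_exponent e" using u(2) by blast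
    then obtain e where e: "\<And>i. i < k \<Longrightarrow> e i \<in> E" "\<And>i. i < k \<Longrightarrow> u i = indicator_exponent (e i)" by metis
    have disj: "e i \<inter> e j = {}" if "i < k" "j < k" "i \<noteq> j" for i j
    proof -
      have "keys (u i) \<inter> keys (u j) = {}" using u(3) that by blast
      then show ?thesis using that(1,2) e finite_edge by (simp add: keys_indicator_exponent)
    qed
    have ne: "e i \<noteq> {}" if "i < k" for i using card_edge[OF e(1)[OF that]] by auto
    \<comment> \<open>Disjoint nonempty edges are distinct, so k factors come from a matching with
      exactly k edges.\<close>
    have "inj_on e {..<k}"
    proof (rule inj_onI, rule ccontr)
      fix i j assume ij: "i \<in> {..<k}" "j \<in> {..<k}" "e i = e j" "i \<noteq> j"
      then have "e i \<inter> e j = {}" by (intro disj) simp_all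
      then show False using ne[of i] ij by simp
    qed
    then have "card (e ` {..<k}) = k" by (simp add: card_image)
    moreover have "is_matching E (e ` {..<k})"
      unfolding is_matching_def
    proof
      show "e ` {..<k} \<subseteq> E" using e(1) by blast
      show "pairwise disjnt (e ` {..<k})" using disj by (auto simp: pairwise_def disjnt_def)
    qed
    ultimately have "(\<Union>i<k. e i) \<in> matched_sets E k" unfolding matched_sets_def by blast
    moreover have "p = (\<Prod>i<k. monomial (indicator_exponent (e i)))"
      unfolding u(1) using e(2) by (intro prod.cong refl) simp
    then have "p = monomial (indicator_exponent (\<Union>i<k. e i))"
      using prod_indicator_monomials[of k e] e(1) finite_edge disj by simp
    ultimately show "p \<in> monomial ` indicator_exponent ` matched_sets E k" by blast
  next
    fix p :: "('v, 'k) mpoly" assume "p \<in> monomial ` indicator_exponent ` matched_sets E k"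
    then obtain N where N: "is_matching E N" "card N = k" "p = monomial (indicator_exponent (\<Union>N))"
      by (auto simp: matched_sets_def)
    obtain e where e: "bij_betw e {..<k} N"
      using finite_same_card_bij[of "{..<k}" N] matching_finite[OF N(1)] N(2) by auto
    have eE: "e i \<in> E" if "i < k" for i using e that N(1) by (auto simp: bij_betw_def is_matching_def)
    have disj: "e i \<inter> e j = {}" if "i < k" "j < k" "i \<noteq> j" for i j
    proof -
      have "e i \<in> N" "e j \<in> N" "e i \<noteq> e j" using e that by (auto simp: bij_betw_def inj_on_def)
      then show ?thesis using N(1) by (auto simp: is_matching_def pairwise_def disjnt_def)
    qed
    have "(\<Prod>i<k. monomial (indicator_exponent (e i))) =
        (monomial (indicator_exponent (\<Union>i<k. e i)) :: ('v, 'k) mpoly)"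
      by (rule prod_indicator_monomials[OF finite_edge[OF eE] disj])
    moreover have "(\<Union>i<k. e i) = \<Union>N" using e by (auto simp: bij_betw_def)
    ultimately have "p = (\<Prod>i<k. monomial (indicator_exponent (e i)))" using N(3) by simp
    moreover have "keys (indicator_exponent (e i)) = e i" if "i < k" for i
      using finite_edge[OF eE[OF that]] by (rule keys_indicator_exponent)
    ultimately show "p \<in> ?X"
      unfolding minimal_generators_edge_ideal mem_Collect_eq
      using eE disj by (intro exI[of _ "\<lambda>i. indicator_exponent (e i)"]) simp
  qed
  then show ?thesis
    unfolding matching_power_def
    using genideal_squarefree[OF finite_V matched_sets_subset, of k, where 'k = 'k] by simp
qed

end

theorem theorem3p5:
  fixes V :: "'v set" and E :: "'v set set"
  assumes "finite V"
    and "simple_graph V E"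
    and "no_isolated_vertices V E"
    and "cameron_walker V E"
  shows "(\<forall>k. 1 \<le> k \<and> k \<le> matching_number E \<longrightarrow>
            cohen_macaulay_ideal V (matching_power V (edge_ideal V E :: ('v, 'k::field) mpoly set) k))
         \<longleftrightarrow> isomorphic_to_complete V E 2 \<or> isomorphic_to_complete V E 3"
proof -
  interpret finite_simple_graph V E using assms(1,2) by unfold_locales
  show ?thesis
    unfolding matching_power_eq_squarefree isomorphic_to_complete_iff[OF assms(1,2)]
  proof
    assume CM: "\<forall>k. 1 \<le> k \<and> k \<le> matching_number E \<longrightarrow>
      cohen_macaulay_ideal V (squarefree_ideal V (matched_sets E k) :: ('v, 'k) mpoly set)"
    have "E = complete_edges V \<and> (card V = 2 \<or> card V = 3)"
    proof (rule cameron_walker_unmixed[OF assms])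
      fix k C D
      assume k: "1 \<le> k" "k \<le> matching_number E"
        and C: "C \<subseteq> V" "\<And>f. f \<in> matched_sets E k \<Longrightarrow> f \<inter> C \<noteq> {}"
        and D: "D \<subseteq> V" "\<And>f. f \<in> matched_sets E k \<Longrightarrow> f \<inter> D \<noteq> {}"
          "\<And>x. x \<in> D \<Longrightarrow> \<exists>f\<in>matched_sets E k. f \<inter> D = {x}"
      have "\<exists>f\<in>matched_sets E k. f \<subseteq> V \<and> f \<inter> D = {x}" if "x \<in> D" for x
        using D(3)[OF that] matched_sets_subset by blast
      then show "card D \<le> card C"
        using cohen_macaulay_cover_card_le[OF assms(1) CM[rule_format, OF conjI[OF k]] C D(1,2)] by blast
    qed
    then show "E = complete_edges V \<and> card V = 2 \<or> E = complete_edges V \<and> card V = 3" by blast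
  next
    assume complete: "E = complete_edges V \<and> card V = 2 \<or> E = complete_edges V \<and> card V = 3"
    then have E: "E = complete_edges V" and V: "V \<noteq> {}" "card V \<le> 3" by auto
    \<comment> \<open>At most three vertices carry a matching of at most one edge, so only k = 1
      remains, where the matched sets are the edges.\<close>
    have "matching_number E \<le> 1" by (rule small_graph_matching_number[OF assms(1,2) V(2)])
    moreover have "cohen_macaulay_ideal V (squarefree_ideal V (matched_sets E 1) :: ('v, 'k) mpoly set)"
      unfolding matched_sets_1 using complete_graph_cohen_macaulay[OF assms(1) V(1)] E by simp
    ultimately show "\<forall>k. 1 \<le> k \<and> k \<le> matching_number E \<longrightarrow>
      cohen_macaulay_ideal V (squarefree_ideal V (matched_sets E k) :: ('v, 'k) mpoly set)"
      by (metis le_antisym le_trans)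
  qed
qed

end
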